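(* Let $\alpha\in[0,1]$, and let $(\lambda^{(j)})_{j\ge 1}$ be any sequence of integer partitions, $\lambda^{(j)}$ being a partition of $n_j\ge 1$, such that $n_j\to\infty$ and $\alpha_1(\lambda^{(j)})\to\alpha$ as $j\to\infty$. For a partition $\lambda$ of $n$, let $$W_{\lambda}=\left(\frac{d(\pi)-\frac{1-\alpha_1^2}{2}n}{n^{1/2}},\ \frac{\mathrm{maj}(\pi)-\frac{1-\alpha_1^2}{4}n^2}{n^{3/2}}\right),\qquad \alpha_1=\alpha_1(\lambda),$$ where $\pi$ is chosen uniformly at random from the conjugacy class $\mathcal{C}_\lambda$ of $S_n$. Then $W_{\lambda^{(j)}}$ converges in distribution, as $j\to\infty$, to a bivariate normal distribution with zero mean and covariance matrix $\Sigma_\alpha$ (which depends only on $\alpha$).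
   Context: For $\pi\in S_n$, a descent is a position $i\in\{1,\dots,n-1\}$ with $\pi(i)>\pi(i+1)$; $d(\pi)$ is the number of descents of $\pi$ plus $1$, and $\mathrm{maj}(\pi)$ is the sum of the positions at which $\pi$ has a descent. A partition $\lambda$ of $n$ is recorded by multiplicities: $\lambda_k$ is the number of parts equal to $k$, so $\sum_k k\lambda_k=n$. $\mathcal{C}_\lambda$ is the set of $\pi\in S_n$ having exactly $\lambda_k$ cycles of length $k$ for every $k\in\{1,\dots,n\}$. $\alpha_1(\lambda)=\lambda_1/n$ is the density of fixed points of elements of $\mathcal{C}_\lambda$. For $\alpha\in[0,1]$, $$\Sigma_\alpha=\begin{pmatrix}\frac1{12}(1-4\alpha^3+3\alpha^4)&\frac1{24}(1-4\alpha^3+3\alpha^4)\\ \frac1{24}(1-4\alpha^3+3\alpha^4)&\frac1{36}(1-\alpha^3)\end{pmatrix}.$$ Normal distributions are allowed to be degenerate. *)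

theory Defs
  imports "HOL-Probability.Probability" "HOL-Combinatorics.Orbits"
begin

section \<open>Permutation statistics\<close>

text \<open>
  Elements of the symmetric group on \<open>{1..n}\<close> are functions \<open>\<pi>\<close> with
  \<open>\<pi> permutes {1..n}\<close>, i.e. bijections of \<open>{1..n}\<close> extended by the identity.
\<close>

definition descents :: "nat \<Rightarrow> (nat \<Rightarrow> nat) \<Rightarrow> nat set" where
  "descents n \<pi> = {i \<in> {1..<n}. \<pi> i > \<pi> (i + 1)}"

definition des1 :: "nat \<Rightarrow> (nat \<Rightarrow> nat) \<Rightarrow> nat" where
  "des1 n \<pi> = card (descents n \<pi>) + 1"

definition maj :: "nat \<Rightarrow> (nat \<Rightarrow> nat) \<Rightarrow> nat" where
  "maj n \<pi> = (\<Sum>i\<in>descents n \<pi>. i)"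

section \<open>Partitions and conjugacy classes\<close>

text \<open>A partition is given by its multiplicity function: \<open>lam k\<close> is the number of parts equal to \<open>k\<close>.\<close>

definition partition_of :: "(nat \<Rightarrow> nat) \<Rightarrow> nat \<Rightarrow> bool" where
  "partition_of lam n \<longleftrightarrow>
     (\<forall>k. lam k \<noteq> 0 \<longrightarrow> 1 \<le> k \<and> k \<le> n) \<and> (\<Sum>k=1..n. k * lam k) = n"

text \<open>Cycles are identified with orbits; a fixed point is a cycle of length 1.\<close>

definition num_cycles :: "nat \<Rightarrow> (nat \<Rightarrow> nat) \<Rightarrow> nat \<Rightarrow> nat" where
  "num_cycles n \<pi> k = card {C. (\<exists>x\<in>{1..n}. C = orbit \<pi> x) \<and> card C = k}"

definition conj_class :: "nat \<Rightarrow> (nat \<Rightarrow> nat) \<Rightarrow> (nat \<Rightarrow> nat) set" where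
  "conj_class n lam = {\<pi>. \<pi> permutes {1..n} \<and> (\<forall>k\<in>{1..n}. num_cycles n \<pi> k = lam k)}"

definition fix_density :: "nat \<Rightarrow> (nat \<Rightarrow> nat) \<Rightarrow> real" where
  "fix_density n lam = real (lam 1) / real n"

definition W_stat :: "nat \<Rightarrow> (nat \<Rightarrow> nat) \<Rightarrow> (nat \<Rightarrow> nat) \<Rightarrow> real^2" where
  "W_stat n lam \<pi> = vector
     [(real (des1 n \<pi>) - (1 - (fix_density n lam)\<^sup>2) / 2 * real n) / real n powr (1/2),
      (real (maj n \<pi>) - (1 - (fix_density n lam)\<^sup>2) / 4 * (real n)\<^sup>2) / real n powr (3/2)]"

definition W_law :: "nat \<Rightarrow> (nat \<Rightarrow> nat) \<Rightarrow> (real^2) measure" where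
  "W_law n lam = distr (measure_pmf (pmf_of_set (conj_class n lam))) borel (W_stat n lam)"

section \<open>Normal distributions and convergence in distribution\<close>

text \<open>Univariate normal law with mean \<open>m\<close> and variance \<open>v\<close>; variance 0 gives a point mass.\<close>

definition is_normal1 :: "real \<Rightarrow> real \<Rightarrow> real measure \<Rightarrow> bool" where
  "is_normal1 m v M \<longleftrightarrow>
     (v = 0 \<and> M = return borel m) \<or>
     (v > 0 \<and> M = density lborel (\<lambda>x. ennreal (normal_density m (sqrt v) x)))"

text \<open>
  Multivariate normal law with mean vector \<open>m\<close> and covariance matrix \<open>S\<close>, possibly degenerate:
  every linear functional \<open>x \<mapsto> t \<bullet> x\<close> is univariate normal, with mean \<open>t \<bullet> m\<close>
  and variance \<open>t \<bullet> S t\<close>. Symmetry of \<open>S\<close> is required since the variances only see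
  its symmetric part.
\<close>

definition is_normal :: "real^'n \<Rightarrow> real^'n^'n \<Rightarrow> (real^'n) measure \<Rightarrow> bool" where
  "is_normal m S M \<longleftrightarrow>
     prob_space M \<and> sets M = sets borel \<and> (\<forall>i j. S $ i $ j = S $ j $ i) \<and>
     (\<forall>t. is_normal1 (t \<bullet> m) (t \<bullet> (S *v t)) (distr M borel (\<lambda>x. t \<bullet> x)))"

text \<open>
  The library's \<open>weak_conv_m\<close> is formulated through distribution functions on the real line
  only; here convergence is tested against bounded continuous functions.
\<close>

definition conv_in_distr :: "(nat \<Rightarrow> 'a::topological_space measure) \<Rightarrow> 'a measure \<Rightarrow> bool" where
  "conv_in_distr M N \<longleftrightarrow>
     (\<forall>f :: 'a \<Rightarrow> real. continuous_on UNIV f \<longrightarrow> bounded (range f) \<longrightarrow>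
        (\<lambda>j. integral\<^sup>L (M j) f) \<longlonglongrightarrow> integral\<^sup>L N f)"

definition Sigma_mat :: "real \<Rightarrow> real^2^2" where
  "Sigma_mat \<alpha> = vector
     [vector [1/12 * (1 - 4 * \<alpha>^3 + 3 * \<alpha>^4), 1/24 * (1 - 4 * \<alpha>^3 + 3 * \<alpha>^4)],
      vector [1/24 * (1 - 4 * \<alpha>^3 + 3 * \<alpha>^4), 1/36 * (1 - \<alpha>^3)]]"

end

theory Submission
  imports Defs
begin

text \<open>
  By the Gessel-Reutenauer correspondence, pairs of a permutation of cycle type \<open>\<lambda>\<close> and a weakly decreasing
  word over \<open>a\<close> letters that drops at the descents correspond to multisets of primitive necklaces with
  \<open>\<lambda>\<^sub>i\<close> necklaces of length \<open>i\<close>. Weighting a letter \<open>l\<close> by \<open>q^l\<close> gives an identity between the sum of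
  \<open>q^maj (\<Prod>j=1..n. (1 - z q^(j-d)) / (1 - q^j))\<close> over the class and a product over \<open>i\<close> of complete symmetric
  functions, valid for \<open>z = q^a\<close>. Both sides are polynomials in \<open>z\<close> and continuous in \<open>q\<close>, so the identity
  persists for real \<open>z\<close> and for \<open>q\<close> on the unit circle. There, with \<open>q = exp (\<i> \<theta>\<^sub>2 n^(-3/2))\<close> and
  \<open>z = \<theta>\<^sub>1 / (\<theta>\<^sub>1 + \<theta>\<^sub>2)\<close>, the left-hand side is the characteristic function of \<open>(d, maj)\<close> at \<open>(\<theta>\<^sub>1, \<theta>\<^sub>2)\<close>, up to
  a factor depending only on \<open>d / n\<close>. The factors with \<open>i \<ge> 2\<close> are asymptotically those of distinct
  primitive necklaces, so only the fixed points contribute beyond the uniform case. The same estimate with \<open>n^(-2)\<close> in place of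
  \<open>n^(-3/2)\<close> yields the law of large numbers for \<open>d / n\<close> that makes the extra factor constant.
\<close>


section \<open>Periodic words and complete symmetric functions\<close>


text \<open>The value of \<open>z\<close> is dictated by
  \<open>z / (1 - z) = \<theta>1 / \<theta>2\<close>: each factor
  \<open>(1 - z q^(j-d)) / (1 - z)\<close> becomes
  \<open>1 - (\<theta>1/\<theta>2) (q^(j-d) - 1)\<close>, whose first-order term puts
  \<open>d\<close> into the phase beside \<open>maj\<close>. The second-order term is real and
  leaves the extra factor, with constant
  \<open>\<kappa> = \<theta>1 (\<theta>1 + \<theta>2)\<close>. The price is that \<theta>2 = 0 and
  \<theta>1 + \<theta>2 = 0 are excluded, so characteristic functions are controlled only off two
  lines, and the continuity theorem has to live with that. Fixed points differ from longer cycles by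
  a count of powers. With \<eta> of order |q - 1|, a correction in the Newton recursion for cycles
  of length i has relative size (n \<eta>^i)^k, and there are at most n steps. For \<eta> of order
  n^(-3/2) and i \<ge> 2 the total n (n \<eta>^2) tends to 0; for i = 1 this count fails, so that
  factor is evaluated in closed form. The cubes of \<alpha> in the covariance come from sums of k^2
  over k up to and beyond the number of fixed points, the fourth power from the distance of the mean
  of d/n from 1/2.\<close>

text \<open>A primitive necklace of length \<open>k\<close> is represented by its \<open>k\<close> infinite periodic readings.\<close>

definition period_words :: "nat \<Rightarrow> nat \<Rightarrow> (nat \<Rightarrow> nat) set" where
  "period_words a k = {u. (\<forall>j. u j < a) \<and> (\<forall>j. u (j + k) = u j)}"

definition prim_words :: "nat \<Rightarrow> nat \<Rightarrow> (nat \<Rightarrow> nat) set" where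
  "prim_words a k = {u \<in> period_words a k. 0 < k \<and> (\<forall>i. 0 < i \<longrightarrow> i < k \<longrightarrow> (\<exists>j. u (j + i) \<noteq> u j))}"

definition shift :: "nat \<Rightarrow> (nat \<Rightarrow> nat) \<Rightarrow> nat \<Rightarrow> nat" where
  "shift j u = (\<lambda>t. u (t + j))"

lemma shift_0 [simp]: "shift 0 u = u"
  by (simp add: shift_def)

lemma shift_shift [simp]: "shift i (shift j u) = shift (i + j) u"
  by (auto simp: shift_def algebra_simps)

lemma period_words_iff_shift: "u \<in> period_words a k \<longleftrightarrow> (\<forall>j. u j < a) \<and> shift k u = u"
  by (auto simp: period_words_def shift_def fun_eq_iff)

lemma shift_mult_period: "shift k u = u \<Longrightarrow> shift (k * m) u = u"
proof (induction m)
  case (Suc m)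
  have "shift (k * Suc m) u = shift (k * m) (shift k u)" by (simp add: algebra_simps)
  then show ?case using Suc by simp
qed simp

lemma shift_mod_period: "shift k u = u \<Longrightarrow> shift (m mod k) u = shift m u"
proof -
  assume k: "shift k u = u"
  have "shift m u = shift (m mod k) (shift (k * (m div k)) u)"
    by simp
  then show ?thesis using shift_mult_period[OF k] by simp
qed

lemma period_words_mod: "u \<in> period_words a k \<Longrightarrow> u (j mod k) = u j"
proof -
  assume u: "u \<in> period_words a k"
  then have "shift k u = u" by (simp add: period_words_iff_shift)
  then have "shift (j mod k) u 0 = shift j u 0" by (simp add: shift_mod_period)
  then show ?thesis by (simp add: shift_def)
qed

lemma prim_words_iff_shift:
  "u \<in> prim_words a k \<longleftrightarrow> 0 < k \<and> (\<forall>j. u j < a) \<and> shift k u = u \<and> (\<forall>i. 0 < i \<longrightarrow> i < k \<longrightarrow> shift i u \<noteq> u)"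
  by (auto simp: prim_words_def period_words_iff_shift shift_def fun_eq_iff)

lemma prim_words_period: "u \<in> prim_words a k \<Longrightarrow> shift k u = u"
  by (simp add: prim_words_iff_shift)

lemma prim_words_pos: "u \<in> prim_words a k \<Longrightarrow> 0 < k"
  by (simp add: prim_words_iff_shift)

lemma prim_words_dvd:
  assumes "u \<in> prim_words a i" "shift k u = u"
  shows "i dvd k"
proof -
  have "shift (k mod i) u = u"
    using assms by (simp add: shift_mod_period prim_words_iff_shift)
  moreover have "k mod i < i" using assms by (simp add: prim_words_iff_shift)
  ultimately have "k mod i = 0" using assms(1) by (auto simp: prim_words_iff_shift)
  then show ?thesis by auto
qed

lemma prim_words_unique: "u \<in> prim_words a i \<Longrightarrow> u \<in> prim_words a k \<Longrightarrow> i = k"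
  by (meson dvd_antisym prim_words_dvd prim_words_period)

lemma period_words_prim:
  assumes "u \<in> period_words a k" "0 < k"
  obtains i where "u \<in> prim_words a i" "i dvd k"
proof -
  define i where "i = (LEAST i. 0 < i \<and> shift i u = u)"
  have ex: "0 < k \<and> shift k u = u" using assms by (simp add: period_words_iff_shift)
  have "0 < i \<and> shift i u = u" unfolding i_def by (rule LeastI[of _ k]) (use ex in auto)
  moreover have "shift j u \<noteq> u" if "0 < j" "j < i" for j
    using not_less_Least[of j "\<lambda>i. 0 < i \<and> shift i u = u"] that unfolding i_def by auto
  ultimately have "u \<in> prim_words a i" using assms by (auto simp: prim_words_iff_shift period_words_iff_shift)
  moreover from this have "i dvd k" using ex prim_words_dvd by blast
  ultimately show ?thesis by (rule that)
qed

lemma prim_words_dvd_period: "u \<in> prim_words a i \<Longrightarrow> i dvd k \<Longrightarrow> u \<in> period_words a k"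
  by (auto simp: prim_words_iff_shift period_words_iff_shift shift_mult_period elim!: dvdE)

lemma bij_betw_period_words:
  assumes "0 < k"
  shows "bij_betw (\<lambda>u. restrict u {..<k}) (period_words a k) (PiE {..<k} (\<lambda>_. {..<a}))"
proof (rule bij_betwI[where g = "\<lambda>v j. v (j mod k)"])
  show "(\<lambda>u. restrict u {..<k}) \<in> period_words a k \<rightarrow> (PiE {..<k} (\<lambda>_. {..<a}))"
    by (auto simp: period_words_def)
  show "(\<lambda>v j. v (j mod k)) \<in> (PiE {..<k} (\<lambda>_. {..<a})) \<rightarrow> period_words a k"
    using assms by (auto simp: period_words_def PiE_iff)
  show "(\<lambda>j. restrict u {..<k} (j mod k)) = u" if "u \<in> period_words a k" for u
    using assms that by (auto simp: period_words_mod)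
  show "restrict (\<lambda>j. v (j mod k)) {..<k} = v" if "v \<in> (PiE {..<k} (\<lambda>_. {..<a}))" for v
    using assms that by (auto simp: PiE_iff extensional_def restrict_def)
qed

lemma finite_period_words: "0 < k \<Longrightarrow> finite (period_words a k)"
  using bij_betw_finite[OF bij_betw_period_words] by (simp add: finite_PiE)

lemma finite_prim_words [simp]: "finite (prim_words a k)"
  by (cases "k = 0") (auto simp: prim_words_def intro: finite_subset[OF _ finite_period_words])

lemma sum_period_words:
  fixes x :: "nat \<Rightarrow> 'a::comm_semiring_1"
  assumes "0 < k"
  shows "(\<Sum>u\<in>period_words a k. \<Prod>j<k. f (u j)) = (\<Sum>l<a. f l :: 'a) ^ k"
proof -
  have "(\<Sum>u\<in>period_words a k. \<Prod>j<k. f (u j)) = (\<Sum>v\<in>(PiE {..<k} (\<lambda>_. {..<a})). \<Prod>j<k. f (v j))"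
    using sum.reindex_bij_betw[OF bij_betw_period_words[OF assms], where g = "\<lambda>v. \<Prod>j<k. f (v j)"] by simp
  also have "\<dots> = (\<Prod>j<k. \<Sum>l<a. f l)"
    by (rule prod_sum_PiE[symmetric]) auto
  finally show ?thesis by simp
qed

text \<open>A necklace of length \<open>i\<close> enters once for each of its \<open>i\<close>
  readings, all of the same weight, so this is \<open>i\<close> times the \<open>m\<close>-th power
  sum of the necklace weights.\<close>

definition prim_sum :: "(nat \<Rightarrow> 'a::comm_semiring_1) \<Rightarrow> nat \<Rightarrow> nat \<Rightarrow> nat \<Rightarrow> 'a" where
  "prim_sum x a i m = (\<Sum>u\<in>prim_words a i. (\<Prod>j<i. x (u j)) ^ m)"

lemma prod_periodic:
  fixes f :: "nat \<Rightarrow> 'a::comm_monoid_mult"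
  assumes "\<And>j. f (j + i) = f j"
  shows "(\<Prod>j<i * m. f j) = (\<Prod>j<i. f j) ^ m"
proof (induction m)
  case (Suc m)
  have *: "f (j + i * m) = f j" for j
  proof (induction m)
    case (Suc m)
    have "f (j + i * Suc m) = f ((j + i * m) + i)" by (simp add: algebra_simps)
    then show ?case using assms Suc by simp
  qed simp
  have "(\<Prod>j<i * Suc m. f j) = (\<Prod>j<i * m + i. f j)" by (simp add: algebra_simps)
  also have "\<dots> = (\<Prod>j<i * m. f j) * (\<Prod>j<i. f (j + i * m))"
    proof -
    have "(\<Prod>j<p + r. f j) = (\<Prod>j<p. f j) * (\<Prod>j<r. f (j + p))" for p r
      by (induction r) (simp_all add: mult_ac add_ac)
    then show ?thesis .
  qed
  also have "\<dots> = (\<Prod>j<i. f j) ^ m * (\<Prod>j<i. f j)" using Suc * by simp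
  finally show ?case by (simp add: mult.commute)
qed simp

text \<open>Sort the words of period \<open>k\<close> by their least period \<open>i\<close>, a
  divisor of \<open>k\<close>: such a word runs through its primitive block \<open>k div i\<close>
  times, so its weight is that power of the block weight.\<close>

lemma power_sum_prim_sum:
  fixes x :: "nat \<Rightarrow> 'a::comm_semiring_1"
  assumes "0 < k"
  shows "(\<Sum>l<a. x l ^ m) ^ k = (\<Sum>i | i dvd k. prim_sum x a i (m * (k div i)))"
proof -
  have "period_words a k = (\<Union>i\<in>{i. i dvd k}. prim_words a i)"
  proof (intro equalityI subsetI)
    fix u assume "u \<in> period_words a k"
    then show "u \<in> (\<Union>i\<in>{i. i dvd k}. prim_words a i)"
      by (rule period_words_prim) (use assms in auto)
  qed (auto intro: prim_words_dvd_period)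
  then have "(\<Sum>u\<in>period_words a k. \<Prod>j<k. x (u j) ^ m)
      = (\<Sum>u\<in>(\<Union>i\<in>{i. i dvd k}. prim_words a i). \<Prod>j<k. x (u j) ^ m)"
    by simp
  also have "\<dots> = (\<Sum>i | i dvd k. \<Sum>u\<in>prim_words a i. \<Prod>j<k. x (u j) ^ m)"
  proof (rule sum.UNION_disjoint)
    show "\<forall>i\<in>{i. i dvd k}. \<forall>j\<in>{i. i dvd k}. i \<noteq> j \<longrightarrow> prim_words a i \<inter> prim_words a j = {}"
      by (auto dest: prim_words_unique)
  qed (use assms in auto)
  also have "\<dots> = (\<Sum>i | i dvd k. prim_sum x a i (m * (k div i)))"
    unfolding prim_sum_def
  proof (intro sum.cong refl)
    fix i u assume "i \<in> {i. i dvd k}" "u \<in> prim_words a i"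
    then have k: "k = i * (k div i)" and u: "u (j + i) = u j" for j
      by (auto simp: prim_words_def period_words_def)
    have "(\<Prod>j<k. x (u j) ^ m) = (\<Prod>j<i. x (u j) ^ m) ^ (k div i)"
      by (subst k, rule prod_periodic) (simp add: u)
    then show "(\<Prod>j<k. x (u j) ^ m) = (\<Prod>j<i. x (u j)) ^ (m * (k div i))"
      by (simp add: prod_power_distrib power_mult)
  qed
  finally show ?thesis using sum_period_words[OF assms, where f = "\<lambda>l. x l ^ m"] by simp
qed

section \<open>Shift orbits of primitive words\<close>

lemma shift_prim_words:
  assumes "u \<in> prim_words a i"
  shows "shift j u \<in> prim_words a i"
proof -
  have i: "0 < i" using assms prim_words_pos by blast
  have u: "shift i u = u" using assms by (simp add: prim_words_iff_shift)
  \<comment> \<open>Together with the \<open>j\<close> shifts already made, these complete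
    \<open>j\<close> full periods; this inverts the shift.\<close>
  have bk: "shift (j * (i - 1)) (shift j u) = u"
  proof -
    have "j * (i - 1) + j = i * j" using i by (cases i) auto
    then show ?thesis using shift_mult_period[OF u] by simp
  qed
  have "shift l u = u" if "shift l (shift j u) = shift j u" for l
  proof -
    have "shift l u = shift l (shift (j * (i - 1)) (shift j u))" using bk by metis
    also have "\<dots> = shift (j * (i - 1)) (shift l (shift j u))" by (simp add: algebra_simps)
    also have "\<dots> = u" using that bk by metis
    finally show ?thesis .
  qed
  moreover have "shift i (shift j u) = shift j u"
  proof -
    have "shift i (shift j u) = shift j (shift i u)" by (simp add: add.commute)
    then show ?thesis using u by simp
  qed
  ultimately show ?thesis
    using assms unfolding prim_words_iff_shift by (metis shift_def)
qed

lemma shift_inj_prim_words: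
  assumes "u \<in> prim_words a i"
  shows "inj_on (\<lambda>j. shift j u) {..<i}"
proof (rule linorder_inj_onI)
  fix j k assume jk: "j < k" "j \<in> {..<i}" "k \<in> {..<i}"
  show "shift j u \<noteq> shift k u"
  proof
    assume "shift j u = shift k u"
    then have "shift (i - j) (shift j u) = shift (i - j) (shift k u)" by simp
    then have "shift i u = shift (i - j + k) u" using jk by simp
    also have "\<dots> = shift (k - j) (shift i u)" using jk by (simp add: algebra_simps)
    finally have "u = shift (k - j) u" using prim_words_period[OF assms] by simp
    then show False using assms jk by (auto simp: prim_words_iff_shift dest!: spec[of _ "k - j"])
  qed
qed auto


section \<open>Multisets of primitive necklaces and their generating function\<close>

definition prim_words_upto :: "nat \<Rightarrow> nat \<Rightarrow> (nat \<Rightarrow> nat) set" where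
  "prim_words_upto a n = (\<Union>i\<in>{1..n}. prim_words a i)"

text \<open>A multiset of primitive necklaces is encoded by the shift-invariant function giving every
  reading the multiplicity of its necklace, so \<open>lam i\<close> necklaces of length \<open>i\<close> have total mass \<open>i * lam i\<close>.\<close>

definition mult_funs :: "nat \<Rightarrow> nat \<Rightarrow> (nat \<Rightarrow> nat) \<Rightarrow> ((nat \<Rightarrow> nat) \<Rightarrow> nat) set" where
  "mult_funs a n lam = {N. (\<forall>u. u \<notin> prim_words_upto a n \<longrightarrow> N u = 0) \<and>
     (\<forall>u\<in>prim_words_upto a n. N (shift 1 u) = N u) \<and>
     (\<forall>i\<in>{1..n}. (\<Sum>u\<in>prim_words a i. N u) = i * lam i)}"

text \<open>Only the first letter of a reading is weighted: over all readings of a necklace each of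
  its letters comes first exactly once.\<close>

definition mult_weight :: "(nat \<Rightarrow> 'a::comm_semiring_1) \<Rightarrow> nat \<Rightarrow> nat \<Rightarrow> ((nat \<Rightarrow> nat) \<Rightarrow> nat) \<Rightarrow> 'a" where
  "mult_weight x a n N = (\<Prod>u\<in>prim_words_upto a n. x (u 0) ^ N u)"

definition mult_gf :: "(nat \<Rightarrow> 'a::comm_semiring_1) \<Rightarrow> nat \<Rightarrow> nat \<Rightarrow> (nat \<Rightarrow> nat) \<Rightarrow> 'a" where
  "mult_gf x a n lam = (\<Sum>N\<in>mult_funs a n lam. mult_weight x a n N)"

lemma finite_prim_words_upto [simp]: "finite (prim_words_upto a n)"
  by (simp add: prim_words_upto_def)

lemma finite_mult_funs: "finite (mult_funs a n lam)"
proof -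
  define B where "B = (\<Sum>i=1..n. i * lam i)"
  have "mult_funs a n lam \<subseteq>
      {N. \<forall>u. (u \<in> prim_words_upto a n \<longrightarrow> N u \<in> {..B}) \<and> (u \<notin> prim_words_upto a n \<longrightarrow> N u = 0)}"
  proof (intro subsetI CollectI allI conjI impI)
    fix N u assume N: "N \<in> mult_funs a n lam" and "u \<in> prim_words_upto a n"
    then obtain i where i: "i \<in> {1..n}" "u \<in> prim_words a i" by (auto simp: prim_words_upto_def)
    have "N u \<le> (\<Sum>u\<in>prim_words a i. N u)" using i by (intro member_le_sum) auto
    also have "\<dots> = i * lam i" using N i by (auto simp: mult_funs_def)
    also have "\<dots> \<le> B" unfolding B_def using i by (intro member_le_sum) auto
    finally show "N u \<in> {..B}" by simp
  qed (auto simp: mult_funs_def)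
  then show ?thesis by (rule finite_subset) (intro finite_set_of_finite_funs; simp)
qed

lemma mult_funs_shift:
  assumes "N \<in> mult_funs a n lam" "u \<in> prim_words a i" "i \<in> {1..n}"
  shows "N (shift j u) = N u"
proof (induction j)
  case (Suc j)
  have "shift j u \<in> prim_words_upto a n" using shift_prim_words[OF assms(2)] assms(3) unfolding prim_words_upto_def by blast
  then have "N (shift 1 (shift j u)) = N (shift j u)" using assms(1) by (auto simp: mult_funs_def)
  then show ?case using Suc by simp
qed simp

text \<open>Raising the multiplicity by \<open>k\<close> on the whole shift orbit of
  \<open>u\<close> maps the functions with \<open>k\<close> fewer necklaces of length
  \<open>i\<close> bijectively onto the summation range, and it multiplies the weight by the
  \<open>k\<close>-th power of the necklace weight.\<close>

lemma mult_gf_remove: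
  fixes x :: "nat \<Rightarrow> 'a::comm_semiring_1"
  assumes u: "u \<in> prim_words a i" and i: "i \<in> {1..n}" and k: "k \<le> lam i"
  shows "(\<Sum>N\<in>{N \<in> mult_funs a n lam. k \<le> N u}. mult_weight x a n N)
    = (\<Prod>j<i. x (u j)) ^ k * mult_gf x a n (lam(i := lam i - k))"
proof -
  define Ob where "Ob = (\<lambda>j. shift j u) ` {..<i}"
  define V where "V = prim_words_upto a n"
  define add where "add = (\<lambda>N v. N v + (if v \<in> Ob then k else 0) :: nat)"
  have i0: "0 < i" using i by auto
  have Ob_all: "shift j u \<in> Ob" for j
  proof -
    have "shift j u = shift (j mod i) u" using prim_words_period[OF u] by (simp add: shift_mod_period)
    then show ?thesis using i0 by (auto simp: Ob_def)
  qed
  have u_O: "u \<in> Ob" using Ob_all[of 0] by simp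
  have Ob_prim: "Ob \<subseteq> prim_words a i" using u shift_prim_words by (auto simp: Ob_def)
  have Ob_V: "Ob \<subseteq> V" using Ob_prim i by (auto simp: V_def prim_words_upto_def)
  have finOb: "finite Ob" by (simp add: Ob_def)
  have cardOb: "card Ob = i" using shift_inj_prim_words[OF u] by (simp add: Ob_def card_image)
  have Ob_shift: "shift 1 v \<in> Ob \<longleftrightarrow> v \<in> Ob" if v: "v \<in> V" for v
  proof
    assume "v \<in> Ob"
    then obtain j where "v = shift j u" by (auto simp: Ob_def)
    then show "shift 1 v \<in> Ob" using Ob_all[of "Suc j"] by simp
  next
    \<comment> \<open>The least period of \<open>v\<close> is that of its shift, hence
      \<open>i\<close>, so \<open>i - 1\<close> further shifts lead back to \<open>v\<close> along
      the orbit.\<close>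
    assume *: "shift 1 v \<in> Ob"
    from v obtain i' where v': "v \<in> prim_words a i'" by (auto simp: V_def prim_words_upto_def)
    have "i' = i" using shift_prim_words[OF v', of 1] * Ob_prim prim_words_unique by blast
    then have "shift (i - 1) (shift 1 v) = v" using prim_words_period[OF v'] i0 by simp
    moreover obtain j where "shift 1 v = shift j u" using * by (auto simp: Ob_def)
    ultimately have "v = shift (i - 1) (shift j u)" by metis
    then show "v \<in> Ob" using Ob_all by simp
  qed
  have sumOb: "(\<Sum>v\<in>prim_words a i'. if v \<in> Ob then k else 0) = (if i' = i then i * k else 0)" for i'
  proof (cases "i' = i")
    case True
    have "(\<Sum>v\<in>prim_words a i. if v \<in> Ob then k else 0) = (\<Sum>v\<in>Ob. k)"
      using Ob_prim by (simp add: sum.inter_restrict[symmetric] Int_absorb1)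
    then show ?thesis using True cardOb by simp
  next
    case False
    then have "v \<notin> Ob" if "v \<in> prim_words a i'" for v using that Ob_prim prim_words_unique by blast
    then show ?thesis using False by simp
  qed
  have bij: "bij_betw add (mult_funs a n (lam(i := lam i - k))) {N \<in> mult_funs a n lam. k \<le> N u}"
  proof (rule bij_betwI[where g = "\<lambda>N v. N v - (if v \<in> Ob then k else 0)"])
    show "add \<in> mult_funs a n (lam(i := lam i - k)) \<rightarrow> {N \<in> mult_funs a n lam. k \<le> N u}"
    proof
      fix N assume N: "N \<in> mult_funs a n (lam(i := lam i - k))"
      have "(\<Sum>u\<in>prim_words a i'. add N u) = i' * lam i'" if "i' \<in> {1..n}" for i'
      proof -
        have "(\<Sum>u\<in>prim_words a i'. add N u) = (\<Sum>u\<in>prim_words a i'. N u) + (if i' = i then i * k else 0)"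
          by (simp add: add_def sum.distrib sumOb)
        also have "(\<Sum>u\<in>prim_words a i'. N u) = i' * (lam(i := lam i - k)) i'"
          using N that by (simp add: mult_funs_def)
        finally show ?thesis using k by (auto simp flip: add_mult_distrib2)
      qed
      moreover have "add N (shift 1 v) = add N v" if "v \<in> V" for v
        using N that Ob_shift[OF that] by (auto simp: add_def mult_funs_def V_def)
      moreover have "add N v = 0" if "v \<notin> V" for v
        using N that Ob_V by (auto simp: add_def mult_funs_def V_def)
      ultimately show "add N \<in> {N \<in> mult_funs a n lam. k \<le> N u}"
        using u_O by (auto simp: mult_funs_def V_def) (simp add: add_def)
    qed
    show "(\<lambda>N v. N v - (if v \<in> Ob then k else 0)) \<in>
        {N \<in> mult_funs a n lam. k \<le> N u} \<rightarrow> mult_funs a n (lam(i := lam i - k))"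
    proof
      fix N assume N': "N \<in> {N \<in> mult_funs a n lam. k \<le> N u}"
      then have N: "N \<in> mult_funs a n lam" and ku: "k \<le> N u" by auto
      have kOb: "(if v \<in> Ob then k else 0) \<le> N v" for v
        using mult_funs_shift[OF N u i] ku by (auto simp: Ob_def)
      let ?N = "\<lambda>v. N v - (if v \<in> Ob then k else 0)"
      have "(\<Sum>u\<in>prim_words a i'. ?N u) = i' * (lam(i := lam i - k)) i'" if "i' \<in> {1..n}" for i'
      proof -
        have "(\<Sum>u\<in>prim_words a i'. ?N u) = (\<Sum>u\<in>prim_words a i'. N u) - (if i' = i then i * k else 0)"
          unfolding sumOb[symmetric] using kOb by (intro sum_subtractf_nat) auto
        then show ?thesis using N that by (auto simp: mult_funs_def diff_mult_distrib2)
      qed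
      moreover have "?N (shift 1 v) = ?N v" if "v \<in> V" for v
        using N that Ob_shift[OF that] by (auto simp: mult_funs_def V_def)
      moreover have "?N v = 0" if "v \<notin> V" for v
        using N that Ob_V by (auto simp: mult_funs_def V_def)
      ultimately show "?N \<in> mult_funs a n (lam(i := lam i - k))"
        by (auto simp: mult_funs_def V_def simp del: fun_upd_apply)
    qed
    show "(\<lambda>v. add N v - (if v \<in> Ob then k else 0)) = N" for N by (simp add: add_def fun_eq_iff)
    show "add (\<lambda>v. N v - (if v \<in> Ob then k else 0)) = N" if "N \<in> {N \<in> mult_funs a n lam. k \<le> N u}" for N
    proof -
      have "k \<le> N v" if "v \<in> Ob" for v
        using mult_funs_shift[of N a n lam, OF _ u i] \<open>N \<in> _\<close> that by (auto simp: Ob_def)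
      then show ?thesis by (auto simp: add_def fun_eq_iff)
    qed
  qed
  have wt: "mult_weight x a n (add N) = (\<Prod>j<i. x (u j)) ^ k * mult_weight x a n N" for N
  proof -
    have "mult_weight x a n (add N) = (\<Prod>v\<in>V. x (v 0) ^ N v * (if v \<in> Ob then x (v 0) ^ k else 1))"
      unfolding mult_weight_def V_def[symmetric] add_def by (intro prod.cong) (auto simp: power_add)
    also have "\<dots> = mult_weight x a n N * (\<Prod>v\<in>V. if v \<in> Ob then x (v 0) ^ k else 1)"
      by (simp add: prod.distrib mult_weight_def V_def)
    also have "(\<Prod>v\<in>V. if v \<in> Ob then x (v 0) ^ k else 1) = (\<Prod>v\<in>Ob. x (v 0) ^ k)"
      using Ob_V by (simp add: V_def prod.inter_restrict[symmetric] Int_absorb1)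
    also have "\<dots> = (\<Prod>j<i. x (u j) ^ k)"
      unfolding Ob_def using shift_inj_prim_words[OF u] by (simp add: prod.reindex shift_def)
    finally show ?thesis by (simp add: prod_power_distrib mult.commute)
  qed
  show ?thesis
    unfolding sum.reindex_bij_betw[OF bij, symmetric] mult_gf_def by (simp add: wt sum_distrib_left)
qed

text \<open>Newton's identity: count the triples \<open>(N, u, k)\<close> with \<open>1 \<le> k \<le> N u\<close> by removing \<open>k\<close> copies
  of the necklace of \<open>u\<close> from \<open>N\<close>.\<close>

lemma mult_gf_newton:
  fixes x :: "nat \<Rightarrow> 'a::comm_semiring_1"
  assumes i: "i \<in> {1..n}"
  shows "of_nat (i * lam i) * mult_gf x a n lam
    = (\<Sum>k=1..lam i. prim_sum x a i k * mult_gf x a n (lam(i := lam i - k)))"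
proof -
  \<comment> \<open>The \<open>i\<close> distinct readings of the necklace all carry the value
    \<open>N u\<close> within the mass \<open>i * lam i\<close>. This gives the sums over
    \<open>k\<close> a common range.\<close>
  have le: "N u \<le> lam i" if N: "N \<in> mult_funs a n lam" and u: "u \<in> prim_words a i" for N u
  proof -
    have "i * N u = (\<Sum>j<i. N (shift j u))" using mult_funs_shift[OF N u i] by simp
    also have "\<dots> = (\<Sum>v\<in>(\<lambda>j. shift j u) ` {..<i}. N v)"
      using shift_inj_prim_words[OF u] by (simp add: sum.reindex)
    also have "\<dots> \<le> (\<Sum>v\<in>prim_words a i. N v)"
      using u shift_prim_words by (intro sum_mono2) auto
    also have "\<dots> = i * lam i" using N i by (auto simp: mult_funs_def)
    finally show ?thesis using i by simp
  qed
  have "of_nat (i * lam i) * mult_gf x a n lam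
      = (\<Sum>N\<in>mult_funs a n lam. of_nat (\<Sum>u\<in>prim_words a i. N u) * mult_weight x a n N)"
    unfolding mult_gf_def sum_distrib_left using i by (intro sum.cong) (auto simp: mult_funs_def)
  also have "\<dots> = (\<Sum>N\<in>mult_funs a n lam. \<Sum>u\<in>prim_words a i. \<Sum>k=1..lam i. if k \<le> N u then mult_weight x a n N else 0)"
  proof (intro sum.cong refl)
    fix N assume N: "N \<in> mult_funs a n lam"
    have "of_nat (N u) * mult_weight x a n N = (\<Sum>k=1..lam i. if k \<le> N u then mult_weight x a n N else 0)"
      if "u \<in> prim_words a i" for u
    proof -
      have "{k \<in> {1..lam i}. k \<le> N u} = {1..N u}" using le[OF N that] by auto
      then show ?thesis by (simp add: sum.inter_filter[symmetric])
    qed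
    then show "of_nat (\<Sum>u\<in>prim_words a i. N u) * mult_weight x a n N =
      (\<Sum>u\<in>prim_words a i. \<Sum>k=1..lam i. if k \<le> N u then mult_weight x a n N else 0)"
      by (simp add: sum_distrib_right)
  qed
  also have "\<dots> = (\<Sum>u\<in>prim_words a i. \<Sum>k=1..lam i. \<Sum>N\<in>mult_funs a n lam. if k \<le> N u then mult_weight x a n N else 0)"
    by (subst sum.swap) (intro sum.cong refl, rule sum.swap)
  also have "\<dots> = (\<Sum>u\<in>prim_words a i. \<Sum>k=1..lam i. (\<Prod>j<i. x (u j)) ^ k * mult_gf x a n (lam(i := lam i - k)))"
    using i by (intro sum.cong refl) (simp add: mult_gf_remove sum.inter_filter[symmetric] finite_mult_funs)
  also have "\<dots> = (\<Sum>k=1..lam i. prim_sum x a i k * mult_gf x a n (lam(i := lam i - k)))"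
    by (subst sum.swap) (simp add: prim_sum_def sum_distrib_right)
  finally show ?thesis .
qed

text \<open>The complete homogeneous symmetric functions, computed from the power sums
  \<open>p\<close> by Newton's recursion \<open>m h_m = p_1 h_(m-1) + ... + p_m h_0\<close>; the
  division is why characteristic 0 is assumed.\<close>

fun hom_sym :: "(nat \<Rightarrow> 'a::field_char_0) \<Rightarrow> nat \<Rightarrow> 'a" where
  "hom_sym p 0 = 1"
| "hom_sym p (Suc m) = (\<Sum>k\<le>m. p (Suc k) * hom_sym p (m - k)) / of_nat (Suc m)"

text \<open>Induction on the total number of necklaces: Newton's identity, applied to a length that
  still occurs, lowers that multiplicity alone. Dividing \<open>prim_sum\<close> by \<open>i\<close>
  passes from readings to necklaces.\<close>

lemma mult_gf_eq_prod_hom_sym: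
  fixes x :: "nat \<Rightarrow> 'a::field_char_0"
  shows "mult_gf x a n lam = (\<Prod>i=1..n. hom_sym (\<lambda>k. prim_sum x a i k / of_nat i) (lam i))"
proof (induction "\<Sum>i=1..n. lam i" arbitrary: lam rule: less_induct)
  case less
  let ?h = "\<lambda>i. hom_sym (\<lambda>k. prim_sum x a i k / of_nat i)"
  show ?case
  proof (cases "\<forall>i\<in>{1..n}. lam i = 0")
    case True
    have "mult_funs a n lam = {\<lambda>_. 0}"
    proof (intro equalityI subsetI)
      fix N assume N: "N \<in> mult_funs a n lam"
      have "N u = 0" for u
        using N True by (cases "u \<in> prim_words_upto a n") (auto simp: mult_funs_def prim_words_upto_def)
      then show "N \<in> {\<lambda>_. 0}" by auto
    qed (use True in \<open>auto simp: mult_funs_def\<close>)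
    then show ?thesis using True by (simp add: mult_gf_def mult_weight_def)
  next
    case False
    then obtain i m where i: "i \<in> {1..n}" and m: "lam i = Suc m" by (auto simp: gr0_conv_Suc)
    have fi: "prod f {1..n} = f i * prod f ({1..n} - {i})" for f :: "nat \<Rightarrow> 'a"
      using i by (simp add: prod.remove)
    have IH: "mult_gf x a n (lam(i := m - k)) = ?h i (m - k) * (\<Prod>j\<in>{1..n} - {i}. ?h j (lam j))" for k
    proof -
      have "(\<Sum>j=1..n. (lam(i := m - k)) j) < (\<Sum>j=1..n. lam j)"
        using i m by (intro sum_strict_mono_ex1) auto
      from less[OF this] have "mult_gf x a n (lam(i := m - k)) = (\<Prod>j=1..n. ?h j ((lam(i := m - k)) j))" .
      also have "\<dots> = ?h i (m - k) * (\<Prod>j\<in>{1..n} - {i}. ?h j ((lam(i := m - k)) j))"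
        by (simp only: fi fun_upd_same)
      also have "(\<Prod>j\<in>{1..n} - {i}. ?h j ((lam(i := m - k)) j)) = (\<Prod>j\<in>{1..n} - {i}. ?h j (lam j))"
        by (intro prod.cong) auto
      finally show ?thesis .
    qed
    have reindex: "(\<Sum>k=1..Suc m. f k) = (\<Sum>k\<le>m. f (Suc k))" for f :: "nat \<Rightarrow> 'a"
      using sum.atLeast1_atMost_eq[of f "Suc m"] by (simp add: lessThan_Suc_atMost del: sum.lessThan_Suc)
    have "of_nat (i * lam i) * mult_gf x a n lam
        = (\<Sum>k\<le>m. prim_sum x a i (Suc k) * mult_gf x a n (lam(i := m - k)))"
      using mult_gf_newton[OF i, where lam = lam and x = x and a = a] unfolding m reindex by simp
    also have "\<dots> = (\<Sum>k\<le>m. prim_sum x a i (Suc k) / of_nat i * ?h i (m - k)) * of_nat i * (\<Prod>j\<in>{1..n} - {i}. ?h j (lam j))"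
      using i by (simp add: IH sum_distrib_right sum_distrib_left field_simps)
    also have "\<dots> = of_nat (i * lam i) * (?h i (lam i) * (\<Prod>j\<in>{1..n} - {i}. ?h j (lam j)))"
      by (simp add: m del: of_nat_Suc mult_Suc_right)
    finally have "of_nat (i * lam i) * mult_gf x a n lam
      = of_nat (i * lam i) * (?h i (lam i) * (\<Prod>j\<in>{1..n} - {i}. ?h j (lam j)))" .
    moreover have "(of_nat (i * lam i) :: 'a) \<noteq> 0" unfolding of_nat_eq_0_iff using i m by simp
    ultimately have "mult_gf x a n lam = ?h i (lam i) * (\<Prod>j\<in>{1..n} - {i}. ?h j (lam j))"
      by (simp only: mult_cancel_left) simp
    then show ?thesis by (simp only: fi)
  qed
qed

section \<open>The Gessel-Reutenauer correspondence\<close>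


text \<open>Values outside \<open>{1..n}\<close> are pinned to 0, so that each word is represented
  by exactly one function.\<close>

definition compat_words :: "nat \<Rightarrow> nat \<Rightarrow> nat set \<Rightarrow> (nat \<Rightarrow> nat) set" where
  "compat_words n b D = {c. (\<forall>i. i \<notin> {1..n} \<longrightarrow> c i = 0) \<and> (\<forall>i\<in>{1..n}. c i < b) \<and>
     (\<forall>i\<in>{1..<n}. c (i + 1) \<le> c i \<and> (i \<in> D \<longrightarrow> c (i + 1) < c i))}"

definition compat_pairs :: "nat \<Rightarrow> nat \<Rightarrow> (nat \<Rightarrow> nat) \<Rightarrow> ((nat \<Rightarrow> nat) \<times> (nat \<Rightarrow> nat)) set" where
  "compat_pairs n a lam = (SIGMA \<pi>:conj_class n lam. compat_words n a (descents n \<pi>))"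

section \<open>Itineraries and their lexicographic order\<close>

definition itinerary :: "(nat \<Rightarrow> nat) \<Rightarrow> (nat \<Rightarrow> nat) \<Rightarrow> nat \<Rightarrow> nat \<Rightarrow> nat" where
  "itinerary \<pi> c i = (\<lambda>k. c ((\<pi> ^^ k) i))"

definition lex_gt :: "(nat \<Rightarrow> nat) \<Rightarrow> (nat \<Rightarrow> nat) \<Rightarrow> bool" where
  "lex_gt u v \<longleftrightarrow> (\<exists>k. (\<forall>l<k. u l = v l) \<and> v k < u k)"

lemma lex_gt_irrefl [simp]: "\<not> lex_gt u u"
  by (simp add: lex_gt_def)

lemma lex_gt_trans: "lex_gt u v \<Longrightarrow> lex_gt v w \<Longrightarrow> lex_gt u w"
proof -
  assume "lex_gt u v" "lex_gt v w"
  then obtain k k' where k: "\<forall>l<k. u l = v l" "v k < u k" and k': "\<forall>l<k'. v l = w l" "w k' < v k'"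
    unfolding lex_gt_def by blast
  have "(\<forall>l<min k k'. u l = w l) \<and> w (min k k') < u (min k k')"
    using k k' by (cases k k' rule: linorder_cases) (auto simp: min_def)
  then show ?thesis unfolding lex_gt_def by blast
qed

lemma lex_gt_total: "u \<noteq> v \<Longrightarrow> lex_gt u v \<or> lex_gt v u"
proof -
  assume "u \<noteq> v"
  then have ex: "\<exists>k. u k \<noteq> v k" by auto
  define k where "k = (LEAST k. u k \<noteq> v k)"
  have "u k \<noteq> v k" unfolding k_def using ex by (rule LeastI_ex)
  moreover have "\<forall>l<k. u l = v l" unfolding k_def using not_less_Least by blast
  ultimately show ?thesis unfolding lex_gt_def by (metis nat_neq_iff)
qed

lemma lex_gt_shift: "lex_gt u v \<Longrightarrow> u 0 = v 0 \<Longrightarrow> lex_gt (shift 1 u) (shift 1 v)"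
proof -
  assume "lex_gt u v" "u 0 = v 0"
  then obtain k where k: "\<forall>l<k. u l = v l" "v k < u k" unfolding lex_gt_def by blast
  with \<open>u 0 = v 0\<close> have "k \<noteq> 0" by (metis less_irrefl)
  then have "(\<forall>l<k - 1. shift 1 u l = shift 1 v l) \<and> shift 1 v (k - 1) < shift 1 u (k - 1)"
    using k by (auto simp: shift_def)
  then show ?thesis unfolding lex_gt_def by blast
qed

lemma lex_gt_0: "lex_gt u v \<Longrightarrow> v 0 \<le> u 0"
  unfolding lex_gt_def by (metis gr0I less_imp_le order_refl)

lemma itinerary_shift: "shift k (itinerary \<pi> c i) = itinerary \<pi> c ((\<pi> ^^ k) i)"
  by (simp add: shift_def itinerary_def funpow_add)

text \<open>Identifies the size of an orbit, by which cycles are counted, with the first return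
  time, which will be the least period of an itinerary.\<close>

lemma funpow_orbit_card:
  fixes \<pi> :: "nat \<Rightarrow> nat"
  assumes "\<pi> permutes {1..n}"
  shows "(\<pi> ^^ card (orbit \<pi> i)) i = i"
    and "\<And>l. 0 < l \<Longrightarrow> l < card (orbit \<pi> i) \<Longrightarrow> (\<pi> ^^ l) i \<noteq> i"
    and "0 < card (orbit \<pi> i)"
proof -
  have per: "permutation \<pi>"
    unfolding permutation_permutes using assms by (intro exI[of _ "{1..n}"]) simp
  have self: "i \<in> orbit \<pi> i" using per by (rule permutation_self_in_orbit)
  define d where "d = funpow_dist1 \<pi> i i"
  have orb: "orbit \<pi> i = (\<lambda>l. (\<pi> ^^ l) i) ` {0..<d}"
    unfolding d_def by (rule orbit_conv_funpow_dist1[OF self])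
  have "inj_on (\<lambda>l. (\<pi> ^^ l) i) {0..<d}" unfolding d_def by (rule inj_on_funpow_dist1[OF self])
  then have card: "card (orbit \<pi> i) = d" using orb by (simp add: card_image)
  show "(\<pi> ^^ card (orbit \<pi> i)) i = i" unfolding card d_def by (rule funpow_dist1_prop[OF self])
  show "(\<pi> ^^ l) i \<noteq> i" if "0 < l" "l < card (orbit \<pi> i)" for l
    using that unfolding card d_def by (rule funpow_dist1_least)
  show "0 < card (orbit \<pi> i)" unfolding card by (simp add: d_def)
qed

lemma orbit_permutes_subset:
  assumes "\<pi> permutes {1..n}" "i \<in> {1..n}"
  shows "orbit \<pi> i \<subseteq> {1..n::nat}"
  using assms by (rule permutes_orbit_subset)

section \<open>From a compatible pair to a multiplicity function\<close>

locale compat_pair =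
  fixes n a :: nat and \<pi> c :: "nat \<Rightarrow> nat"
  assumes permutes: "\<pi> permutes {1..n}"
    and compat: "c \<in> compat_words n a (descents n \<pi>)"
begin

abbreviation "itin \<equiv> itinerary \<pi> c"

definition mult :: "(nat \<Rightarrow> nat) \<Rightarrow> nat" where
  "mult u = card {i \<in> {1..n}. itin i = u}"

lemma in_range: "i \<in> {1..n} \<Longrightarrow> (\<pi> ^^ k) i \<in> {1..n}"
  using permutes by (induction k) (auto simp: permutes_in_image simp del: atLeastAtMost_iff)

lemma pi_eq_iff [simp]: "\<pi> i = \<pi> j \<longleftrightarrow> i = j"
  using permutes_inj[OF permutes] by (auto dest: injD)

text \<open>The word drops strictly at every descent, so neighbours with equal letters are no
  descent; the general case follows because equal end letters force all letters between them to be
  equal.\<close>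

lemma mono_step:
  assumes "i < j" "i \<in> {1..n}" "j \<in> {1..n}"
  shows "c j \<le> c i \<and> (c i = c j \<longrightarrow> \<pi> i < \<pi> j)"
  using assms
proof (induction rule: less_Suc_induct)
  case (1 i)
  then have i: "i \<in> {1..<n}" by auto
  then have "c (i + 1) \<le> c i \<and> (i \<in> descents n \<pi> \<longrightarrow> c (i + 1) < c i)"
    using compat by (simp add: compat_words_def)
  moreover have "\<not> \<pi> (Suc i) < \<pi> i \<longrightarrow> \<pi> i < \<pi> (Suc i)"
    by (metis pi_eq_iff n_not_Suc_n nat_neq_iff)
  ultimately show ?case using i by (auto simp: descents_def)
next
  case (2 i j k)
  then show ?case by fastforce
qed

text \<open>As long as the letters read agree, \<open>mono_step\<close> applies to the current pair
  of images and preserves their order.\<close>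

lemma pow_less:
  assumes "i < j" "i \<in> {1..n}" "j \<in> {1..n}" "\<forall>l<k. itin i l = itin j l"
  shows "(\<pi> ^^ k) i < (\<pi> ^^ k) j"
  using assms(4)
proof (induction k)
  case (Suc k)
  then have "(\<pi> ^^ k) i < (\<pi> ^^ k) j" by simp
  moreover have "c ((\<pi> ^^ k) i) = c ((\<pi> ^^ k) j)" using Suc.prems by (simp add: itinerary_def)
  ultimately show ?case using mono_step in_range assms(2,3) by simp
qed (use assms in simp)

text \<open>This is what allows positions to be recovered by sorting itineraries, up to
  ties.\<close>

lemma itin_mono:
  assumes "i < j" "i \<in> {1..n}" "j \<in> {1..n}"
  shows "itin i = itin j \<or> lex_gt (itin i) (itin j)"
proof (rule ccontr)
  assume contr: "\<not> ?thesis"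
  then have "lex_gt (itin j) (itin i)" using lex_gt_total by metis
  then obtain k where k: "\<forall>l<k. itin j l = itin i l" "itin i k < itin j k" unfolding lex_gt_def by blast
  then have "(\<pi> ^^ k) i < (\<pi> ^^ k) j" using pow_less assms by simp
  then have "c ((\<pi> ^^ k) j) \<le> c ((\<pi> ^^ k) i)" using mono_step in_range assms by blast
  then show False using k by (simp add: itinerary_def)
qed

text \<open>Equal itineraries would let the inequality between \<open>i\<close> and its image
  persist under all iterates, giving an infinite strictly monotone sequence inside
  \<open>{1..n}\<close>. Hence the word read along a cycle is primitive.\<close>

lemma itin_distinct:
  assumes i: "i \<in> {1..n}" and eq: "itin ((\<pi> ^^ l) i) = itin i"
  shows "(\<pi> ^^ l) i = i"
proof (rule ccontr)
  assume ne: "(\<pi> ^^ l) i \<noteq> i"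
  let ?j = "(\<pi> ^^ l) i"
  define f where "f t = (\<pi> ^^ (t * l)) i" for t
  have f_range: "f t \<in> {1..n}" for t using in_range[OF i] by (simp add: f_def)
  have f_Suc: "f (Suc t) = (\<pi> ^^ (t * l)) ?j" for t 
  proof -
    have "f (Suc t) = (\<pi> ^^ (t * l + l)) i" by (simp add: f_def add.commute)
    then show ?thesis by (simp add: funpow_add)
  qed
  show False
  proof (cases "i < ?j")
    case True
    have "f t < f (Suc t)" for t
      unfolding f_Suc using pow_less[OF True i in_range[OF i]] eq by (simp add: f_def)
    then have "strict_mono f" by (simp add: strict_mono_Suc_iff)
    then have "Suc n \<le> f (Suc n)" by (rule strict_mono_imp_increasing)
    then show False using f_range[of "Suc n"] by simp
  next
    case False
    then have lt: "?j < i" using ne by simp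
    have dec: "f (Suc t) < f t" for t
      unfolding f_Suc using pow_less[OF lt in_range[OF i] i] eq by (simp add: f_def)
    \<comment> \<open>Each step costs at least 1, so after \<open>n + 1\<close> steps the starting
      value would exceed \<open>n\<close>.\<close>
    have "f t + t \<le> f 0" for t
      by (induction t) (use dec in \<open>auto intro: order.trans simp: Suc_le_eq[symmetric]\<close>, metis add_Suc_right dec le_trans less_eq_Suc_le add_le_mono1 add_Suc)
    from this[of "Suc n"] show False using f_range[of 0] by simp
  qed
qed

lemma itin_prim:
  assumes i: "i \<in> {1..n}"
  shows "itin i \<in> prim_words a (card (orbit \<pi> i))"
  unfolding prim_words_iff_shift
proof (intro conjI allI impI)
  show "itin i j < a" for j
    using in_range[OF i, of j] compat by (simp add: itinerary_def compat_words_def)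
  show "shift l (itin i) \<noteq> itin i" if "0 < l" "l < card (orbit \<pi> i)" for l
    using itin_distinct[OF i, of l] funpow_orbit_card(2)[OF permutes that] by (auto simp: itinerary_shift)
qed (simp_all add: itinerary_shift funpow_orbit_card(1,3)[OF permutes])

lemma card_orbit_range: "i \<in> {1..n} \<Longrightarrow> card (orbit \<pi> i) \<in> {1..n}"
  using funpow_orbit_card(3)[OF permutes, of i] card_mono[OF _ orbit_permutes_subset[OF permutes], of i]
  by simp

lemma itin_upto: "i \<in> {1..n} \<Longrightarrow> itin i \<in> prim_words_upto a n"
  using itin_prim card_orbit_range unfolding prim_words_upto_def by blast

text \<open>The map \<open>\<pi>\<close> sends the positions reading \<open>u\<close> injectively to
  positions reading the shifted word. After one full period the word is \<open>u\<close> again, so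
  none of the resulting inequalities between cardinalities is strict.\<close>

lemma mult_shift:
  assumes u: "u \<in> prim_words a k"
  shows "mult (shift 1 u) = mult u" "\<pi> ` {i \<in> {1..n}. itin i = u} = {i \<in> {1..n}. itin i = shift 1 u}"
proof -
  have img: "\<pi> ` {i \<in> {1..n}. itin i = v} \<subseteq> {i \<in> {1..n}. itin i = shift 1 v}" for v
  proof
    fix j assume "j \<in> \<pi> ` {i \<in> {1..n}. itin i = v}"
    then obtain i where i: "i \<in> {1..n}" "itin i = v" "j = \<pi> i" by blast
    then have "itin j = shift 1 v" using itinerary_shift[of 1 \<pi> c i] by simp
    then show "j \<in> {i \<in> {1..n}. itin i = shift 1 v}" using in_range[OF i(1), of 1] i(3) by simp
  qed
  have inj: "inj_on \<pi> S" for S by (simp add: inj_on_def)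
  have le: "mult v \<le> mult (shift 1 v)" for v
    unfolding mult_def using card_mono[OF _ img[of v]] by (simp add: card_image[OF inj])
  have le': "mult v \<le> mult (shift j v)" for v j
  proof (induction j)
    case (Suc j)
    then show ?case using le[of "shift j v"] by simp
  qed simp
  have "mult (shift 1 u) \<le> mult (shift (k - 1) (shift 1 u))" by (rule le')
  also have "shift (k - 1) (shift 1 u) = u" using u by (simp add: prim_words_iff_shift)
  finally show eq: "mult (shift 1 u) = mult u" using le[of u] by simp
  show "\<pi> ` {i \<in> {1..n}. itin i = u} = {i \<in> {1..n}. itin i = shift 1 u}"
    using img[of u] eq by (intro card_subset_eq) (auto simp: mult_def card_image[OF inj])
qed

lemma sum_mult: "finite S \<Longrightarrow> (\<Sum>u\<in>S. mult u) = card {i \<in> {1..n}. itin i \<in> S}"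
proof -
  assume S: "finite S"
  have "{i \<in> {1..n}. itin i \<in> S} = (\<Union>u\<in>S. {i \<in> {1..n}. itin i = u})" by auto
  then show ?thesis unfolding mult_def using S by (simp only:) (subst card_UN_disjoint; auto)
qed

text \<open>By \<open>itin_prim\<close> the positions counted on the left are those on cycles of
  length \<open>k\<close>, and the orbits cut them into blocks of size \<open>k\<close>.\<close>

lemma sum_mult_prim: "(\<Sum>u\<in>prim_words a k. mult u) = k * num_cycles n \<pi> k"
proof -
  let ?CC = "{C. (\<exists>x\<in>{1..n}. C = orbit \<pi> x) \<and> card C = k}"
  have eq_orb: "orbit \<pi> i = orbit \<pi> j" if "j \<in> orbit \<pi> i" for i j
    using that permutes permutation_permutes by (metis orbit_cyclic_eq3 cyclic_on_orbit finite_atLeastAtMost)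
  have self: "i \<in> orbit \<pi> i" for i 
    using permutes permutation_permutes[of \<pi>] permutation_self_in_orbit[of \<pi> i] by (metis finite_atLeastAtMost)
  have "itin i \<in> prim_words a k \<longleftrightarrow> card (orbit \<pi> i) = k" if "i \<in> {1..n}" for i
    using itin_prim[OF that] prim_words_unique by blast
  then have "{i \<in> {1..n}. itin i \<in> prim_words a k} = {i \<in> {1..n}. card (orbit \<pi> i) = k}" by auto
  also have "\<dots> = \<Union>?CC"
  proof (intro equalityI subsetI)
    fix i assume "i \<in> {i \<in> {1..n}. card (orbit \<pi> i) = k}"
    then show "i \<in> \<Union>?CC" using self by blast
  next
    fix i assume "i \<in> \<Union>?CC"
    then obtain x where x: "x \<in> {1..n}" "i \<in> orbit \<pi> x" "card (orbit \<pi> x) = k" by blast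
    then have "i \<in> {1..n}" using orbit_permutes_subset[OF permutes x(1)] by blast
    then show "i \<in> {i \<in> {1..n}. card (orbit \<pi> i) = k}" using x eq_orb by fastforce
  qed
  finally have *: "{i \<in> {1..n}. itin i \<in> prim_words a k} = \<Union>?CC" .
  have "?CC \<subseteq> orbit \<pi> ` {1..n}" by auto
  then have fin: "finite ?CC" by (rule finite_subset) simp
  have "k * card ?CC = card (\<Union>?CC)"
  proof (rule card_partition[OF fin])
    show "finite (\<Union>?CC)" unfolding *[symmetric] by simp
    show "C1 \<inter> C2 = {}" if "C1 \<in> ?CC" "C2 \<in> ?CC" "C1 \<noteq> C2" for C1 C2
    proof (rule ccontr)
      note C = that
      assume "C1 \<inter> C2 \<noteq> {}"
      then obtain y where y: "y \<in> C1" "y \<in> C2" by blast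
      obtain x1 x2 where "C1 = orbit \<pi> x1" "C2 = orbit \<pi> x2" using C(1,2) by blast
      then have "C1 = orbit \<pi> y" "C2 = orbit \<pi> y" using y eq_orb[of y x1] eq_orb[of y x2] by simp_all
      then show False using C(3) by simp
    qed
  qed auto
  moreover have "(\<Sum>u\<in>prim_words a k. mult u) = card {i \<in> {1..n}. itin i \<in> prim_words a k}"
    by (rule sum_mult) simp
  ultimately show ?thesis unfolding * num_cycles_def by simp
qed

lemma mult_outside: "u \<notin> prim_words_upto a n \<Longrightarrow> mult u = 0"
  using itin_upto by (auto simp: mult_def simp del: atLeastAtMost_iff)

lemma mult_in_mult_funs:
  assumes "\<pi> \<in> conj_class n lam"
  shows "mult \<in> mult_funs a n lam"
  unfolding mult_funs_def
proof (intro CollectI conjI ballI allI impI)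
  show "mult u = 0" if "u \<notin> prim_words_upto a n" for u
    using that by (rule mult_outside)
  show "mult (shift 1 u) = mult u" if "u \<in> prim_words_upto a n" for u
    using that mult_shift(1) by (auto simp: prim_words_upto_def)
  show "(\<Sum>u\<in>prim_words a i. mult u) = i * lam i" if "i \<in> {1..n}" for i
    using that assms by (simp add: sum_mult_prim conj_class_def)
qed

lemma prod_mult:
  fixes x :: "nat \<Rightarrow> 'a::comm_semiring_1"
  shows "(\<Prod>i=1..n. x (c i)) = mult_weight x a n mult"
proof -
  have "(\<Prod>i=1..n. x (c i)) = (\<Prod>u\<in>prim_words_upto a n. \<Prod>i\<in>{i \<in> {1..n}. itin i = u}. x (c i))"
    using itin_upto by (intro prod.group[symmetric]) auto
  also have "\<dots> = (\<Prod>u\<in>prim_words_upto a n. \<Prod>i\<in>{i \<in> {1..n}. itin i = u}. x (u 0))"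
    by (intro prod.cong refl) (auto simp: itinerary_def)
  finally show ?thesis by (simp add: mult_weight_def mult_def)
qed

end


section \<open>Ranks in a finite strict order\<close>

definition rank :: "('b \<Rightarrow> 'b \<Rightarrow> bool) \<Rightarrow> 'b set \<Rightarrow> 'b \<Rightarrow> nat" where
  "rank R P p = Suc (card {q \<in> P. R q p})"

lemma rank_less:
  assumes "finite P" "irreflp R" "transp R"
    and "p \<in> P" "q \<in> P" "R p q"
  shows "rank R P p < rank R P q"
proof -
  have "{r \<in> P. R r p} \<subset> {r \<in> P. R r q}"
    using assms(4-) irreflpD[OF assms(2)] transpD[OF assms(3)] by blast
  then show ?thesis using assms(1) by (simp add: rank_def psubset_card_mono)
qed

lemma bij_betw_rank:
  assumes "finite P" "irreflp R" "transp R"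
    and "\<And>p q. p \<noteq> q \<Longrightarrow> R p q \<or> R q p"
  shows "bij_betw (rank R P) P {1..card P}"
proof -
  have inj: "inj_on (rank R P) P"
    using rank_less[OF assms(1-3)] assms(4) by (intro inj_onI) (metis less_irrefl)
  have "rank R P ` P \<subseteq> {1..card P}"
  proof
    fix k assume "k \<in> rank R P ` P"
    then obtain p where p: "p \<in> P" "k = rank R P p" by auto
    then have "{q \<in> P. R q p} \<subset> P" using irreflpD[OF assms(2)] by blast
    then show "k \<in> {1..card P}" using p assms(1) by (simp add: rank_def psubset_card_mono Suc_le_eq)
  qed
  then have "rank R P ` P = {1..card P}" using inj by (intro card_subset_eq) (simp_all add: card_image)
  then show ?thesis using inj by (simp add: bij_betw_def)
qed

text \<open>The elements below \<open>e i\<close> are the images of the indices below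
  \<open>i\<close>; in this way sorting will give back the original positions.\<close>

lemma rank_of_mono_enumeration:
  assumes "bij_betw e {1..n} P" "irreflp R" "transp R"
    and mono: "\<And>i j. i \<in> {1..n} \<Longrightarrow> j \<in> {1..n} \<Longrightarrow> i < j \<Longrightarrow> R (e i) (e j)" and i: "i \<in> {1..n}"
  shows "rank R P (e i) = i"
proof -
  have P: "P = e ` {1..n}" and inj: "inj_on e {1..n}" using assms(1) by (auto simp: bij_betw_def)
  have "R (e j) (e i) \<longleftrightarrow> j < i" if "j \<in> {1..n}" for j
    using mono[OF that i] mono[OF i that] irreflpD[OF assms(2)] transpD[OF assms(3)]
    by (cases i j rule: linorder_cases) blast+
  then have "{q \<in> P. R q (e i)} = e ` {1..<i}" using i by (auto simp: P)
  moreover have "inj_on e {1..<i}" using inj i by (rule_tac inj_on_subset[OF inj]) auto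
  ultimately show ?thesis using i by (simp add: rank_def card_image)
qed

text \<open>Lexicographically larger words come first, since the letters of a compatible word decrease. The
  copies of one word keep their order under the shift, which is how ties are broken.\<close>

definition point_less :: "(nat \<Rightarrow> nat) \<times> nat \<Rightarrow> (nat \<Rightarrow> nat) \<times> nat \<Rightarrow> bool" where
  "point_less p q \<longleftrightarrow> lex_gt (fst p) (fst q) \<or> fst p = fst q \<and> snd p < snd q"

lemma point_less_irrefl: "irreflp point_less"
  by (simp add: point_less_def irreflp_def)

lemma point_less_trans: "transp point_less"
  by (rule transpI) (auto simp: point_less_def dest: lex_gt_trans)

lemma point_less_total: "p \<noteq> q \<Longrightarrow> point_less p q \<or> point_less q p"
  using lex_gt_total[of "fst p" "fst q"] by (cases "fst p = fst q") (auto simp: point_less_def prod_eq_iff)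

text \<open>The numbered copies of all words, counted from 0; they take the place of the positions
  \<open>{1..n}\<close>.\<close>

definition points :: "((nat \<Rightarrow> nat) \<Rightarrow> nat) \<Rightarrow> ((nat \<Rightarrow> nat) \<times> nat) set" where
  "points N = {p. snd p < N (fst p)}"

text \<open>What a permutation does to positions, seen on words: the word moves on by one letter and
  the copy number stays.\<close>

definition point_step :: "(nat \<Rightarrow> nat) \<times> nat \<Rightarrow> (nat \<Rightarrow> nat) \<times> nat" where
  "point_step p = (shift 1 (fst p), snd p)"

abbreviation "point_rank N \<equiv> rank point_less (points N)"

abbreviation "point_at N \<equiv> inv_into (points N) (point_rank N)"

definition perm_of_mult :: "nat \<Rightarrow> ((nat \<Rightarrow> nat) \<Rightarrow> nat) \<Rightarrow> nat \<Rightarrow> nat" where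
  "perm_of_mult n N i = (if i \<in> {1..n} then point_rank N (point_step (point_at N i)) else i)"

definition word_of_mult :: "nat \<Rightarrow> ((nat \<Rightarrow> nat) \<Rightarrow> nat) \<Rightarrow> nat \<Rightarrow> nat" where
  "word_of_mult n N i = (if i \<in> {1..n} then fst (point_at N i) 0 else 0)"

section \<open>Recovering a compatible pair from its multiplicities\<close>

context compat_pair
begin

definition point :: "nat \<Rightarrow> (nat \<Rightarrow> nat) \<times> nat" where
  "point i = (itin i, card {j \<in> {1..n}. itin j = itin i \<and> j < i})"

lemma point_mono:
  assumes "i < j" "i \<in> {1..n}" "j \<in> {1..n}"
  shows "point_less (point i) (point j)"
proof (cases "itin i = itin j")
  case True
  then have "{k \<in> {1..n}. itin k = itin i \<and> k < i} \<subset> {k \<in> {1..n}. itin k = itin j \<and> k < j}"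
    using assms by fastforce
  then show ?thesis using True by (simp add: point_less_def point_def psubset_card_mono)
next
  case False
  then show ?thesis using itin_mono[OF assms] by (simp add: point_less_def point_def)
qed

text \<open>Injectivity is monotonicity. Surjectivity is a count: every position has exactly one
  itinerary, so the multiplicities add up to \<open>n\<close>.\<close>

lemma bij_betw_point: "bij_betw point {1..n} (points mult)"
proof -
  have inj: "inj_on point {1..n}"
  proof (rule linorder_inj_onI)
    show "point i \<noteq> point j" if "i < j" "i \<in> {1..n}" "j \<in> {1..n}" for i j
      using point_mono[OF that] irreflpD[OF point_less_irrefl] by metis
  qed auto
  have sub: "point ` {1..n} \<subseteq> points mult"
  proof
    fix p assume "p \<in> point ` {1..n}"
    then obtain i where i: "i \<in> {1..n}" "p = point i" by auto
    then have "{j \<in> {1..n}. itin j = itin i \<and> j < i} \<subset> {j \<in> {1..n}. itin j = itin i}" by fastforce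
    then show "p \<in> points mult" using i by (simp add: points_def point_def mult_def psubset_card_mono)
  qed
  have pts: "points mult = (SIGMA u:prim_words_upto a n. {..<mult u})"
    using mult_outside by (fastforce simp: points_def)
  have "{i \<in> {1..n}. itin i \<in> prim_words_upto a n} = {1..n}"
    using itin_upto by blast
  then have "card (points mult) = n"
    unfolding pts by (subst card_SigmaI) (simp_all add: sum_mult)
  moreover have "finite (points mult)" unfolding pts by simp
  ultimately have "point ` {1..n} = points mult"
    using sub inj by (intro card_subset_eq) (simp_all add: card_image)
  then show ?thesis using inj by (simp add: bij_betw_def)
qed

lemma point_rank_point: "i \<in> {1..n} \<Longrightarrow> point_rank mult (point i) = i"
  by (rule rank_of_mono_enumeration[OF bij_betw_point point_less_irrefl point_less_trans])
     (auto intro: point_mono simp del: atLeastAtMost_iff)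

lemma point_at_point: "i \<in> {1..n} \<Longrightarrow> point_at mult i = point i"
proof -
  assume i: "i \<in> {1..n}"
  have "inj_on (point_rank mult) (points mult)"
  proof (rule inj_onI)
    fix p q assume "p \<in> points mult" "q \<in> points mult" and eq: "point_rank mult p = point_rank mult q"
    then obtain j k where "j \<in> {1..n}" "p = point j" "k \<in> {1..n}" "q = point k"
      using bij_betw_imp_surj_on[OF bij_betw_point] by blast
    then show "p = q" using eq by (simp add: point_rank_point del: atLeastAtMost_iff)
  qed
  then show ?thesis
    using i bij_betw_point point_rank_point[OF i] by (metis bij_betwE inv_into_f_f)
qed

text \<open>Among positions with the same itinerary \<open>\<pi>\<close> preserves the order, and it
  reaches all positions reading the shifted word, so the number of a position among its equals does
  not change.\<close>

lemma point_step_point: 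
  assumes i: "i \<in> {1..n}"
  shows "point_step (point i) = point (\<pi> i)"
proof -
  have img: "\<pi> ` {j \<in> {1..n}. itin j = itin i} = {j \<in> {1..n}. itin j = shift 1 (itin i)}"
    by (rule mult_shift(2)[OF itin_prim[OF i]])
  have less: "\<pi> j < \<pi> i \<longleftrightarrow> j < i" if "j \<in> {1..n}" "itin j = itin i" for j
  proof -
    have "c j = c i" using fun_cong[OF that(2), of 0] by (simp add: itinerary_def)
    then show ?thesis
      using mono_step[OF _ that(1) i] mono_step[OF _ i that(1)] by (cases i j rule: linorder_cases) auto
  qed
  have "{j \<in> {1..n}. itin j = itin (\<pi> i) \<and> j < \<pi> i} = \<pi> ` {j \<in> {1..n}. itin j = itin i \<and> j < i}"
  proof -
    have "itin (\<pi> i) = shift 1 (itin i)" by (simp add: itinerary_shift)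
    then have "{j \<in> {1..n}. itin j = itin (\<pi> i) \<and> j < \<pi> i} = {j \<in> \<pi> ` {j \<in> {1..n}. itin j = itin i}. j < \<pi> i}"
      unfolding img by simp
    also have "\<dots> = \<pi> ` {j \<in> {1..n}. itin j = itin i \<and> j < i}" using less by blast
    finally show ?thesis .
  qed
  moreover have "inj_on \<pi> S" for S by (simp add: inj_on_def)
  ultimately show ?thesis by (simp add: point_step_def point_def itinerary_shift card_image)
qed

lemma perm_of_mult: "perm_of_mult n mult = \<pi>"
proof
  fix i
  show "perm_of_mult n mult i = \<pi> i"
  proof (cases "i \<in> {1..n}")
    case True
    moreover have "\<pi> i \<in> {1..n}" using in_range[OF True, of 1] by simp
    ultimately show ?thesis by (simp add: perm_of_mult_def point_at_point point_step_point point_rank_point del: atLeastAtMost_iff)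
  next
    case False
    then show ?thesis using permutes by (simp add: perm_of_mult_def permutes_not_in del: atLeastAtMost_iff)
  qed
qed

lemma word_of_mult: "word_of_mult n mult = c"
proof
  fix i
  show "word_of_mult n mult i = c i"
  proof (cases "i \<in> {1..n}")
    case True
    then show ?thesis by (simp add: word_of_mult_def point_at_point point_def itinerary_def del: atLeastAtMost_iff)
  next
    case False
    then show ?thesis using compat by (simp add: word_of_mult_def compat_words_def del: atLeastAtMost_iff)
  qed
qed

end

section \<open>From a multiplicity function to a compatible pair\<close>

context
  fixes n a :: nat and lam N
  assumes lam: "partition_of lam n" and N: "N \<in> mult_funs a n lam"
begin

lemma points_eq: "points N = (SIGMA u:prim_words_upto a n. {..<N u})"
  using N by (fastforce simp: points_def mult_funs_def)

lemma finite_points: "finite (points N)"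
  unfolding points_eq by simp

lemma card_points: "card (points N) = n"
proof -
  have "card (points N) = (\<Sum>u\<in>prim_words_upto a n. N u)"
    unfolding points_eq by (subst card_SigmaI) auto
  also have "\<dots> = (\<Sum>i=1..n. \<Sum>u\<in>prim_words a i. N u)"
    unfolding prim_words_upto_def by (intro sum.UNION_disjoint) (auto dest: prim_words_unique)
  also have "\<dots> = n" using N lam by (simp add: mult_funs_def partition_of_def)
  finally show ?thesis .
qed

lemma bij_point_rank: "bij_betw (point_rank N) (points N) {1..n}"
  using bij_betw_rank[OF finite_points point_less_irrefl point_less_trans point_less_total]
  by (simp add: card_points)

lemma point_at_in: "i \<in> {1..n} \<Longrightarrow> point_at N i \<in> points N"
  using bij_point_rank by (metis bij_betw_imp_surj_on inv_into_into)

lemma rank_point_at: "i \<in> {1..n} \<Longrightarrow> point_rank N (point_at N i) = i"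
  using bij_point_rank by (metis bij_betw_imp_surj_on f_inv_into_f)

lemma point_at_rank: "p \<in> points N \<Longrightarrow> point_at N (point_rank N p) = p"
  using bij_point_rank by (metis bij_betw_imp_inj_on inv_into_f_f)

lemma point_rank_less: "p \<in> points N \<Longrightarrow> q \<in> points N \<Longrightarrow> point_less p q \<Longrightarrow> point_rank N p < point_rank N q"
  by (rule rank_less[OF finite_points point_less_irrefl point_less_trans])

lemma point_at_less:
  assumes "i < j" "i \<in> {1..n}" "j \<in> {1..n}"
  shows "point_less (point_at N i) (point_at N j)"
proof (rule ccontr)
  assume "\<not> ?thesis"
  moreover have "point_at N i \<noteq> point_at N j" using rank_point_at assms by (metis less_irrefl)
  ultimately have "point_less (point_at N j) (point_at N i)" using point_less_total by blast
  then have "j < i" using point_rank_less point_at_in rank_point_at assms by metis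
  then show False using assms by simp
qed

lemma point_step_in: "p \<in> points N \<Longrightarrow> point_step p \<in> points N"
proof -
  assume p: "p \<in> points N"
  then have "fst p \<in> prim_words_upto a n" by (auto simp: points_eq)
  then have "N (shift 1 (fst p)) = N (fst p)" using N by (simp add: mult_funs_def)
  then show ?thesis using p by (simp add: points_def point_step_def)
qed

lemma bij_point_step: "bij_betw point_step (points N) (points N)"
proof -
  have "inj_on point_step (points N)"
  proof (rule inj_onI)
    fix p q assume p: "p \<in> points N" and q: "q \<in> points N" and eq: "point_step p = point_step q"
    obtain i k where i: "fst p \<in> prim_words a i" and k: "fst q \<in> prim_words a k"
      using p q by (auto simp: points_eq prim_words_upto_def)
    have sh: "shift 1 (fst p) = shift 1 (fst q)" using eq by (simp add: point_step_def)
    have "i = k" using shift_prim_words[OF i, of 1] shift_prim_words[OF k, of 1] sh prim_words_unique by simp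
    moreover have "shift (i - 1) (shift 1 (fst p)) = fst p" using i by (simp add: prim_words_iff_shift)
    moreover have "shift (k - 1) (shift 1 (fst q)) = fst q" using k by (simp add: prim_words_iff_shift)
    ultimately have "fst p = fst q" using sh by metis
    then show "p = q" using eq by (simp add: point_step_def prod_eq_iff)
  qed
  moreover from this have "point_step ` points N = points N"
    using point_step_in by (intro endo_inj_surj finite_points) blast+
  ultimately show ?thesis by (simp add: bij_betw_def)
qed

lemma perm_of_mult_permutes: "perm_of_mult n N permutes {1..n}"
proof (rule bij_imp_permutes)
  have "bij_betw (point_rank N \<circ> (point_step \<circ> point_at N)) {1..n} {1..n}"
    using bij_point_rank bij_point_step bij_betw_inv_into[OF bij_point_rank] by (intro bij_betw_trans)
  then show "bij_betw (perm_of_mult n N) {1..n} {1..n}"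
    by (rule bij_betw_cong[THEN iffD1, rotated]) (simp add: perm_of_mult_def)
qed (auto simp: perm_of_mult_def)

text \<open>If neighbouring positions carry the same letter, their order survives the shift: either
  the words differ later, which is \<open>lex_gt_shift\<close>, or they are copies of one word. So
  there is no descent at that place, and every descent comes with a strict drop.\<close>

lemma word_of_mult_compat: "word_of_mult n N \<in> compat_words n a (descents n (perm_of_mult n N))"
  unfolding compat_words_def
proof (intro CollectI conjI ballI allI impI)
  show "word_of_mult n N i < a" if "i \<in> {1..n}" for i
    using point_at_in[OF that] that
    by (auto simp: points_eq word_of_mult_def prim_words_upto_def prim_words_iff_shift simp del: atLeastAtMost_iff)
next
  fix i assume i: "i \<in> {1..<n}"
  then have i': "i \<in> {1..n}" "i + 1 \<in> {1..n}" by auto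
  let ?p = "point_at N i" and ?q = "point_at N (i + 1)"
  have less: "point_less ?p ?q" using i' by (intro point_at_less) auto
  then show le: "word_of_mult n N (i + 1) \<le> word_of_mult n N i"
    using i' lex_gt_0 by (auto simp: word_of_mult_def point_less_def simp del: atLeastAtMost_iff)
  assume d: "i \<in> descents n (perm_of_mult n N)"
  show "word_of_mult n N (i + 1) < word_of_mult n N i"
  proof (rule ccontr)
    assume "\<not> ?thesis"
    then have eq: "fst ?p 0 = fst ?q 0" using le i' by (simp add: word_of_mult_def del: atLeastAtMost_iff)
    then have "point_less (point_step ?p) (point_step ?q)"
      using less lex_gt_shift by (auto simp: point_less_def point_step_def)
    then have "perm_of_mult n N i < perm_of_mult n N (i + 1)"
      using i' by (simp add: perm_of_mult_def point_rank_less point_step_in point_at_in del: atLeastAtMost_iff)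
    then show False using d by (simp add: descents_def)
  qed
qed (simp add: word_of_mult_def del: atLeastAtMost_iff)

interpretation cp: compat_pair n a "perm_of_mult n N" "word_of_mult n N"
  by unfold_locales (rule perm_of_mult_permutes, rule word_of_mult_compat)

lemma itinerary_of_mult:
  assumes i: "i \<in> {1..n}"
  shows "itinerary (perm_of_mult n N) (word_of_mult n N) i = fst (point_at N i)"
proof
  fix k
  have "(perm_of_mult n N ^^ k) i \<in> {1..n} \<and>
    point_at N ((perm_of_mult n N ^^ k) i) = (shift k (fst (point_at N i)), snd (point_at N i))"
  proof (induction k)
    case (Suc k)
    let ?j = "(perm_of_mult n N ^^ k) i"
    from Suc have j: "?j \<in> {1..n}" by simp
    have "point_at N (perm_of_mult n N ?j) = point_step (point_at N ?j)"
      using j by (simp add: perm_of_mult_def point_at_rank point_step_in point_at_in del: atLeastAtMost_iff)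
    then show ?case using Suc cp.in_range[OF i, of "Suc k"]
      by (simp add: point_step_def del: atLeastAtMost_iff)
  qed (use i in simp)
  then show "itinerary (perm_of_mult n N) (word_of_mult n N) i k = fst (point_at N i) k"
    by (simp add: itinerary_def word_of_mult_def shift_def del: atLeastAtMost_iff)
qed

lemma mult_of_mult: "cp.mult = N"
proof
  fix u
  have "{i \<in> {1..n}. itinerary (perm_of_mult n N) (word_of_mult n N) i = u} = point_rank N ` ({u} \<times> {..<N u})"
  proof (intro equalityI subsetI)
    fix i assume "i \<in> {i \<in> {1..n}. itinerary (perm_of_mult n N) (word_of_mult n N) i = u}"
    then have i: "i \<in> {1..n}" "fst (point_at N i) = u" using itinerary_of_mult by auto
    then have "point_at N i \<in> {u} \<times> {..<N u}" using point_at_in[OF i(1)] by (auto simp: points_def mem_Times_iff)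
    then show "i \<in> point_rank N ` ({u} \<times> {..<N u})" using rank_point_at[OF i(1)] by (metis imageI)
  next
    fix i assume "i \<in> point_rank N ` ({u} \<times> {..<N u})"
    then obtain p where p: "p \<in> points N" "fst p = u" "i = point_rank N p" by (auto simp: points_def)
    then have "i \<in> {1..n}" using bij_point_rank by (auto simp: bij_betw_def)
    then show "i \<in> {i \<in> {1..n}. itinerary (perm_of_mult n N) (word_of_mult n N) i = u}"
      using itinerary_of_mult p point_at_rank by auto
  qed
  moreover have "inj_on (point_rank N) ({u} \<times> {..<N u})"
    by (rule inj_on_subset[OF bij_betw_imp_inj_on[OF bij_point_rank]]) (auto simp: points_def)
  ultimately show "cp.mult u = N u" by (simp add: cp.mult_def card_image)
qed

text \<open>The cycle type needs no separate analysis: the constructed pair has multiplicity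
  function \<open>N\<close>, so \<open>sum_mult_prim\<close> turns the prescribed masses into cycle
  counts.\<close>

lemma perm_of_mult_conj_class: "perm_of_mult n N \<in> conj_class n lam"
proof -
  have "num_cycles n (perm_of_mult n N) k = lam k" if k: "k \<in> {1..n}" for k
  proof -
    have "k * num_cycles n (perm_of_mult n N) k = k * lam k"
      using cp.sum_mult_prim[of k] N k unfolding mult_of_mult by (simp add: mult_funs_def)
    then show ?thesis using k by simp
  qed
  then show ?thesis using perm_of_mult_permutes by (simp add: conj_class_def)
qed

end

lemma finite_conj_class: "finite (conj_class n lam)"
  by (rule finite_subset[OF _ finite_permutations[of "{1..n}"]]) (auto simp: conj_class_def)

lemma finite_compat_words: "finite (compat_words n a D)"
proof -
  have "compat_words n a D \<subseteq> {c. \<forall>i. (i \<in> {1..n} \<longrightarrow> c i \<in> {..<a}) \<and> (i \<notin> {1..n} \<longrightarrow> c i = 0)}"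
    by (auto simp: compat_words_def)
  then show ?thesis by (rule finite_subset) (intro finite_set_of_finite_funs; simp)
qed

text \<open>The correspondence preserves weights by \<open>prod_mult\<close>, since the letter at a
  position is the first letter of its itinerary.\<close>

theorem sum_compat_pairs:
  fixes x :: "nat \<Rightarrow> 'a::comm_semiring_1"
  assumes lam: "partition_of lam n"
  shows "(\<Sum>\<pi>\<in>conj_class n lam. \<Sum>c\<in>compat_words n a (descents n \<pi>). \<Prod>i=1..n. x (c i)) = mult_gf x a n lam"
proof -
  let ?m = "\<lambda>(\<pi>, c). compat_pair.mult n \<pi> c"
  have cp: "compat_pair n a (fst p) (snd p)" "fst p \<in> conj_class n lam" if "p \<in> compat_pairs n a lam" for p
    using that by (auto simp: compat_pairs_def compat_pair_def conj_class_def)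
  have bij: "bij_betw ?m (compat_pairs n a lam) (mult_funs a n lam)"
  proof (rule bij_betwI[where g = "\<lambda>N. (perm_of_mult n N, word_of_mult n N)"])
    show "?m \<in> compat_pairs n a lam \<rightarrow> mult_funs a n lam"
      using cp compat_pair.mult_in_mult_funs by (fastforce simp: case_prod_beta)
    show "(\<lambda>N. (perm_of_mult n N, word_of_mult n N)) \<in> mult_funs a n lam \<rightarrow> compat_pairs n a lam"
      using perm_of_mult_conj_class[OF lam] word_of_mult_compat[OF lam] by (auto simp: compat_pairs_def)
    show "(perm_of_mult n (?m p), word_of_mult n (?m p)) = p" if "p \<in> compat_pairs n a lam" for p
      using compat_pair.perm_of_mult[OF cp(1)[OF that]] compat_pair.word_of_mult[OF cp(1)[OF that]]
      by (simp add: case_prod_beta)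
    show "?m (perm_of_mult n N, word_of_mult n N) = N" if "N \<in> mult_funs a n lam" for N
      using mult_of_mult[OF lam that] by simp
  qed
  have "mult_gf x a n lam = (\<Sum>p\<in>compat_pairs n a lam. mult_weight x a n (?m p))"
    unfolding mult_gf_def by (rule sum.reindex_bij_betw[OF bij, symmetric])
  also have "\<dots> = (\<Sum>p\<in>compat_pairs n a lam. \<Prod>i=1..n. x (snd p i))"
    by (intro sum.cong refl, simp only: case_prod_beta) (rule compat_pair.prod_mult[OF cp(1), symmetric])
  also have "\<dots> = (\<Sum>\<pi>\<in>conj_class n lam. \<Sum>c\<in>compat_words n a (descents n \<pi>). \<Prod>i=1..n. x (c i))"
    unfolding compat_pairs_def by (subst sum.Sigma) (auto simp: case_prod_beta finite_conj_class finite_compat_words)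
  finally show ?thesis ..
qed

section \<open>Polynomial form of the joint generating function\<close>


lemma compat_words_antimono:
  assumes "c \<in> compat_words n b D" "i \<le> j" "i \<in> {1..n}" "j \<in> {1..n}"
  shows "c j \<le> c i"
  using assms(2,4)
proof (induction rule: dec_induct)
  case (step m)
  then have "m \<in> {1..<n}" using assms(3) by auto
  then have "c (m + 1) \<le> c m" using assms(1) by (simp add: compat_words_def)
  then show ?case using step \<open>m \<in> {1..<n}\<close> by simp
qed simp

lemma compat_words_0: "compat_words 0 b D = {\<lambda>_. 0}"
  by (auto simp: compat_words_def)

lemma compat_words_Suc_0: "compat_words (Suc n) 0 D = {}"
  by (auto simp: compat_words_def)

definition raise_word :: "nat \<Rightarrow> (nat \<Rightarrow> nat) \<Rightarrow> nat \<Rightarrow> nat" where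
  "raise_word n c i = (if i \<in> {1..n} then Suc (c i) else 0)"

lemma inj_on_raise_word: "inj_on (raise_word n) (compat_words n b D)"
proof (rule inj_onI)
  fix c c' assume c: "c \<in> compat_words n b D" "c' \<in> compat_words n b D" "raise_word n c = raise_word n c'"
  show "c = c'"
  proof
    fix i show "c i = c' i"
      using c(1,2) fun_cong[OF c(3), of i]
      by (cases "i \<in> {1..n}") (auto simp: raise_word_def compat_words_def simp del: atLeastAtMost_iff)
  qed
qed

lemma raise_word_compat:
  "c \<in> compat_words n b D \<Longrightarrow> raise_word n c \<in> compat_words n (Suc b) D"
  by (auto simp: compat_words_def raise_word_def)

lemma raise_word_image:
  assumes "c \<in> compat_words n (Suc b) D" "\<And>i. i \<in> {1..n} \<Longrightarrow> 0 < c i"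
  shows "c \<in> raise_word n ` compat_words n b D"
proof
  show "c = raise_word n (\<lambda>i. c i - 1)"
    using assms by (auto simp: fun_eq_iff raise_word_def compat_words_def)
  have "c i - 1 < b" if "i \<in> {1..n}" for i
  proof -
    have "c i < Suc b" using assms(1) that by (simp add: compat_words_def)
    then show ?thesis using assms(2)[OF that] by simp
  qed
  moreover have "c (i + 1) - 1 \<le> c i - 1 \<and> (i \<in> D \<longrightarrow> c (i + 1) - 1 < c i - 1)" if "i \<in> {1..<n}" for i
  proof -
    have "c (i + 1) \<le> c i \<and> (i \<in> D \<longrightarrow> c (i + 1) < c i)"
      using assms(1) that by (simp add: compat_words_def)
    moreover have "0 < c (i + 1)" using assms(2) that by simp
    ultimately show ?thesis by auto
  qed
  ultimately show "(\<lambda>i. c i - 1) \<in> compat_words n b D"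
    using assms(1) by (simp add: compat_words_def)
qed

text \<open>Split by the last letter, which is the smallest. If it is positive, all letters can be
  lowered by 1. If it is 0, drop it; when \<open>n \<in> D\<close> the remaining letters are
  positive and can be lowered as well, and with the last position gone the condition at
  \<open>n\<close> disappears from \<open>D\<close>.\<close>

lemma compat_words_Suc_Suc:
  "compat_words (Suc n) (Suc b) D = raise_word (Suc n) ` compat_words (Suc n) b D \<union>
     (if n \<in> D \<and> 0 < n then raise_word n ` compat_words n b (D - {n}) else compat_words n (Suc b) D)"
  (is "?L = ?A \<union> ?B")
proof (intro equalityI subsetI)
  fix c assume c: "c \<in> ?L"
  show "c \<in> ?A \<union> ?B"
  proof (cases "c (Suc n) = 0")
    case False
    have "0 < c i" if "i \<in> {1..Suc n}" for i
      using compat_words_antimono[OF c, of i "Suc n"] that False by auto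
    then show ?thesis using raise_word_image[OF c] by blast
  next
    case True
    have c': "c \<in> compat_words n (Suc b) (D - {n})" "c \<in> compat_words n (Suc b) D"
      using c True by (auto simp: compat_words_def le_Suc_eq)
    show ?thesis
    proof (cases "n \<in> D \<and> 0 < n")
      case nD: True
      then have "c (n + 1) < c n" using c unfolding compat_words_def by fastforce
      then have "0 < c i" if "i \<in> {1..n}" for i
        using compat_words_antimono[OF c'(1), of i n] that by fastforce
      then show ?thesis using raise_word_image[OF c'(1)] nD by auto
    qed (use c' in auto)
  qed
next
  fix c assume "c \<in> ?A \<union> ?B"
  then consider "c \<in> ?A" | "c \<in> ?B" by blast
  then show "c \<in> ?L"
  proof cases
    case 1
    then show ?thesis using raise_word_compat by blast
  next
    case 2
    show ?thesis
    proof (cases "n \<in> D \<and> 0 < n")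
      case True
      then obtain c' where c': "c' \<in> compat_words n b (D - {n})" "c = raise_word n c'" using 2 by auto
      then have c: "c \<in> compat_words n (Suc b) (D - {n})" using raise_word_compat by blast
      have "0 < c n" "c (Suc n) = 0" using c'(2) True by (auto simp: raise_word_def)
      then show ?thesis using c by (auto simp: compat_words_def less_Suc_eq le_Suc_eq)
    next
      case False
      then have c: "c \<in> compat_words n (Suc b) D" using 2 by auto
      then show ?thesis using False by (auto simp: compat_words_def less_Suc_eq le_Suc_eq)
    qed
  qed
qed

lemma sum_raise_word:
  fixes q :: "'a::comm_semiring_1"
  shows "(\<Sum>c\<in>raise_word n ` compat_words n b D. \<Prod>i=1..n. q ^ c i)
    = q ^ n * (\<Sum>c\<in>compat_words n b D. \<Prod>i=1..n. q ^ c i)"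
proof -
  have raise: "(\<Prod>i=1..n. q ^ raise_word n c i) = q ^ n * (\<Prod>i=1..n. q ^ c i)" for c
  proof -
    have "(\<Prod>i=1..n. q ^ raise_word n c i) = (\<Prod>i=1..n. q * q ^ c i)"
      by (intro prod.cong) (auto simp: raise_word_def)
    then show ?thesis by (simp add: prod.distrib)
  qed
  then show ?thesis by (simp add: sum.reindex[OF inj_on_raise_word] sum_distrib_left)
qed

text \<open>A q-binomial coefficient: subtracting the least word with the required drops, of weight
  \<open>q ^ (\<Sum>D)\<close>, leaves weakly decreasing words over \<open>b - card D\<close>
  letters. In the form of quotients it also covers small \<open>b\<close>, where for
  \<open>0 < n\<close> and \<open>b \<le> card D\<close> one factor vanishes.\<close>

lemma sum_compat_words:
  fixes q :: "'a::field"
  assumes "q \<noteq> 0" "D \<subseteq> {1..<n}" "\<forall>j\<in>{1..n}. q ^ j \<noteq> 1"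
  shows "(\<Sum>c\<in>compat_words n b D. \<Prod>i=1..n. q ^ c i)
    = q ^ (\<Sum>D) * (\<Prod>j=1..n. (1 - q ^ b * q ^ j / q ^ (card D + 1)) / (1 - q ^ j))"
  using assms(2,3)
proof (induction n arbitrary: b D)
  case 0
  then show ?case by (simp add: compat_words_0)
next
  case (Suc n)
  note IHn = Suc.IH and premsn = Suc.prems
  show ?case
    using Suc.prems(1)
  proof (induction b)
    case 0
    have "finite D" using premsn by (auto intro: finite_subset)
    then have "card D \<le> card {1..<Suc n}" using premsn by (intro card_mono) auto
    then have "card D + 1 \<in> {1..Suc n}" by simp
    then have "(\<Prod>j=1..Suc n. (1 - q ^ 0 * q ^ j / q ^ (card D + 1)) / (1 - q ^ j)) = 0"
      using assms(1) by (intro prod_zero bexI[of _ "card D + 1"]) auto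
    then show ?case by (simp add: compat_words_Suc_0)
  next
    case (Suc b)
    define k where "k = card D"
    \<comment> \<open>In both cases with last letter 0 the alphabet size and the number of drops
      change so that the same \<open>y\<close> results; hence both contribute
      \<open>P / Q\<close>.\<close>
    define y where "y = q ^ b / q ^ k"
    define P where "P = (\<Prod>j=1..n. (1 - y * q ^ j))"
    define Q where "Q = (\<Prod>j=1..n. (1 - q ^ j))"
    have Q0: "Q \<noteq> 0" using premsn(2) by (auto simp: Q_def)
    have qn: "1 - q ^ Suc n \<noteq> 0" using premsn(2) by (metis atLeastAtMost_iff eq_iff_diff_eq_0 le_add1 le_refl plus_1_eq_Suc)
    have finD: "finite D" using premsn by (auto intro: finite_subset)
    let ?S = "\<lambda>n A. (\<Sum>c\<in>A. \<Prod>i=1..n. q ^ c i)"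
    let ?B = "if n \<in> D \<and> 0 < n then raise_word n ` compat_words n b (D - {n}) else compat_words n (Suc b) D"
    have disj: "raise_word (Suc n) ` compat_words (Suc n) b D \<inter> ?B = {}"
    proof -
      have "c (Suc n) = 0" if "c \<in> ?B" for c
        using that by (auto simp: raise_word_def compat_words_def split: if_splits)
      moreover have "c (Suc n) \<noteq> 0" if "c \<in> raise_word (Suc n) ` compat_words (Suc n) b D" for c
        using that by (auto simp: raise_word_def)
      ultimately show ?thesis by blast
    qed
    have "?S (Suc n) (compat_words (Suc n) (Suc b) D)
        = ?S (Suc n) (raise_word (Suc n) ` compat_words (Suc n) b D) + ?S (Suc n) ?B"
      unfolding compat_words_Suc_Suc using disj finite_compat_words by (intro sum.union_disjoint) auto
    also have "?S (Suc n) ?B = ?S n ?B"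
    proof (intro sum.cong refl)
      fix c assume "c \<in> ?B"
      then have "c (Suc n) = 0" by (auto simp: raise_word_def compat_words_def split: if_splits)
      then show "(\<Prod>i=1..Suc n. q ^ c i) = (\<Prod>i=1..n. q ^ c i)" by simp
    qed
    also have "?S n ?B = q ^ (\<Sum>D) * (P / Q)"
    proof (cases "n \<in> D \<and> 0 < n")
      case True
      then have D': "D - {n} \<subseteq> {1..<n}" "\<Sum>D = n + \<Sum>(D - {n})"
        using premsn(1) finD by (auto simp: sum.remove)
      have k: "card (D - {n}) + 1 = k" using True card_Suc_Diff1[OF finD, of n] by (simp add: k_def)
      have "?S n ?B = q ^ n * ?S n (compat_words n b (D - {n}))"
        unfolding if_P[OF True] by (rule sum_raise_word)
      also have "\<dots> = q ^ n * (q ^ (\<Sum>(D - {n})) * (P / Q))"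
        using premsn(2) by (subst IHn[OF D'(1)]) (auto simp: k P_def Q_def y_def prod_dividef simp del: One_nat_def add_Suc_right)
      finally show ?thesis by (simp add: D'(2) power_add)
    next
      case False
      then have D': "D \<subseteq> {1..<n}" using premsn(1) by (auto simp: less_Suc_eq)
      have "?S n ?B = ?S n (compat_words n (Suc b) D)" using False by (simp only: if_False)
      also have "\<dots> = q ^ (\<Sum>D) * (P / Q)"
        using premsn(2) assms(1)
        by (subst IHn[OF D']) (auto simp: k_def[symmetric] P_def Q_def y_def prod_dividef)
      finally show ?thesis .
    qed
    also have "?S (Suc n) (raise_word (Suc n) ` compat_words (Suc n) b D)
        = q ^ (\<Sum>D) * (q ^ Suc n * (1 - y) * P / (Q * (1 - q ^ Suc n)))"
    proof -
      have "(\<Prod>j=1..Suc n. 1 - q ^ b * q ^ j / q ^ (card D + 1)) = (\<Prod>j=0..n. 1 - y * q ^ j)"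
        using assms(1) by (simp only: One_nat_def prod.atLeast_Suc_atMost_Suc_shift o_def) (simp add: y_def k_def)
      also have "\<dots> = (1 - y) * P"
        by (simp add: P_def prod.atLeast_Suc_atMost)
      finally have "(\<Prod>j=1..Suc n. (1 - q ^ b * q ^ j / q ^ (card D + 1)) / (1 - q ^ j))
          = (1 - y) * P / (Q * (1 - q ^ Suc n))"
        by (simp add: prod_dividef Q_def)
      then show ?thesis unfolding sum_raise_word Suc.IH[OF premsn(1)] by (simp add: mult_ac)
    qed
    also have "q ^ (\<Sum>D) * (q ^ Suc n * (1 - y) * P / (Q * (1 - q ^ Suc n))) + q ^ (\<Sum>D) * (P / Q)
        = q ^ (\<Sum>D) * (P * (1 - y * q ^ Suc n) / (Q * (1 - q ^ Suc n)))"
      using Q0 qn by (simp add: divide_simps del: power_Suc) (simp add: algebra_simps)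
    also have "P * (1 - y * q ^ Suc n) / (Q * (1 - q ^ Suc n))
        = (\<Prod>j=1..Suc n. (1 - q ^ Suc b * q ^ j / q ^ (card D + 1)) / (1 - q ^ j))"
      using assms(1) by (simp add: prod_dividef Q_def P_def y_def k_def)
    finally show ?case .
  qed
qed

text \<open>Expresses the power sums over primitive words through those over letters, by the recursion
  underlying Moebius inversion. This makes them polynomial in \<open>z\<close>.\<close>

fun prim_poly :: "(nat \<Rightarrow> 'a::comm_ring_1) \<Rightarrow> nat \<Rightarrow> nat \<Rightarrow> 'a" where
  "prim_poly P i m = P m ^ i - (\<Sum>j\<in>{j \<in> {1..<i}. j dvd i}. prim_poly P j (m * (i div j)))"

declare prim_poly.simps [simp del]

text \<open>Only power sums of index at most \<open>i * m\<close> enter. This bookkeeping is what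
  later confines the condition \<open>q ^ j \<noteq> 1\<close> to \<open>j \<le> n\<close>.\<close>

lemma prim_poly_power_sum:
  fixes x :: "nat \<Rightarrow> 'a::comm_ring_1"
  assumes "\<And>m. m \<in> {1..n} \<Longrightarrow> P m = (\<Sum>l<a. x l ^ m)" "0 < i" "0 < m" "i * m \<le> n"
  shows "prim_poly P i m = prim_sum x a i m"
  using assms(2-)
proof (induction i arbitrary: m rule: less_induct)
  case (less i)
  have m: "m \<in> {1..n}" using less.prems by (cases i) auto
  have "prim_poly P j (m * (i div j)) = prim_sum x a j (m * (i div j))" if "j \<in> {j \<in> {1..<i}. j dvd i}" for j
  proof -
    have "j * (i div j) * m \<le> n" "0 < i div j" using that less.prems(3) by (auto simp: dvd_def)
    then have "j * (m * (i div j)) \<le> n" "0 < i div j" by (simp_all only: mult_ac)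
    then show ?thesis using less that by (intro less.IH) auto
  qed
  then have "prim_poly P i m = P m ^ i - (\<Sum>j\<in>{j \<in> {1..<i}. j dvd i}. prim_sum x a j (m * (i div j)))"
    by (subst prim_poly.simps) simp
  also have "P m ^ i = (\<Sum>j | j dvd i. prim_sum x a j (m * (i div j)))"
    using power_sum_prim_sum[OF less.prems(1), of x m a] assms(1)[OF m] by simp
  also have "{j. j dvd i} = insert i {j \<in> {1..<i}. j dvd i}"
    using less.prems(1) by (auto dest: dvd_imp_le simp: le_eq_less_or_eq Suc_le_eq intro: dvd_pos_nat)
  finally show ?case using less.prems(1) by simp
qed

text \<open>The quotient \<open>prim_poly P i k / i\<close> is the \<open>k\<close>-th power sum of
  the necklaces of length \<open>i\<close>; so this is the plethysm of \<open>h_m\<close> with the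
  symmetric function of primitive necklaces, the factor for \<open>m\<close> cycles of length
  \<open>i\<close>.\<close>

definition cycle_poly :: "(nat \<Rightarrow> 'a::field_char_0) \<Rightarrow> nat \<Rightarrow> nat \<Rightarrow> 'a" where
  "cycle_poly P i m = hom_sym (\<lambda>k. prim_poly P i k / of_nat i) m"

lemma hom_sym_cong: "(\<And>k. k \<in> {1..m} \<Longrightarrow> p k = p' k) \<Longrightarrow> hom_sym p m = hom_sym p' m"
proof (induction m rule: less_induct)
  case (less m)
  then show ?case by (cases m) (auto intro!: sum.cong)
qed

lemma cycle_poly_0 [simp]: "cycle_poly P i 0 = 1"
  by (simp add: cycle_poly_def)

text \<open>For \<open>z = q ^ a\<close> this is the \<open>m\<close>-th power sum of the letter
  weights 1, q, ..., q^(a-1); in general it is a polynomial in \<open>z\<close>.\<close>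

definition geo_sum :: "'a::field \<Rightarrow> 'a \<Rightarrow> nat \<Rightarrow> 'a" where
  "geo_sum z q m = (1 - z ^ m) / (1 - q ^ m)"

definition des_maj_sum :: "nat \<Rightarrow> (nat \<Rightarrow> nat) \<Rightarrow> 'a::field \<Rightarrow> 'a \<Rightarrow> 'a" where
  "des_maj_sum n lam z q = (\<Sum>\<pi>\<in>conj_class n lam. q ^ maj n \<pi> *
     (\<Prod>j=1..n. (1 - z * q ^ j / q ^ des1 n \<pi>) / (1 - q ^ j)))"

lemma partition_of_le: "partition_of lam n \<Longrightarrow> i \<in> {1..n} \<Longrightarrow> i * lam i \<le> n"
  unfolding partition_of_def using member_le_sum[of i "{1..n}" "\<lambda>k. k * lam k"] by simp

text \<open>Two evaluations of one sum over pairs of a permutation and a word: permutation by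
  permutation with \<open>sum_compat_words\<close>, and through necklaces with
  \<open>sum_compat_pairs\<close>.\<close>

lemma des_maj_sum_power:
  fixes q :: "'a::field_char_0"
  assumes lam: "partition_of lam n" and q: "q \<noteq> 0" "\<forall>j\<in>{1..n}. q ^ j \<noteq> 1"
  shows "des_maj_sum n lam (q ^ a) q = (\<Prod>i=1..n. cycle_poly (geo_sum (q ^ a) q) i (lam i))"
proof -
  have "des_maj_sum n lam (q ^ a) q = (\<Sum>\<pi>\<in>conj_class n lam.
      \<Sum>c\<in>compat_words n a (descents n \<pi>). \<Prod>i=1..n. q ^ c i)"
    unfolding des_maj_sum_def
    using q by (intro sum.cong refl, subst sum_compat_words) (auto simp: descents_def maj_def des1_def)
  also have "\<dots> = mult_gf (\<lambda>l. q ^ l) a n lam"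
    by (rule sum_compat_pairs[OF lam, of "\<lambda>l. q ^ l"])
  also have "\<dots> = (\<Prod>i=1..n. cycle_poly (geo_sum (q ^ a) q) i (lam i))"
    unfolding mult_gf_eq_prod_hom_sym cycle_poly_def
  proof (intro prod.cong hom_sym_cong refl)
    fix i k assume i: "i \<in> {1..n}" and k: "k \<in> {1..lam i}"
    have P: "geo_sum (q ^ a) q m = (\<Sum>l<a. (q ^ l) ^ m)" if "m \<in> {1..n}" for m
    proof -
      have "(\<Sum>l<a. (q ^ l) ^ m) = (\<Sum>l<a. (q ^ m) ^ l)" by (simp add: power_mult[symmetric] mult.commute)
      also have "\<dots> = (1 - (q ^ m) ^ a) / (1 - q ^ m)" using q that by (subst sum_gp_strict) auto
      finally show ?thesis by (simp add: geo_sum_def power_mult[symmetric] mult.commute)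
    qed
    have "i * k \<le> i * lam i" using k by simp
    also have "\<dots> \<le> n" using partition_of_le[OF lam i] .
    finally have "prim_poly (geo_sum (q ^ a) q) i k = prim_sum (\<lambda>l. q ^ l) a i k"
      using P i k by (intro prim_poly_power_sum[where n = n]) auto
    then show "prim_sum (\<lambda>l. q ^ l) a i k / of_nat i = prim_poly (geo_sum (q ^ a) q) i k / of_nat i" by simp
  qed
  finally show ?thesis .
qed

section \<open>Extending the identity from powers of q to all z\<close>

definition is_poly_fun :: "('a::comm_ring_1 \<Rightarrow> 'a) \<Rightarrow> bool" where
  "is_poly_fun f \<longleftrightarrow> (\<exists>p. \<forall>z. f z = poly p z)"

lemma is_poly_fun_const: "is_poly_fun (\<lambda>_. c)"
  unfolding is_poly_fun_def by (intro exI[of _ "[:c:]"]) simp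

lemma is_poly_fun_id: "is_poly_fun (\<lambda>z. z)"
  unfolding is_poly_fun_def by (intro exI[of _ "[:0, 1:]"]) simp

lemma is_poly_fun_add: "is_poly_fun f \<Longrightarrow> is_poly_fun g \<Longrightarrow> is_poly_fun (\<lambda>z. f z + g z)"
  unfolding is_poly_fun_def by (metis poly_add)

lemma is_poly_fun_diff: "is_poly_fun f \<Longrightarrow> is_poly_fun g \<Longrightarrow> is_poly_fun (\<lambda>z. f z - g z)"
  unfolding is_poly_fun_def by (metis poly_diff)

lemma is_poly_fun_mult: "is_poly_fun f \<Longrightarrow> is_poly_fun g \<Longrightarrow> is_poly_fun (\<lambda>z. f z * g z)"
  unfolding is_poly_fun_def by (metis poly_mult)

lemma is_poly_fun_power: "is_poly_fun f \<Longrightarrow> is_poly_fun (\<lambda>z. f z ^ k)"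
  unfolding is_poly_fun_def by (metis poly_power)

lemma is_poly_fun_divide:
  fixes f :: "'a::field \<Rightarrow> 'a"
  shows "is_poly_fun f \<Longrightarrow> is_poly_fun (\<lambda>z. f z / c)"
  unfolding divide_inverse by (intro is_poly_fun_mult is_poly_fun_const)

lemma is_poly_fun_sum: "(\<And>i. i \<in> A \<Longrightarrow> is_poly_fun (f i)) \<Longrightarrow> is_poly_fun (\<lambda>z. \<Sum>i\<in>A. f i z)"
  by (induction A rule: infinite_finite_induct) (auto intro: is_poly_fun_const is_poly_fun_add)

lemma is_poly_fun_prod: "(\<And>i. i \<in> A \<Longrightarrow> is_poly_fun (f i)) \<Longrightarrow> is_poly_fun (\<lambda>z. \<Prod>i\<in>A. f i z)"
  by (induction A rule: infinite_finite_induct) (auto intro: is_poly_fun_const is_poly_fun_mult)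

lemmas is_poly_fun_intros = is_poly_fun_const is_poly_fun_id is_poly_fun_diff is_poly_fun_mult
  is_poly_fun_power is_poly_fun_divide is_poly_fun_sum is_poly_fun_prod

lemma is_poly_fun_eqI:
  fixes f g :: "'a::idom \<Rightarrow> 'a"
  assumes "is_poly_fun f" "is_poly_fun g" "infinite S" "\<And>z. z \<in> S \<Longrightarrow> f z = g z"
  shows "f z = g z"
proof -
  obtain p where p: "\<And>z. f z - g z = poly p z"
    using is_poly_fun_diff[OF assms(1,2)] unfolding is_poly_fun_def by blast
  have "S \<subseteq> {z. poly p z = 0}" using assms(4) by (auto simp flip: p)
  then have "p = 0" using assms(3) poly_roots_finite[of p] finite_subset by blast
  then show ?thesis using p[of z] by simp
qed

lemma is_poly_fun_prim_poly:
  assumes "\<And>m. is_poly_fun (\<lambda>z. P z m)"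
  shows "is_poly_fun (\<lambda>z. prim_poly (P z) i m)"
proof (induction i arbitrary: m rule: less_induct)
  case (less i)
  show ?case by (subst prim_poly.simps) (intro is_poly_fun_intros assms less.IH, auto)
qed

lemma is_poly_fun_hom_sym:
  assumes "\<And>m. is_poly_fun (\<lambda>z. p z m)"
  shows "is_poly_fun (\<lambda>z. hom_sym (p z) m)"
proof (induction m rule: less_induct)
  case (less m)
  show ?case
  proof (cases m)
    case (Suc k)
    show ?thesis unfolding Suc hom_sym.simps by (intro is_poly_fun_intros assms less.IH) (simp add: Suc)
  qed (simp add: is_poly_fun_const)
qed

lemma is_poly_fun_cycle_poly: "is_poly_fun (\<lambda>z. cycle_poly (geo_sum z q) i m)"
  unfolding cycle_poly_def geo_sum_def
  by (intro is_poly_fun_hom_sym is_poly_fun_divide is_poly_fun_prim_poly is_poly_fun_intros)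

lemma is_poly_fun_des_maj_sum: "is_poly_fun (\<lambda>z. des_maj_sum n lam z q)"
  unfolding des_maj_sum_def by (intro is_poly_fun_intros)

text \<open>Off the unit circle the powers \<open>q ^ a\<close> are infinitely many distinct points
  at which the identity is known, and both sides are polynomials in \<open>z\<close>. On the circle
  \<open>q\<close> could be a root of unity, with only finitely many powers.\<close>

lemma des_maj_sum_norm_ne_1:
  fixes q z :: complex
  assumes lam: "partition_of lam n" and q: "q \<noteq> 0" "norm q \<noteq> 1"
  shows "des_maj_sum n lam z q = (\<Prod>i=1..n. cycle_poly (geo_sum z q) i (lam i))"
proof (rule is_poly_fun_eqI[where S = "range (\<lambda>a. q ^ a)" and f = "\<lambda>z. des_maj_sum n lam z q"
      and g = "\<lambda>z. \<Prod>i=1..n. cycle_poly (geo_sum z q) i (lam i)"])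
  have inj: "inj (\<lambda>a. q ^ a)"
  proof (rule injI)
    fix a b assume "q ^ a = q ^ b"
    then have "norm q ^ a = norm q ^ b" by (metis norm_power)
    then show "a = b" using q by (simp add: power_inject_exp')
  qed
  then show "infinite (range (\<lambda>a. q ^ a))" using finite_imageD by blast
  have "\<forall>j\<in>{1..n}. q ^ j \<noteq> 1" using injD[OF inj, of _ 0] by fastforce
  then show "des_maj_sum n lam z q = (\<Prod>i=1..n. cycle_poly (geo_sum z q) i (lam i))"
    if "z \<in> range (\<lambda>a. q ^ a)" for z
    using that des_maj_sum_power[OF lam q(1)] by auto
qed (intro is_poly_fun_des_maj_sum is_poly_fun_prod is_poly_fun_cycle_poly)+

section \<open>Passage to the unit circle by continuity in q\<close>

lemma tendsto_prim_poly:
  fixes P :: "'b \<Rightarrow> nat \<Rightarrow> 'a::{real_normed_field}"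
  assumes "\<And>m. m \<in> {1..n} \<Longrightarrow> ((\<lambda>t. P t m) \<longlongrightarrow> Q m) F" "0 < i" "0 < m" "i * m \<le> n"
  shows "((\<lambda>t. prim_poly (P t) i m) \<longlongrightarrow> prim_poly Q i m) F"
  using assms(2-)
proof (induction i arbitrary: m rule: less_induct)
  case (less i)
  have "m \<in> {1..n}" using less.prems by (cases i) auto
  moreover have "((\<lambda>t. prim_poly (P t) j (m * (i div j))) \<longlongrightarrow> prim_poly Q j (m * (i div j))) F"
    if "j \<in> {j \<in> {1..<i}. j dvd i}" for j
  proof -
    have "j * (i div j) * m \<le> n" "0 < i div j" using that less.prems(3) by (auto simp: dvd_def)
    then have "j * (m * (i div j)) \<le> n" "0 < i div j" by (simp_all only: mult_ac)
    then show ?thesis using less that by (intro less.IH) auto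
  qed
  ultimately show ?case
    unfolding prim_poly.simps[of _ i m] by (intro tendsto_intros assms(1))
qed

lemma tendsto_hom_sym:
  fixes p :: "'b \<Rightarrow> nat \<Rightarrow> 'a::{real_normed_field}"
  assumes "\<And>k. k \<in> {1..m} \<Longrightarrow> ((\<lambda>t. p t k) \<longlongrightarrow> r k) F"
  shows "((\<lambda>t. hom_sym (p t) m) \<longlongrightarrow> hom_sym r m) F"
  using assms
proof (induction m rule: less_induct)
  case (less m)
  show ?case
  proof (cases m)
    case (Suc k)
    show ?thesis unfolding Suc hom_sym.simps
      using less by (intro tendsto_intros) (auto simp: Suc simp del: of_nat_Suc)
  qed simp
qed

lemma tendsto_cycle_poly:
  fixes P :: "'b \<Rightarrow> nat \<Rightarrow> 'a::{real_normed_field}"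
  assumes "\<And>m. m \<in> {1..n} \<Longrightarrow> ((\<lambda>t. P t m) \<longlongrightarrow> Q m) F" "0 < i" "i * m \<le> n"
  shows "((\<lambda>t. cycle_poly (P t) i m) \<longlongrightarrow> cycle_poly Q i m) F"
  unfolding cycle_poly_def
proof (intro tendsto_hom_sym tendsto_divide tendsto_const)
  fix k assume k: "k \<in> {1..m}"
  then have "i * k \<le> n" using assms(3) by (meson atLeastAtMost_iff le_trans mult_le_mono2)
  then show "((\<lambda>t. prim_poly (P t) i k) \<longlongrightarrow> prim_poly Q i k) F"
    using k assms by (intro tendsto_prim_poly[where n = n]) auto
qed (use assms in auto)

theorem des_maj_sum_eq_prod:
  fixes q z :: complex
  assumes lam: "partition_of lam n" and q: "q \<noteq> 0" "\<forall>j\<in>{1..n}. q ^ j \<noteq> 1"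
  shows "des_maj_sum n lam z q = (\<Prod>i=1..n. cycle_poly (geo_sum z q) i (lam i))"
proof (cases "norm q = 1")
  case False
  then show ?thesis using des_maj_sum_norm_ne_1[OF lam q(1)] by blast
next
  case True
  \<comment> \<open>Radial approach from outside the circle, where the identity is
    available.\<close>
  define r where "r k = q * of_real (1 + inverse (real (Suc k)))" for k
  have r: "r \<longlonglongrightarrow> q"
  proof -
    have "r \<longlonglongrightarrow> q * of_real (1 + 0)"
      unfolding r_def by (intro tendsto_intros LIMSEQ_inverse_real_of_nat)
    then show ?thesis by simp
  qed
  have norm_r: "norm (r k) = 1 + inverse (real (Suc k))" for k
  proof -
    have "norm (r k) = \<bar>1 + inverse (real (Suc k))\<bar>" unfolding r_def norm_mult True norm_of_real by simp
    then show ?thesis by simp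
  qed
  then have r1: "norm (r k) \<noteq> 1" "r k \<noteq> 0" for k
  proof -
    have "norm (r k) > 1" unfolding norm_r by simp
    then show "norm (r k) \<noteq> 1" "r k \<noteq> 0" by auto
  qed
  have geo: "(\<lambda>k. geo_sum z (r k) m) \<longlonglongrightarrow> geo_sum z q m" if "m \<in> {1..n}" for m
    unfolding geo_sum_def using q that by (intro tendsto_intros r) auto
  have "(\<lambda>k. des_maj_sum n lam z (r k)) \<longlonglongrightarrow> des_maj_sum n lam z q"
    unfolding des_maj_sum_def using q by (intro tendsto_intros r) auto
  moreover have "(\<lambda>k. des_maj_sum n lam z (r k)) \<longlonglongrightarrow> (\<Prod>i=1..n. cycle_poly (geo_sum z q) i (lam i))"
    unfolding des_maj_sum_norm_ne_1[OF lam r1(2,1)]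
    by (intro tendsto_prod tendsto_cycle_poly[where n = n] geo partition_of_le[OF lam]) auto
  ultimately show ?thesis by (rule LIMSEQ_unique)
qed

section \<open>Estimates for the long cycles\<close>


text \<open>A geometric sum bounded by \<open>\<eta> / (1 - \<eta>)\<close>; the constant 3/2 is the
  value of \<open>1 / (1 - \<eta>)\<close> at 1/3.\<close>

lemma sum_power_diff_le:
  fixes \<eta> :: real
  assumes "0 \<le> \<eta>" "\<eta> \<le> 1/3"
  shows "(\<Sum>j\<in>{1..<i}. \<eta> ^ (i - j)) \<le> 3/2 * \<eta>"
proof (induction i)
  case (Suc i)
  show ?case
  proof (cases "i = 0")
    case False
    have "(\<Sum>j\<in>{1..<Suc i}. \<eta> ^ (Suc i - j)) = (\<Sum>j\<in>{1..<i}. \<eta> * \<eta> ^ (i - j)) + \<eta>"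
      using False by (simp add: Suc_diff_le)
    also have "\<dots> = \<eta> * (\<Sum>j\<in>{1..<i}. \<eta> ^ (i - j)) + \<eta>" by (simp add: sum_distrib_left)
    also have "\<dots> \<le> \<eta> * (3/2 * (1/3)) + \<eta>"
      using Suc assms by (intro add_mono mult_left_mono) auto
    finally show ?thesis by simp
  qed (use assms in simp)
qed (use assms in simp)

lemma sum_divisors_power_le:
  fixes \<eta> :: real
  assumes "0 \<le> \<eta>" "\<eta> \<le> 1/3"
  shows "(\<Sum>j\<in>{j \<in> {1..<i}. j dvd i}. \<eta> ^ (i - j)) \<le> 3/2 * \<eta>"
proof -
  have "(\<Sum>j\<in>{j \<in> {1..<i}. j dvd i}. \<eta> ^ (i - j)) \<le> (\<Sum>j\<in>{1..<i}. \<eta> ^ (i - j))"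
    using assms by (intro sum_mono2) auto
  then show ?thesis using sum_power_diff_le[OF assms, of i] by linarith
qed

text \<open>Normalised by the leading term \<open>p_1^m / m!\<close> of \<open>h_m\<close> with
  \<open>p_1 = 1 / i\<close>: the value is 1 when the first power sum over primitive words is 1 and
  all higher ones vanish.\<close>

definition cycle_ratio :: "(nat \<Rightarrow> complex) \<Rightarrow> nat \<Rightarrow> nat \<Rightarrow> complex" where
  "cycle_ratio P i m = of_nat (i ^ m) * fact m * cycle_poly P i m"

context
  fixes P :: "nat \<Rightarrow> complex" and \<eta> :: real and n :: nat
  assumes \<eta>: "0 \<le> \<eta>" "\<eta> \<le> 1/3" and P1: "P 1 = 1"
    and P: "\<And>m. m \<in> {1..n} \<Longrightarrow> norm (P m) \<le> \<eta> ^ (m - 1)"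
begin

text \<open>The term \<open>P m ^ i\<close> has the claimed order. The contribution of a proper
  divisor \<open>j\<close> is smaller by \<open>\<eta> ^ (i - j)\<close>, and these factors sum to
  at most 1/2, so the induction closes with the constant 2.\<close>

lemma norm_prim_poly_le:
  assumes "0 < i" "0 < m" "i * m \<le> n"
  shows "norm (prim_poly P i m) \<le> 2 * \<eta> ^ ((m - 1) * i)"
  using assms
proof (induction i arbitrary: m rule: less_induct)
  case (less i)
  let ?D = "{j \<in> {1..<i}. j dvd i}"
  have m: "m \<in> {1..n}" using less.prems by (cases i) auto
  have bound: "norm (prim_poly P j (m * (i div j))) \<le> 2 * \<eta> ^ ((m - 1) * i) * \<eta> ^ (i - j)" if j: "j \<in> ?D" for j
  proof -
    have jd: "j * (i div j) = i" using j by auto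
    have "0 < i div j" using j by (auto simp: dvd_def)
    moreover have "j * (m * (i div j)) \<le> n" using less.prems(3) jd by (metis mult.left_commute mult.commute)
    ultimately have "norm (prim_poly P j (m * (i div j))) \<le> 2 * \<eta> ^ ((m * (i div j) - 1) * j)"
      using less.prems j by (intro less.IH) auto
    also have "(m * (i div j) - 1) * j = (m - 1) * i + (i - j)"
    proof -
      have "(m * (i div j) - 1) * j = m * (j * (i div j)) - j" by (simp add: diff_mult_distrib2 mult_ac)
      also have "\<dots> = m * i - j" by (simp only: jd)
      also have "\<dots> = (m - 1) * i + (i - j)" using less.prems(2) j by (cases m) auto
      finally show ?thesis .
    qed
    finally show ?thesis by (simp add: power_add)
  qed
  have "norm (prim_poly P i m) \<le> norm (P m ^ i) + norm (\<Sum>j\<in>?D. prim_poly P j (m * (i div j)))"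
    by (subst prim_poly.simps) (rule norm_triangle_ineq4)
  also have "norm (P m ^ i) \<le> (\<eta> ^ (m - 1)) ^ i"
    using P[OF m] by (simp add: norm_power power_mono)
  also have "(\<eta> ^ (m - 1)) ^ i = \<eta> ^ ((m - 1) * i)" by (simp add: power_mult)
  also have "norm (\<Sum>j\<in>?D. prim_poly P j (m * (i div j))) \<le> (\<Sum>j\<in>?D. 2 * \<eta> ^ ((m - 1) * i) * \<eta> ^ (i - j))"
    using bound by (rule sum_norm_le)
  also have "\<dots> = 2 * \<eta> ^ ((m - 1) * i) * (\<Sum>j\<in>?D. \<eta> ^ (i - j))" by (simp add: sum_distrib_left)
  also have "\<dots> \<le> 2 * \<eta> ^ ((m - 1) * i) * (1/2)"
    using sum_divisors_power_le[OF \<eta>, of i] \<eta> by (intro mult_left_mono) auto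
  finally show ?case by simp
qed

lemma norm_prim_poly_1_le:
  assumes "0 < i" "i \<le> n"
  shows "norm (prim_poly P i 1 - 1) \<le> 3 * \<eta>"
proof -
  let ?D = "{j \<in> {1..<i}. j dvd i}"
  have "prim_poly P i 1 - 1 = - (\<Sum>j\<in>?D. prim_poly P j (i div j))"
    by (subst prim_poly.simps) (simp add: P1[unfolded One_nat_def])
  then have "norm (prim_poly P i 1 - 1) = norm (\<Sum>j\<in>?D. prim_poly P j (i div j))" by simp
  also have "\<dots> \<le> (\<Sum>j\<in>?D. 2 * \<eta> ^ (i - j))"
  proof (rule sum_norm_le)
    fix j assume j: "j \<in> ?D"
    then have jd: "j * (i div j) = i" by auto
    have "0 < i div j" using j by (auto simp: dvd_def)
    then have "norm (prim_poly P j (i div j)) \<le> 2 * \<eta> ^ ((i div j - 1) * j)"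
      using j jd assms by (intro norm_prim_poly_le) auto
    also have "(i div j - 1) * j = i - j" using jd by (simp add: diff_mult_distrib2 mult.commute[of _ j])
    finally show "norm (prim_poly P j (i div j)) \<le> 2 * \<eta> ^ (i - j)" .
  qed
  also have "\<dots> = 2 * (\<Sum>j\<in>?D. \<eta> ^ (i - j))" by (simp add: sum_distrib_left)
  also have "\<dots> \<le> 2 * (3/2 * \<eta>)" using sum_divisors_power_le[OF \<eta>, of i] by (intro mult_left_mono) auto
  finally show ?thesis by simp
qed

lemma cycle_ratio_Suc:
  assumes "0 < i"
  shows "cycle_ratio P i (Suc m) = (\<Sum>k\<le>m. prim_poly P i (Suc k) * of_nat (i ^ k) * (fact m / fact (m - k)) * cycle_ratio P i (m - k))"
proof -
  have "cycle_ratio P i (Suc m) = of_nat (i ^ Suc m) * fact m * (\<Sum>k\<le>m. prim_poly P i (Suc k) / of_nat i * cycle_poly P i (m - k))"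
    by (simp add: cycle_ratio_def cycle_poly_def field_simps del: of_nat_Suc)
  also have "\<dots> = (\<Sum>k\<le>m. prim_poly P i (Suc k) * of_nat (i ^ k) * (fact m / fact (m - k)) * cycle_ratio P i (m - k))"
    unfolding sum_distrib_left
  proof (intro sum.cong refl)
    fix k assume "k \<in> {..m}"
    then have "(of_nat i :: complex) ^ m = of_nat i ^ k * of_nat i ^ (m - k)" by (simp flip: power_add)
    then show "of_nat (i ^ Suc m) * fact m * (prim_poly P i (Suc k) / of_nat i * cycle_poly P i (m - k))
      = prim_poly P i (Suc k) * of_nat (i ^ k) * (fact m / fact (m - k)) * cycle_ratio P i (m - k)"
      using assms by (simp add: cycle_ratio_def)
  qed
  finally show ?thesis .
qed

context
  assumes small: "\<eta>\<^sup>2 * real n \<le> 1/2"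
begin

text \<open>The term \<open>k = 0\<close> of the recursion nearly reproduces the previous ratio. A
  term with \<open>k \<ge> 1\<close> has \<open>\<eta> ^ (k * i)\<close> against at most
  \<open>(i * m) ^ k\<close>, hence is bounded by a power of \<open>\<eta>\<^sup>2 * n\<close>, and
  these powers form a convergent geometric series.\<close>

lemma cycle_ratio_step:
  assumes i: "2 \<le> i" and im: "i * Suc m \<le> n" and M: "\<And>l. l \<le> m \<Longrightarrow> norm (cycle_ratio P i l) \<le> M"
  shows "norm (cycle_ratio P i (Suc m) - cycle_ratio P i m) \<le> (3 * \<eta> + 4 * (\<eta>\<^sup>2 * real n)) * M"
proof -
  define x where "x = \<eta>\<^sup>2 * real n"
  have x: "0 \<le> x" "x \<le> 1/2" using small by (simp_all add: x_def)
  have M0: "0 \<le> M" using M[of 0] norm_ge_zero order.trans by blast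
  let ?t = "\<lambda>k. prim_poly P i (Suc k) * of_nat (i ^ k) * (fact m / fact (m - k)) * cycle_ratio P i (m - k)"
  have t: "norm (?t k) \<le> 2 * x ^ k * M" if k: "k \<in> {1..m}" for k
  proof -
    have "i * Suc k \<le> i * Suc m" using k by (intro mult_le_mono) auto
    then have "i * Suc k \<le> n" using im by (rule order.trans)
    then have "norm (prim_poly P i (Suc k)) \<le> 2 * \<eta> ^ (k * i)"
      using norm_prim_poly_le[of i "Suc k"] i by simp
    \<comment> \<open>Here fixed points are excluded: cycles of length 1 would give only
      \<open>\<eta> ^ k\<close>.\<close>
    also have "\<dots> \<le> 2 * \<eta> ^ (k * 2)"
      using \<eta> i by (intro mult_left_mono power_decreasing) auto
    finally have 1: "norm (prim_poly P i (Suc k)) \<le> 2 * (\<eta>\<^sup>2) ^ k" by (simp add: power_mult mult.commute[of k])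
    have f: "norm (fact m / fact (m - k) :: complex) \<le> real m ^ k"
    proof -
      have "norm (fact m / fact (m - k) :: complex) = fact m / fact (m - k)" by (simp add: norm_divide)
      also have "\<dots> = real (fact m div fact (m - k))"
        by (simp add: real_of_nat_div[OF fact_dvd] of_nat_fact)
      also have "\<dots> \<le> real (m ^ k)" using k by (intro of_nat_mono fact_div_fact_le_pow) auto
      finally show ?thesis by simp
    qed
    have "norm (?t k) \<le> 2 * (\<eta>\<^sup>2) ^ k * real i ^ k * real m ^ k * M"
      unfolding norm_mult using 1 f M[of "m - k"] \<eta> M0
      by (intro mult_mono) (auto simp: norm_power)
    also have "\<dots> = 2 * (\<eta>\<^sup>2 * real (i * m)) ^ k * M" by (simp add: power_mult_distrib)
    also have "\<dots> \<le> 2 * x ^ k * M"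
      unfolding x_def using im M0 by (intro mult_right_mono mult_left_mono power_mono) (auto intro!: mult_left_mono simp flip: of_nat_mult)
    finally show ?thesis .
  qed
  have "i * 1 \<le> i * Suc m" by (intro mult_le_mono) auto
  then have 0: "norm (prim_poly P i 1 - 1) \<le> 3 * \<eta>" using i im by (intro norm_prim_poly_1_le) auto
  have sum_x: "(\<Sum>k\<in>{1..m}. x ^ k) \<le> 2 * x"
  proof -
    have "(\<Sum>k\<in>{1..m}. x ^ k) = x * (\<Sum>k<m. x ^ k)"
      by (simp add: sum.atLeast1_atMost_eq sum_distrib_left)
    also have "\<dots> \<le> x * 2"
    proof (rule mult_left_mono[OF _ x(1)])
      have "(\<Sum>k<m. x ^ k) = (1 - x ^ m) / (1 - x)" using x by (subst sum_gp_strict) auto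
    also have "\<dots> \<le> 2" using x zero_le_power[OF x(1), of m] by (simp add: divide_le_eq del: zero_le_power)
      finally show "(\<Sum>k<m. x ^ k) \<le> 2" .
    qed
    finally show ?thesis by simp
  qed
  have "cycle_ratio P i (Suc m) = ?t 0 + (\<Sum>k\<in>{1..m}. ?t k)"
    using cycle_ratio_Suc[of i m] i by (simp add: atMost_atLeast0 sum.atLeast_Suc_atMost)
  then have "cycle_ratio P i (Suc m) - cycle_ratio P i m = (prim_poly P i 1 - 1) * cycle_ratio P i m + (\<Sum>k\<in>{1..m}. ?t k)"
    by (simp add: algebra_simps)
  then have "norm (cycle_ratio P i (Suc m) - cycle_ratio P i m)
      \<le> norm ((prim_poly P i 1 - 1) * cycle_ratio P i m) + norm (\<Sum>k\<in>{1..m}. ?t k)"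
    by (simp only: norm_triangle_ineq)
  also have "norm ((prim_poly P i 1 - 1) * cycle_ratio P i m) \<le> 3 * \<eta> * M"
    unfolding norm_mult using 0 M[of m] \<eta> by (intro mult_mono) auto
  also have "norm (\<Sum>k\<in>{1..m}. ?t k) \<le> (\<Sum>k\<in>{1..m}. 2 * x ^ k * M)"
    using t by (rule sum_norm_le)
  also have "\<dots> = 2 * M * (\<Sum>k\<in>{1..m}. x ^ k)" by (simp add: sum_distrib_left mult_ac)
  also have "\<dots> \<le> 2 * M * (2 * x)" using sum_x M0 by (intro mult_left_mono) auto
  finally show ?thesis by (simp add: x_def algebra_simps)
qed

abbreviation "err \<equiv> 3 * \<eta> + 4 * (\<eta>\<^sup>2 * real n)"

text \<open>The size bound and the distance to 1 are proved together, because
  \<open>cycle_ratio_step\<close> measures an increment against the size of all earlier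
  ratios.\<close>

lemma norm_cycle_ratio_le:
  assumes "2 \<le> i" "i * m \<le> n"
  shows "norm (cycle_ratio P i m) \<le> (1 + err) ^ m \<and> norm (cycle_ratio P i m - 1) \<le> (1 + err) ^ m - 1"
  using assms(2)
proof (induction m rule: less_induct)
  case (less m)
  have e: "0 \<le> err" using \<eta> by simp
  show ?case
  proof (cases m)
    case (Suc k)
    have k: "i * k \<le> n" using less.prems by (simp add: Suc)
    have "norm (cycle_ratio P i l) \<le> (1 + err) ^ k" if "l \<le> k" for l
    proof -
      have "i * l \<le> n" using k that by (meson le_trans mult_le_mono2)
      then have "norm (cycle_ratio P i l) \<le> (1 + err) ^ l" using less.IH[of l] that Suc by simp
      also have "\<dots> \<le> (1 + err) ^ k" using e that by (intro power_increasing) auto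
      finally show ?thesis .
    qed
    then have step: "norm (cycle_ratio P i (Suc k) - cycle_ratio P i k) \<le> err * (1 + err) ^ k"
      using less.prems assms(1) by (intro cycle_ratio_step) (auto simp: Suc)
    have IH: "norm (cycle_ratio P i k) \<le> (1 + err) ^ k" "norm (cycle_ratio P i k - 1) \<le> (1 + err) ^ k - 1"
      using less.IH[of k] k Suc by auto
    have "norm (cycle_ratio P i (Suc k)) \<le> norm (cycle_ratio P i (Suc k) - cycle_ratio P i k) + norm (cycle_ratio P i k)"
      using norm_triangle_ineq[of "cycle_ratio P i (Suc k) - cycle_ratio P i k" "cycle_ratio P i k"] by simp
    moreover have "norm (cycle_ratio P i (Suc k) - 1) \<le> norm (cycle_ratio P i (Suc k) - cycle_ratio P i k) + norm (cycle_ratio P i k - 1)"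
      using norm_triangle_ineq[of "cycle_ratio P i (Suc k) - cycle_ratio P i k" "cycle_ratio P i k - 1"] by simp
    moreover have "(1 + err) ^ Suc k = err * (1 + err) ^ k + (1 + err) ^ k" by (simp add: algebra_simps)
    ultimately show ?thesis using step IH unfolding Suc by linarith
  qed (simp add: cycle_ratio_def)
qed

text \<open>Each cycle costs one factor \<open>1 + err\<close>, and there are at most
  \<open>n\<close> cycles.\<close>

lemma norm_prod_cycle_ratio_le:
  assumes "partition_of lam n"
  shows "norm ((\<Prod>i=2..n. cycle_ratio P i (lam i)) - 1) \<le> (1 + err) ^ n - 1"
proof -
  have e: "0 \<le> err" using \<eta> by simp
  have "norm ((\<Prod>i=2..n. 1 + (cycle_ratio P i (lam i) - 1)) - 1) \<le> (\<Prod>i=2..n. 1 + norm (cycle_ratio P i (lam i) - 1)) - 1"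
    by (rule norm_prod_minus1_le_prod_minus1)
  also have "(\<Prod>i=2..n. 1 + norm (cycle_ratio P i (lam i) - 1)) \<le> (\<Prod>i=2..n. (1 + err) ^ lam i)"
  proof (intro prod_mono conjI)
    fix i assume "i \<in> {2..n}"
    then show "1 + norm (cycle_ratio P i (lam i) - 1) \<le> (1 + err) ^ lam i"
      using norm_cycle_ratio_le[of i "lam i"] partition_of_le[OF assms, of i] by simp
  qed simp
  also have "\<dots> = (1 + err) ^ (\<Sum>i=2..n. lam i)" by (simp add: power_sum)
  also have "\<dots> \<le> (1 + err) ^ n"
  proof (rule power_increasing)
    have "(\<Sum>i=2..n. lam i) \<le> (\<Sum>i=2..n. i * lam i)" by (intro sum_mono) auto
    also have "\<dots> \<le> (\<Sum>i=1..n. i * lam i)" by (intro sum_mono2) auto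
    finally show "(\<Sum>i=2..n. lam i) \<le> n" using assms by (simp add: partition_of_def)
  qed (use e in simp)
  finally show ?thesis by simp
qed

end

end

section \<open>The normalised identity\<close>


text \<open>Homogeneity: if the \<open>m\<close>-th power sum has degree \<open>m\<close>, then
  \<open>prim_poly P i m\<close> has degree \<open>i * m\<close>.\<close>

lemma prim_poly_scale: "0 < i \<Longrightarrow> prim_poly (\<lambda>m. P m * c ^ m) i m = prim_poly P i m * (c :: 'a::comm_ring_1) ^ (i * m)"
proof (induction i arbitrary: m rule: less_induct)
  case (less i)
  have "prim_poly (\<lambda>m. P m * c ^ m) j (m * (i div j)) = prim_poly P j (m * (i div j)) * c ^ (i * m)"
    if j: "j \<in> {j \<in> {1..<i}. j dvd i}" for j
  proof -
    have eq: "j * (m * (i div j)) = i * m" using j by (auto simp: dvd_def)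
    show ?thesis unfolding eq[symmetric] using j by (intro less.IH) auto
  qed
  then show ?case
    by (subst (1 2) prim_poly.simps)
       (simp add: power_mult_distrib power_mult[symmetric] mult.commute[of i] left_diff_distrib sum_distrib_right)
qed

lemma hom_sym_scale: "hom_sym (\<lambda>k. p k * d ^ k) m = hom_sym p m * d ^ m"
proof (induction m rule: less_induct)
  case (less m)
  show ?case
  proof (cases m)
    case (Suc k)
    have "(\<Sum>l\<le>k. p (Suc l) * d ^ Suc l * hom_sym (\<lambda>k. p k * d ^ k) (k - l))
        = (\<Sum>l\<le>k. p (Suc l) * hom_sym p (k - l)) * d ^ Suc k"
      unfolding sum_distrib_right
    proof (intro sum.cong refl)
      fix l assume l: "l \<in> {..k}"
      then have "d ^ k = d ^ l * d ^ (k - l)" by (simp flip: power_add)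
      then show "p (Suc l) * d ^ Suc l * hom_sym (\<lambda>k. p k * d ^ k) (k - l) = p (Suc l) * hom_sym p (k - l) * d ^ Suc k"
        using less.IH[of "k - l"] Suc by (simp add: mult_ac)
    qed
    then show ?thesis unfolding Suc hom_sym.simps by simp
  qed simp
qed

lemma cycle_poly_scale:
  assumes "0 < i"
  shows "cycle_poly (\<lambda>m. P m * c ^ m) i m = cycle_poly P i m * c ^ (i * m)"
proof -
  have "cycle_poly (\<lambda>m. P m * c ^ m) i m = hom_sym (\<lambda>k. prim_poly P i k / of_nat i * (c ^ i) ^ k) m"
    unfolding cycle_poly_def by (simp add: prim_poly_scale[OF assms] power_mult)
  also have "\<dots> = hom_sym (\<lambda>k. prim_poly P i k / of_nat i) m * (c ^ i) ^ m" by (rule hom_sym_scale)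
  finally show ?thesis by (simp add: cycle_poly_def power_mult)
qed

text \<open>Serves to evaluate the factor of the fixed points: for this class the sum over
  permutations has one term.\<close>

lemma conj_class_fixed_points:
  "conj_class n (\<lambda>i. if i = 1 then n else 0) = {id}" (is "conj_class n ?lam = _")
proof (intro equalityI subsetI)
  fix \<pi> assume \<pi>: "\<pi> \<in> conj_class n ?lam"
  then have perm: "\<pi> permutes {1..n}" by (simp add: conj_class_def)
  have "\<pi> x = x" for x
  proof (cases "x \<in> {1..n}")
    case True
    let ?C = "{C. (\<exists>x\<in>{1..n}. C = orbit \<pi> x) \<and> card C = 1}"
    let ?F = "{x \<in> {1..n}. \<pi> x = x}"
    have "1 \<in> {1..n}" using True by auto
    then have "num_cycles n \<pi> 1 = n" using \<pi> unfolding conj_class_def by auto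
    moreover have "?C \<subseteq> (\<lambda>x. {x}) ` ?F"
    proof
      fix C assume "C \<in> ?C"
      then obtain y where y: "y \<in> {1..n}" "C = orbit \<pi> y" "card C = 1" by auto
      have "(\<pi> ^^ 1) y = y" using funpow_orbit_card(1)[OF perm, of y] y by simp
      then have "\<pi> y = y" by simp
      then show "C \<in> (\<lambda>x. {x}) ` ?F" using y orbit_eq_singleton_iff[of \<pi> y] by auto
    qed
    moreover have "card ?C \<le> card ((\<lambda>x. {x}) ` ?F)"
      using calculation(2) by (intro card_mono) auto
    ultimately have "n \<le> card ((\<lambda>x. {x}) ` ?F)" by (simp add: num_cycles_def)
    also have "\<dots> \<le> card ?F" by (rule card_image_le) simp
    finally have "?F = {1..n}" by (intro card_seteq) auto
    then show ?thesis using True by blast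
  qed (use perm in \<open>simp add: permutes_not_in\<close>)
  then show "\<pi> \<in> {id}" by auto
next
  fix \<pi> :: "nat \<Rightarrow> nat" assume "\<pi> \<in> {id}"
  then have \<pi>: "\<pi> = id" by simp
  have orb: "orbit \<pi> x = {x}" for x using orbit_eq_singleton_iff[of \<pi> x] by (simp add: \<pi>)
  have "num_cycles n \<pi> k = ?lam k" if "k \<in> {1..n}" for k
  proof -
    have "{C. (\<exists>x\<in>{1..n}. C = orbit \<pi> x) \<and> card C = k} = (if k = 1 then (\<lambda>x. {x}) ` {1..n} else {})"
      using that by (auto simp: orb)
    then show ?thesis by (simp add: num_cycles_def card_image)
  qed
  then show "\<pi> \<in> conj_class n ?lam" by (simp add: conj_class_def \<pi> permutes_id)
qed

text \<open>The general identity is applied to the cycle type with \<open>m\<close> fixed points.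
  The identity permutation has \<open>maj = 0\<close> and \<open>d = 1\<close>, so its single term
  is the closed form, an instance of the q-binomial theorem.\<close>

lemma cycle_poly_1:
  fixes q z :: complex
  assumes q: "q \<noteq> 0" "\<forall>j\<in>{1..m}. q ^ j \<noteq> 1"
  shows "cycle_poly (geo_sum z q) 1 m = (\<Prod>j=1..m. (1 - z * q ^ j / q) / (1 - q ^ j))"
proof (cases "m = 0")
  case False
  define lam where "lam = (\<lambda>i::nat. if i = 1 then m else 0)"
  have "partition_of lam m"
    using False by (auto simp: partition_of_def lam_def if_distrib[where f = "\<lambda>x. _ * x"] cong: if_cong)
  then have "des_maj_sum m lam z q = (\<Prod>i=1..m. cycle_poly (geo_sum z q) i (lam i))"
    using q by (rule des_maj_sum_eq_prod)
  also have "\<dots> = (\<Prod>i\<in>{1}. cycle_poly (geo_sum z q) i (lam i))"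
    using False by (intro prod.mono_neutral_right) (auto simp: lam_def)
  also have "\<dots> = cycle_poly (geo_sum z q) 1 m" by (simp add: lam_def)
  finally show ?thesis
    by (simp add: des_maj_sum_def lam_def conj_class_fixed_points maj_def des1_def descents_def del: One_nat_def)
qed simp

text \<open>Power sums rescaled so that the first one is 1, as the estimates for the long cycles
  require.\<close>

definition geo_ratio :: "complex \<Rightarrow> complex \<Rightarrow> nat \<Rightarrow> complex" where
  "geo_ratio z q m = geo_sum z q m / geo_sum z q 1 ^ m"

definition long_cycles :: "nat \<Rightarrow> (nat \<Rightarrow> nat) \<Rightarrow> complex \<Rightarrow> complex \<Rightarrow> complex" where
  "long_cycles n lam z q = (\<Prod>i=2..n. cycle_ratio (geo_ratio z q) i (lam i))"

definition centralizer_size :: "nat \<Rightarrow> (nat \<Rightarrow> nat) \<Rightarrow> nat" where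
  "centralizer_size n lam = (\<Prod>i=1..n. i ^ lam i * fact (lam i))"

lemma prod_from_2: "1 \<le> n \<Longrightarrow> (\<Prod>i=1..n. f i) = f 1 * (\<Prod>i=2..n::nat. f i :: 'a::comm_monoid_mult)"
  by (simp add: prod.atLeast_Suc_atMost numeral_2_eq_2)

lemma sum_from_2: "1 \<le> n \<Longrightarrow> (\<Sum>i=1..n. f i) = f 1 + (\<Sum>i=2..n::nat. f i :: 'a::comm_monoid_add)"
  by (simp add: sum.atLeast_Suc_atMost numeral_2_eq_2)

text \<open>By homogeneity the rescaling pulls the first power sum out to the total degree
  \<open>n - lam 1\<close> of the long cycles. The centralizer order supplies precisely the factors
  \<open>i ^ m * m!\<close> of the ratios.\<close>

lemma des_maj_sum_centralizer:
  fixes q z :: complex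
  assumes n: "1 \<le> n" and lam: "partition_of lam n" and q: "q \<noteq> 0" "\<forall>j\<in>{1..n}. q ^ j \<noteq> 1" and z: "z \<noteq> 1"
  shows "of_nat (centralizer_size n lam) * des_maj_sum n lam z q
    = (\<Prod>j=1..lam 1. of_nat j * (1 - z * q ^ j / q) / (1 - q ^ j)) *
      ((1 - z) / (1 - q)) ^ (n - lam 1) * long_cycles n lam z q"
proof -
  define c where "c = (1 - z) / (1 - q)"
  have "q ^ 1 \<noteq> 1" using n q(2) by (metis atLeastAtMost_iff le_refl)
  then have c0: "c \<noteq> 0" using z by (simp add: c_def)
  have geo: "geo_sum z q = (\<lambda>m. geo_ratio z q m * c ^ m)"
    using c0 by (simp add: geo_ratio_def geo_sum_def c_def fun_eq_iff)
  have l1: "lam 1 \<le> n" using partition_of_le[OF lam, of 1] n by simp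
  have sum2: "(\<Sum>i=2..n. i * lam i) = n - lam 1"
    using lam n sum_from_2[OF n, of "\<lambda>i. i * lam i"] by (simp add: partition_of_def)
  have "des_maj_sum n lam z q = cycle_poly (geo_sum z q) 1 (lam 1) * (\<Prod>i=2..n. cycle_poly (geo_sum z q) i (lam i))"
    unfolding des_maj_sum_eq_prod[OF lam q] by (rule prod_from_2[OF n])
  also have "cycle_poly (geo_sum z q) 1 (lam 1) = (\<Prod>j=1..lam 1. (1 - z * q ^ j / q) / (1 - q ^ j))"
    using q l1 by (intro cycle_poly_1) auto
  also have "(\<Prod>i=2..n. cycle_poly (geo_sum z q) i (lam i)) = (\<Prod>i=2..n. cycle_poly (geo_ratio z q) i (lam i)) * c ^ (n - lam 1)"
    unfolding sum2[symmetric] power_sum prod.distrib[symmetric]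
    by (intro prod.cong refl, subst geo, rule cycle_poly_scale) simp
  finally have D: "des_maj_sum n lam z q = (\<Prod>j=1..lam 1. (1 - z * q ^ j / q) / (1 - q ^ j)) *
      ((\<Prod>i=2..n. cycle_poly (geo_ratio z q) i (lam i)) * c ^ (n - lam 1))" .
  define A where "A = (\<Prod>j=1..lam 1. (1 - z * q ^ j / q) / (1 - q ^ j))"
  define B where "B = (\<Prod>i=2..n. cycle_poly (geo_ratio z q) i (lam i))"
  define C where "C = (\<Prod>i=2..n. complex_of_nat (i ^ lam i) * fact (lam i))"
  have C: "of_nat (centralizer_size n lam) = fact (lam 1) * C"
    unfolding centralizer_size_def prod_from_2[OF n] C_def by simp
  have L: "C * B = long_cycles n lam z q"
    unfolding B_def C_def long_cycles_def cycle_ratio_def by (simp only: prod.distrib)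
  have A: "(\<Prod>j=1..lam 1. of_nat j * (1 - z * q ^ j / q) / (1 - q ^ j)) = fact (lam 1) * A"
    unfolding A_def fact_prod of_nat_prod prod.distrib[symmetric] by (intro prod.cong) auto
  show ?thesis
    unfolding D C A A_def[symmetric] B_def[symmetric] L[symmetric] c_def[symmetric] by (simp only: mult_ac)
qed

section \<open>Bounds for q near 1\<close>

context
  fixes n :: nat and q :: complex
  assumes q1: "q \<noteq> 1" and qn: "norm q \<le> 1" and small: "real n * norm (q - 1) \<le> 1/2"
begin

text \<open>The quotient is a sum of \<open>m\<close> powers of \<open>q\<close>, each within 1/2 of
  1, so its modulus is at least \<open>m / 2\<close>.\<close>

lemma one_minus_power_lower:
  assumes "m \<in> {1..n}"
  shows "norm ((1 - q ^ m) / (1 - q)) \<ge> 1/2"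
proof -
  have "norm ((1 - q ^ m) / (1 - q) - of_nat m) \<le> real m * (1/2)"
  proof -
    have "(\<Sum>j<m. q ^ j) = (1 - q ^ m) / (1 - q)" using q1 by (simp add: sum_gp_strict)
    then have "(1 - q ^ m) / (1 - q) - of_nat m = (\<Sum>j<m. q ^ j - 1)" by (simp add: sum_subtractf)
    also have "norm \<dots> \<le> (\<Sum>j<m. 1/2)"
    proof (rule sum_norm_le)
      fix j assume "j \<in> {..<m}"
      have "norm (q ^ j - 1) \<le> real j * norm (q - 1)" using norm_power_diff[of q 1 j] qn by simp
      also have "\<dots> \<le> real n * norm (q - 1)" using assms \<open>j \<in> {..<m}\<close> by (intro mult_right_mono) auto
      finally show "norm (q ^ j - 1) \<le> 1/2" using small by linarith
    qed
    finally show ?thesis by simp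
  qed
  moreover have "real m \<le> norm ((1 - q ^ m) / (1 - q)) + norm ((1 - q ^ m) / (1 - q) - of_nat m)"
    using norm_triangle_ineq4[of "(1 - q ^ m) / (1 - q)" "(1 - q ^ m) / (1 - q) - of_nat m"] by simp
  ultimately show ?thesis using assms by auto
qed

lemma power_ne_1: "\<forall>m\<in>{1..n}. q ^ m \<noteq> 1"
  using one_minus_power_lower by fastforce

text \<open>The quotient in \<open>q\<close> supplies \<open>m - 1\<close> powers of
  \<open>|q - 1|\<close>. The constants, \<open>Z ^ m\<close> and 2, are absorbed into an
  \<open>(m - 1)\<close>-st power, which works for \<open>m \<ge> 2\<close> because then
  \<open>m \<le> 2 * (m - 1)\<close>; for \<open>m = 1\<close> the ratio is exactly 1.\<close>

lemma norm_geo_ratio_le: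
  fixes z :: complex
  assumes z: "z \<noteq> 1" and m: "m \<in> {1..n}"
  shows "norm (geo_ratio z q m) \<le> (2 * ((1 + norm z) / norm (1 - z))\<^sup>2 * norm (q - 1)) ^ (m - 1)"
proof -
  define Z where "Z = (1 + norm z) / norm (1 - z)"
  have z0: "norm (1 - z) > 0" using z by simp
  have Z1: "1 \<le> Z" unfolding Z_def using z0 norm_triangle_ineq4[of 1 z] by (simp add: le_divide_eq)
  have eq: "geo_ratio z q m = (1 - z ^ m) / (1 - z) ^ m * (1 - q) ^ m / (1 - q ^ m)"
    by (simp add: geo_ratio_def geo_sum_def power_divide)
  show ?thesis
  proof (cases "m = 1")
    case True
    then show ?thesis using z q1 by (simp add: geo_ratio_def geo_sum_def)
  next
    case False
    then have m2: "2 \<le> m" using m by auto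
    have zm: "norm ((1 - z ^ m) / (1 - z) ^ m) \<le> Z ^ m"
    proof -
      have "norm (1 - z ^ m) \<le> 1 + norm z ^ m" using norm_triangle_ineq4[of 1 "z ^ m"] by (simp add: norm_power)
      also have "\<dots> \<le> (1 + norm z) ^ m"
      proof -
        have "1 + norm z ^ m \<le> (1 + norm z) ^ m" if "1 \<le> m" for m
          using that
        proof (induction m rule: dec_induct)
          case (step k)
          have "1 + norm z ^ Suc k \<le> (1 + norm z ^ k) * (1 + norm z)" by (simp add: algebra_simps)
          also have "\<dots> \<le> (1 + norm z) ^ k * (1 + norm z)" using step by (intro mult_right_mono) auto
          finally show ?case by (simp add: mult.commute)
        qed simp
        then show ?thesis using m by simp
      qed
      finally show ?thesis using z0 by (simp add: Z_def norm_divide norm_power power_divide divide_right_mono)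
    qed
    have qm: "norm ((1 - q) ^ m / (1 - q ^ m)) \<le> norm (q - 1) ^ (m - 1) * 2"
    proof -
      have "(1 - q) ^ m / (1 - q ^ m) = (1 - q) ^ (m - 1) / ((1 - q ^ m) / (1 - q))"
        using m2 by (cases m) auto
      also have "norm \<dots> = norm (q - 1) ^ (m - 1) / norm ((1 - q ^ m) / (1 - q))"
        by (simp only: norm_divide norm_power norm_minus_commute[of 1 q])
      also have "\<dots> \<le> norm (q - 1) ^ (m - 1) / (1/2)"
        using one_minus_power_lower[OF m] by (intro divide_left_mono) auto
      finally show ?thesis by simp
    qed
    have "norm (geo_ratio z q m) = norm ((1 - z ^ m) / (1 - z) ^ m) * norm ((1 - q) ^ m / (1 - q ^ m))"
      unfolding eq norm_mult[symmetric] by simp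
    also have "\<dots> \<le> Z ^ m * (norm (q - 1) ^ (m - 1) * 2)"
      using zm qm Z1 by (intro mult_mono) auto
    also have "\<dots> \<le> Z ^ (2 * (m - 1)) * (norm (q - 1) ^ (m - 1) * 2 ^ (m - 1))"
    proof (rule mult_mono)
      have "(2::real) ^ 1 \<le> 2 ^ (m - 1)" using m2 by (intro power_increasing) auto
      then show "norm (q - 1) ^ (m - 1) * 2 \<le> norm (q - 1) ^ (m - 1) * 2 ^ (m - 1)"
        by (intro mult_left_mono) simp_all
      show "Z ^ m \<le> Z ^ (2 * (m - 1))" using Z1 m2 by (intro power_increasing) auto
    qed (use Z1 in auto)
    finally show ?thesis by (simp add: Z_def[symmetric] power_mult power_mult_distrib mult_ac)
  qed
qed

lemma norm_long_cycles_le: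
  fixes z :: complex
  defines "\<eta> \<equiv> 2 * ((1 + norm z) / norm (1 - z))\<^sup>2 * norm (q - 1)"
  assumes lam: "partition_of lam n" and z: "z \<noteq> 1" and \<eta>: "\<eta> \<le> 1/3" "\<eta>\<^sup>2 * real n \<le> 1/2"
  shows "norm (long_cycles n lam z q - 1) \<le> (1 + (3 * \<eta> + 4 * (\<eta>\<^sup>2 * real n))) ^ n - 1"
  unfolding long_cycles_def
proof (rule norm_prod_cycle_ratio_le[OF _ \<eta>(1) _ _ \<eta>(2) lam])
  show "0 \<le> \<eta>" by (simp add: \<eta>_def)
  show "geo_ratio z q 1 = 1" using z q1 by (simp add: geo_ratio_def geo_sum_def)
  show "norm (geo_ratio z q m) \<le> \<eta> ^ (m - 1)" if "m \<in> {1..n}" for m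
    unfolding \<eta>_def by (rule norm_geo_ratio_le[OF z that])
qed

end

lemma one_minus_power_tendsto:
  fixes r :: "nat \<Rightarrow> complex"
  assumes "r \<longlonglongrightarrow> 1" "\<And>k. r k \<noteq> 1"
  shows "(\<lambda>k. (1 - r k ^ j) / (1 - r k)) \<longlonglongrightarrow> of_nat j"
proof -
  have "(\<lambda>k. \<Sum>i<j. r k ^ i) \<longlonglongrightarrow> (\<Sum>i<j. 1 ^ i)"
    by (intro tendsto_intros assms)
  moreover have "(\<Sum>i<j. r k ^ i) = (1 - r k ^ j) / (1 - r k)" for k
    using assms(2) by (subst sum_gp_strict) auto
  ultimately show ?thesis by simp
qed

text \<open>The class size falls out of the same identity: at \<open>z = 0\<close> the numerators
  depending on descents disappear and the sum of \<open>q ^ maj\<close> remains, which tends to the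
  size of the class as \<open>q\<close> increases to 1, while the other side tends to
  \<open>n!\<close>.\<close>

theorem card_conj_class:
  assumes n: "1 \<le> n" and lam: "partition_of lam n"
  shows "centralizer_size n lam * card (conj_class n lam) = fact n"
proof -
  \<comment> \<open>The shift of the denominator makes \<open>r 0 = 1/2\<close> and keeps the
    sequence away from 0.\<close>
  define r where "r k = complex_of_real (1 - inverse (real (Suc k) + 1))" for k
  have r_norm: "norm (r k - 1) = inverse (real (Suc k) + 1)" for k
  proof -
    have "r k - 1 = - complex_of_real (inverse (real (Suc k) + 1))" by (simp add: r_def)
    then show ?thesis by (simp only: norm_minus_cancel norm_of_real) simp
  qed
  have r0: "r k \<noteq> 0" "r k \<noteq> 1" "norm (r k) \<le> 1" for k
  proof -
    have *: "0 < inverse (real (Suc k) + 1)" "inverse (real (Suc k) + 1) < 1" by (auto simp: field_simps)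
    then show "r k \<noteq> 0" "norm (r k) \<le> 1" unfolding r_def norm_of_real of_real_eq_0_iff by auto
    show "r k \<noteq> 1" using r_norm[of k] * by auto
  qed
  have diff: "(\<lambda>k. norm (r k - 1)) \<longlonglongrightarrow> 0"
    unfolding r_norm by real_asymp
  have r: "r \<longlonglongrightarrow> 1" by (rule LIM_zero_cancel[OF tendsto_norm_zero_cancel[OF diff]])
  define \<eta> where "\<eta> k = 2 * norm (r k - 1)" for k
  have \<eta>_lim: "\<eta> \<longlonglongrightarrow> 0" unfolding \<eta>_def using tendsto_mult_right_zero[OF diff] by simp
  have ev1: "\<forall>\<^sub>F k in sequentially. real n * norm (r k - 1) < 1/2"
    using tendsto_mult_right_zero[OF diff, of "real n"] by (rule order_tendstoD(2)) simp
  have ev2: "\<forall>\<^sub>F k in sequentially. \<eta> k < 1/3" using \<eta>_lim by (rule order_tendstoD(2)) simp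
  have "(\<lambda>k. (\<eta> k)\<^sup>2 * real n) \<longlonglongrightarrow> 0\<^sup>2 * real n" by (intro tendsto_intros \<eta>_lim)
  then have lim3: "(\<lambda>k. (\<eta> k)\<^sup>2 * real n) \<longlonglongrightarrow> 0" by simp
  have ev3: "\<forall>\<^sub>F k in sequentially. (\<eta> k)\<^sup>2 * real n < 1/2" using lim3 by (rule order_tendstoD(2)) simp
  have "(\<lambda>k. (1 + (3 * \<eta> k + 4 * ((\<eta> k)\<^sup>2 * real n))) ^ n - 1) \<longlonglongrightarrow> (1 + (3 * 0 + 4 * 0)) ^ n - 1"
    by (intro tendsto_intros \<eta>_lim lim3)
  then have bound: "(\<lambda>k. (1 + (3 * \<eta> k + 4 * ((\<eta> k)\<^sup>2 * real n))) ^ n - 1) \<longlonglongrightarrow> 0" by simp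
  have "(\<lambda>k. long_cycles n lam 0 (r k) - 1) \<longlonglongrightarrow> 0"
  proof (rule Lim_null_comparison[OF _ bound])
    show "\<forall>\<^sub>F k in sequentially. norm (long_cycles n lam 0 (r k) - 1) \<le> (1 + (3 * \<eta> k + 4 * ((\<eta> k)\<^sup>2 * real n))) ^ n - 1"
      using ev1 ev2 ev3
    proof eventually_elim
      case (elim k)
      then show ?case
        using norm_long_cycles_le[of "r k" n lam 0, OF r0(2) r0(3) _ lam] by (simp add: \<eta>_def)
    qed
  qed
  then have long: "(\<lambda>k. long_cycles n lam 0 (r k)) \<longlonglongrightarrow> 1" by (simp add: LIM_zero_iff)
  have "(\<lambda>k. of_nat (centralizer_size n lam) * (\<Sum>\<pi>\<in>conj_class n lam. r k ^ maj n \<pi>))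
      \<longlonglongrightarrow> of_nat (centralizer_size n lam) * (\<Sum>\<pi>\<in>conj_class n lam. 1 ^ maj n \<pi>)"
    by (intro tendsto_intros r)
  then have L1: "(\<lambda>k. of_nat (centralizer_size n lam) * (\<Sum>\<pi>\<in>conj_class n lam. r k ^ maj n \<pi>))
      \<longlonglongrightarrow> of_nat (centralizer_size n lam * card (conj_class n lam))" by simp
  have l1: "lam 1 \<le> n" using partition_of_le[OF lam, of 1] n by simp
  have "(\<lambda>k. (\<Prod>j=1..n. (1 - r k ^ j) / (1 - r k)) * (\<Prod>j=1..lam 1. of_nat j / ((1 - r k ^ j) / (1 - r k))) * long_cycles n lam 0 (r k))
      \<longlonglongrightarrow> (\<Prod>j=1..n. of_nat j) * (\<Prod>j=1..lam 1. of_nat j / of_nat j) * 1"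
    by (intro tendsto_intros one_minus_power_tendsto r r0 long) auto
  moreover have "(\<Prod>j=1..lam 1. of_nat j / of_nat j) = (1::complex)" by (intro prod.neutral) auto
  ultimately have L2: "(\<lambda>k. (\<Prod>j=1..n. (1 - r k ^ j) / (1 - r k)) * (\<Prod>j=1..lam 1. of_nat j / ((1 - r k ^ j) / (1 - r k))) * long_cycles n lam 0 (r k))
      \<longlonglongrightarrow> of_nat (fact n)" by (simp add: fact_prod)
  have "\<forall>\<^sub>F k in sequentially. of_nat (centralizer_size n lam) * (\<Sum>\<pi>\<in>conj_class n lam. r k ^ maj n \<pi>)
     = (\<Prod>j=1..n. (1 - r k ^ j) / (1 - r k)) * (\<Prod>j=1..lam 1. of_nat j / ((1 - r k ^ j) / (1 - r k))) * long_cycles n lam 0 (r k)"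
    using ev1
  proof eventually_elim
    case (elim k)
    have ne: "\<forall>j\<in>{1..n}. r k ^ j \<noteq> 1" using power_ne_1[of "r k" n] r0 elim by simp
    define A where "A = (\<Prod>j=1..n. 1 - r k ^ j)"
    have A0: "A \<noteq> 0" using ne by (auto simp: A_def)
    have r1: "1 - r k \<noteq> 0" using r0(2)[of k] by simp
    have "des_maj_sum n lam 0 (r k) = (\<Sum>\<pi>\<in>conj_class n lam. r k ^ maj n \<pi>) / A"
      by (simp add: des_maj_sum_def A_def prod_dividef sum_divide_distrib)
    then have "of_nat (centralizer_size n lam) * (\<Sum>\<pi>\<in>conj_class n lam. r k ^ maj n \<pi>)
        = A * (of_nat (centralizer_size n lam) * des_maj_sum n lam 0 (r k))" using A0 by simp
    also have "\<dots> = A * ((\<Prod>j=1..lam 1. of_nat j / (1 - r k ^ j)) * (1 / (1 - r k)) ^ (n - lam 1) * long_cycles n lam 0 (r k))"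
      by (subst des_maj_sum_centralizer[OF n lam r0(1) ne]) auto
    also have "\<dots> = (A / (1 - r k) ^ n) * ((\<Prod>j=1..lam 1. of_nat j / (1 - r k ^ j)) * (1 - r k) ^ lam 1) * long_cycles n lam 0 (r k)"
      using r1 l1 by (simp add: power_diff power_one_over field_simps)
    also have "A / (1 - r k) ^ n = (\<Prod>j=1..n. (1 - r k ^ j) / (1 - r k))"
      by (simp add: A_def prod_dividef)
    also have "(\<Prod>j=1..lam 1. of_nat j / (1 - r k ^ j)) * (1 - r k) ^ lam 1 = (\<Prod>j=1..lam 1. of_nat j / ((1 - r k ^ j) / (1 - r k)))"
      by (simp add: prod_dividef prod.distrib)
    finally show ?case .
  qed
  then have "(\<lambda>k. of_nat (centralizer_size n lam) * (\<Sum>\<pi>\<in>conj_class n lam. r k ^ maj n \<pi>)) \<longlonglongrightarrow> of_nat (fact n)"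
    using L2 by (simp only: tendsto_cong)
  then have "of_nat (centralizer_size n lam * card (conj_class n lam)) = (of_nat (fact n) :: complex)"
    using L1 LIMSEQ_unique by blast
  then show ?thesis using of_nat_eq_iff by blast
qed

text \<open>Every factor is normalised to be 1 at \<open>q = 1\<close>. The first and third products
  cancel for \<open>j \<le> lam 1\<close>, so only quotients with \<open>j > lam 1\<close> survive
  beside the factor of the fixed points.\<close>

theorem average_des_maj:
  fixes q z :: complex
  assumes n: "1 \<le> n" and lam: "partition_of lam n" and q: "q \<noteq> 0" "\<forall>j\<in>{1..n}. q ^ j \<noteq> 1" and z: "z \<noteq> 1"
  shows "(\<Sum>\<pi>\<in>conj_class n lam. q ^ maj n \<pi> * (\<Prod>j=1..n. (1 - z * q ^ j / q ^ des1 n \<pi>) / (1 - z))) / of_nat (card (conj_class n lam))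
    = (\<Prod>j=1..n. (1 - q ^ j) / (of_nat j * (1 - q))) * (\<Prod>j=1..lam 1. (1 - z * q ^ j / q) / (1 - z)) *
      (\<Prod>j=1..lam 1. of_nat j * (1 - q) / (1 - q ^ j)) * long_cycles n lam z q"
proof -
  define A where "A = (\<Prod>j=1..n. 1 - q ^ j)"
  define Z where "Z = (of_nat (centralizer_size n lam) :: complex)"
  have "q ^ 1 \<noteq> 1" using n q(2) by (metis atLeastAtMost_iff le_refl)
  then have q1: "1 - q \<noteq> 0" and z1: "1 - z \<noteq> 0" using z by auto
  have A0: "A \<noteq> 0" using q by (auto simp: A_def)
  have l1: "lam 1 \<le> n" using partition_of_le[OF lam, of 1] n by simp
  have Zc: "Z * of_nat (card (conj_class n lam)) = fact n"
    unfolding Z_def of_nat_mult[symmetric] card_conj_class[OF n lam] by simp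
  then have Z0: "Z \<noteq> 0" and c0: "of_nat (card (conj_class n lam)) \<noteq> (0::complex)" by (metis fact_nonzero mult_zero_left, metis fact_nonzero mult_zero_right)
  have "(\<Sum>\<pi>\<in>conj_class n lam. q ^ maj n \<pi> * (\<Prod>j=1..n. (1 - z * q ^ j / q ^ des1 n \<pi>) / (1 - z)))
      = des_maj_sum n lam z q * A / (1 - z) ^ n"
    using A0 by (simp add: des_maj_sum_def A_def prod_dividef sum_distrib_right sum_divide_distrib)
  also have "\<dots> / of_nat (card (conj_class n lam)) = Z * des_maj_sum n lam z q * A / (1 - z) ^ n / fact n"
    unfolding Zc[symmetric] using Z0 by simp
  also have "Z * des_maj_sum n lam z q = (\<Prod>j=1..lam 1. of_nat j * (1 - z * q ^ j / q) / (1 - q ^ j)) *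
      ((1 - z) / (1 - q)) ^ (n - lam 1) * long_cycles n lam z q"
    unfolding Z_def by (rule des_maj_sum_centralizer[OF n lam q z])
  also have "(\<Prod>j=1..lam 1. of_nat j * (1 - z * q ^ j / q) / (1 - q ^ j)) =
      (\<Prod>j=1..lam 1. (1 - z * q ^ j / q) / (1 - z)) * (\<Prod>j=1..lam 1. of_nat j * (1 - q) / (1 - q ^ j)) * ((1 - z) / (1 - q)) ^ lam 1"
    using q1 z1 by (simp add: prod.distrib prod_dividef power_divide)
  also have "(\<Prod>j=1..lam 1. (1 - z * q ^ j / q) / (1 - z)) * (\<Prod>j=1..lam 1. of_nat j * (1 - q) / (1 - q ^ j)) * ((1 - z) / (1 - q)) ^ lam 1 *
      ((1 - z) / (1 - q)) ^ (n - lam 1) * long_cycles n lam z q * A / (1 - z) ^ n / fact n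
     = (A / (fact n * (1 - q) ^ n)) * (\<Prod>j=1..lam 1. (1 - z * q ^ j / q) / (1 - z)) *
      (\<Prod>j=1..lam 1. of_nat j * (1 - q) / (1 - q ^ j)) * long_cycles n lam z q" (is "?x * ?y * ?c ^ lam 1 * ?c ^ (n - lam 1) * ?l * A / _ / _ = _")
  proof -
    have "?c ^ lam 1 * ?c ^ (n - lam 1) = ?c ^ n" using l1 by (simp flip: power_add)
    then have "?x * ?y * ?c ^ lam 1 * ?c ^ (n - lam 1) * ?l * A / (1 - z) ^ n / fact n
        = ?x * ?y * ?c ^ n * ?l * A / (1 - z) ^ n / fact n" by (simp only: mult.assoc)
    also have "\<dots> = (A / (fact n * (1 - q) ^ n)) * ?x * ?y * ?l"
      using z1 q1 by (simp add: power_divide mult_ac)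
    finally show ?thesis .
  qed
  also have "A / (fact n * (1 - q) ^ n) = (\<Prod>j=1..n. (1 - q ^ j) / (of_nat j * (1 - q)))"
    by (simp add: A_def prod_dividef prod.distrib fact_prod)
  finally show ?thesis .
qed

section \<open>Expansions of the factors\<close>


text \<open>The mean value inequality on a disc; each application raises the order of vanishing at 0
  by one, so Taylor estimates reduce to a bound for one high derivative.\<close>

lemma norm_le_power_of_deriv:
  fixes f f' :: "complex \<Rightarrow> complex"
  assumes "\<And>x. (f has_field_derivative f' x) (at x)" "f 0 = 0"
    and "\<And>x. norm x \<le> 1 \<Longrightarrow> norm (f' x) \<le> C * norm x ^ k" and x: "norm x \<le> 1"
  shows "norm (f x) \<le> C * norm x ^ Suc k"
proof -
  have C: "0 \<le> C" using order.trans[OF norm_ge_zero assms(3)[of 1]] by simp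
  have "norm (f x - f 0) \<le> C * norm x ^ k * norm (x - 0)"
  proof (rule field_differentiable_bound)
    show "norm (f' z) \<le> C * norm x ^ k" if "z \<in> cball 0 (norm x)" for z
    proof -
      have z: "norm z \<le> norm x" using that by simp
      have "norm (f' z) \<le> C * norm z ^ k" using z x by (intro assms(3)) simp
      also have "\<dots> \<le> C * norm x ^ k" using z C by (intro mult_left_mono power_mono) auto
      finally show ?thesis .
    qed
  qed (use assms(1) in \<open>auto intro: has_field_derivative_at_within\<close>)
  then show ?thesis by (simp add: assms(2) mult_ac)
qed

lemma continuous_bounded_cball:
  fixes f :: "complex \<Rightarrow> complex"
  assumes "continuous_on UNIV f"
  obtains B where "\<And>x. norm x \<le> 1 \<Longrightarrow> norm (f x) \<le> B" "0 < B"
proof -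
  have "compact (f ` cball 0 1)"
    using assms by (intro compact_continuous_image) (auto intro: continuous_on_subset)
  then obtain B where "0 < B" "\<forall>y\<in>f ` cball 0 1. norm y \<le> B"
    using compact_imp_bounded bounded_pos by metis
  then show ?thesis by (intro that) auto
qed

text \<open>The exponent is minus the second Taylor polynomial of the logarithm of
  \<open>1 - w * (exp x - 1)\<close>. The derivative of the product is \<open>g x * E x\<close>,
  where \<open>g\<close> vanishes to second order.\<close>

lemma linear_factor_approx:
  fixes w :: complex
  obtains C where "0 \<le> C"
    "\<And>x. norm x \<le> 1 \<Longrightarrow> norm ((1 - w * (exp x - 1)) * exp (w * x + w * (1 + w) / 2 * x\<^sup>2) - 1) \<le> C * norm x ^ 3"
proof -
  define E where "E x = exp (w * x + w * (1 + w) / 2 * x\<^sup>2)" for x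
  define g where "g x = - w * exp x + (1 - w * (exp x - 1)) * (w + w * (1 + w) * x)" for x
  define g1 where "g1 x = - w * exp x - w * exp x * (w + w * (1 + w) * x) + (1 - w * (exp x - 1)) * (w * (1 + w))" for x
  define g2 where "g2 x = - w * exp x - w * exp x * (w + w * (1 + w) * x) - 2 * w * exp x * (w * (1 + w))" for x
  have dg1: "(g1 has_field_derivative g2 x) (at x)" for x
    unfolding g1_def g2_def by (rule derivative_eq_intros refl | simp add: algebra_simps)+
  have dg: "(g has_field_derivative g1 x) (at x)" for x
    unfolding g_def g1_def by (rule derivative_eq_intros refl | simp add: algebra_simps)+
  have dE: "((\<lambda>x. (1 - w * (exp x - 1)) * E x - 1) has_field_derivative g x * E x) (at x)" for x
    unfolding g_def E_def by (rule derivative_eq_intros refl | simp add: field_simps power2_eq_square)+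
  obtain B where B: "\<And>x. norm x \<le> 1 \<Longrightarrow> norm (g2 x) \<le> B" "0 < B"
    by (rule continuous_bounded_cball[of g2]) (auto simp: g2_def intro!: continuous_intros)
  obtain M where M: "\<And>x. norm x \<le> 1 \<Longrightarrow> norm (E x) \<le> M" "0 < M"
    by (rule continuous_bounded_cball[of E]) (auto simp: E_def intro!: continuous_intros)
  have g1: "norm (g1 x) \<le> B * norm x ^ Suc 0" if "norm x \<le> 1" for x
    by (rule norm_le_power_of_deriv[OF dg1 _ _ that]) (auto simp: B g1_def algebra_simps)
  have g: "norm (g x) \<le> B * norm x ^ Suc (Suc 0)" if "norm x \<le> 1" for x
    by (rule norm_le_power_of_deriv[OF dg _ g1 that]) (auto simp: g_def)
  have gE: "norm (g x * E x) \<le> B * M * norm x ^ 2" if "norm x \<le> 1" for x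
  proof -
    have "norm (g x) * norm (E x) \<le> (B * norm x ^ 2) * M"
      using M(1)[OF that] g[OF that] B(2) by (intro mult_mono) (auto simp: numeral_2_eq_2)
    then show ?thesis by (simp add: norm_mult mult_ac)
  qed
  have "norm ((1 - w * (exp x - 1)) * E x - 1) \<le> B * M * norm x ^ Suc 2" if "norm x \<le> 1" for x
    by (rule norm_le_power_of_deriv[OF dE _ gE that]) (auto simp: E_def)
  then show ?thesis using B(2) M(2) by (intro that[of "B * M"]) (auto simp: E_def numeral_3_eq_3 numeral_2_eq_2)
qed

text \<open>Up to second order, \<open>x/2 + x^2/24\<close> is the logarithm of
  \<open>(exp x - 1) / x\<close>. The singular quotient is avoided by showing that
  \<open>exp x - 1 - x * D x\<close> vanishes to fourth order and dividing by \<open>x\<close> only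
  at the end.\<close>

lemma exp_quotient_approx:
  obtains C where "0 \<le> C"
    "\<And>x::complex. norm x \<le> 1 \<Longrightarrow> x \<noteq> 0 \<Longrightarrow> norm ((exp x - 1) / x * exp (- (x / 2 + x\<^sup>2 / 24)) - 1) \<le> C * norm x ^ 3"
proof -
  define D where "D x = exp (x / 2 + x\<^sup>2 / 24)" for x :: complex
  define u where "u x = exp x - 1 - x * D x" for x
  \<comment> \<open>Successive derivatives of \<open>u\<close>, with \<open>D x\<close> factored out
    by \<open>D' = D * (1/2 + x/12)\<close>.\<close>
  define u1 where "u1 x = exp x - D x * (1 + x/2 + x^2/12)" for x
  define u2 where "u2 x = exp x - D x * (1 + x/2 + x^2/12 + x^3/144)" for x
  define u3 where "u3 x = exp x - D x * (1 + x/2 + 5*x^2/48 + x^3/96 + x^4/1728)" for x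
  define u4 where "u4 x = exp x - D x * ((1/2 + x/12) * (1 + x/2 + 5*x^2/48 + x^3/96 + x^4/1728) + (1/2 + 5*x/24 + x^2/32 + x^3/432))" for x
  have dD: "(D has_field_derivative D x * (1/2 + x/12)) (at x)" for x
    unfolding D_def by (rule derivative_eq_intros refl | simp add: algebra_simps)+
  have d: "(u has_field_derivative u1 x) (at x)" "(u1 has_field_derivative u2 x) (at x)"
    "(u2 has_field_derivative u3 x) (at x)" "(u3 has_field_derivative u4 x) (at x)" for x
    unfolding u_def u1_def u2_def u3_def u4_def
    by (rule derivative_eq_intros dD refl | simp add: field_simps power2_eq_square power3_eq_cube power4_eq_xxxx)+
  have z: "u 0 = 0" "u1 0 = 0" "u2 0 = 0" "u3 0 = 0" by (simp_all add: u_def u1_def u2_def u3_def D_def)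
  obtain B where B: "\<And>x. norm x \<le> 1 \<Longrightarrow> norm (u4 x) \<le> B" "0 < B"
    by (rule continuous_bounded_cball[of u4]) (auto simp: u4_def D_def intro!: continuous_intros)
  obtain M where M: "\<And>x. norm x \<le> 1 \<Longrightarrow> norm (exp (- (x / 2 + x\<^sup>2 / 24)) :: complex) \<le> M" "0 < M"
    by (rule continuous_bounded_cball[of "\<lambda>x. exp (- (x / 2 + x\<^sup>2 / 24))"]) (auto intro!: continuous_intros)
  have 3: "norm (u3 x) \<le> B * norm x ^ Suc 0" if "norm x \<le> 1" for x
    by (rule norm_le_power_of_deriv[OF d(4) z(4) _ that]) (auto simp: B)
  have 2: "norm (u2 x) \<le> B * norm x ^ Suc (Suc 0)" if "norm x \<le> 1" for x
    by (rule norm_le_power_of_deriv[OF d(3) z(3) 3 that])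
  have 1: "norm (u1 x) \<le> B * norm x ^ Suc (Suc (Suc 0))" if "norm x \<le> 1" for x
    by (rule norm_le_power_of_deriv[OF d(2) z(2) 2 that])
  have 0: "norm (u x) \<le> B * norm x ^ Suc (Suc (Suc (Suc 0)))" if "norm x \<le> 1" for x
    by (rule norm_le_power_of_deriv[OF d(1) z(1) 1 that])
  show ?thesis
  proof (rule that[of "B * M"])
    fix x :: complex assume x: "norm x \<le> 1" "x \<noteq> 0"
    have eq: "(exp x - 1) / x * exp (- (x / 2 + x\<^sup>2 / 24)) - 1 = u x / x * exp (- (x / 2 + x\<^sup>2 / 24))"
      using x(2) by (simp add: u_def D_def exp_minus field_simps)
    have "norm (u x / x) \<le> B * norm x ^ 3"
    proof -
      have "norm (u x) \<le> B * norm x ^ 3 * norm x" using 0[OF x(1)] by (simp add: numeral_3_eq_3 mult_ac)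
      then show ?thesis using x(2) by (simp add: norm_divide divide_le_eq)
    qed
    then have "norm (u x / x) * norm (exp (- (x / 2 + x\<^sup>2 / 24))) \<le> B * norm x ^ 3 * M"
      using M(1)[OF x(1)] B(2) by (intro mult_mono) auto
    then show "norm ((exp x - 1) / x * exp (- (x / 2 + x\<^sup>2 / 24)) - 1) \<le> B * M * norm x ^ 3"
      unfolding eq norm_mult by (simp add: mult_ac)
  qed (use B M in auto)
qed

lemma norm_prod_minus_1_le_exp:
  fixes r :: "nat \<Rightarrow> complex"
  assumes "\<And>j. j \<in> A \<Longrightarrow> norm (r j - 1) \<le> e" "0 \<le> e"
  shows "norm ((\<Prod>j\<in>A. r j) - 1) \<le> exp (real (card A) * e) - 1"
proof -
  have "norm ((\<Prod>j\<in>A. 1 + (r j - 1)) - 1) \<le> (\<Prod>j\<in>A. 1 + norm (r j - 1)) - 1"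
    by (rule norm_prod_minus1_le_prod_minus1)
  also have "(\<Prod>j\<in>A. 1 + norm (r j - 1)) \<le> (\<Prod>j\<in>A. exp e)"
  proof (intro prod_mono conjI)
    fix j assume "j \<in> A"
    then have "1 + norm (r j - 1) \<le> 1 + e" using assms(1) by simp
    also have "\<dots> \<le> exp e" by (rule exp_ge_add_one_self)
    finally show "1 + norm (r j - 1) \<le> exp e" .
  qed simp
  also have "\<dots> = exp (real (card A) * e)" by (simp add: exp_of_nat_mult)
  finally show ?thesis by simp
qed

text \<open>A product of factors \<open>f (x j)\<close> close to \<open>exp (g (x j))\<close> is compared after division by the exponentials,
  since the factors themselves are only \<open>1 + O(x j)\<close>.\<close>

lemma norm_prod_minus_exp_sum_le:
  fixes f g :: "complex \<Rightarrow> complex" and x :: "nat \<Rightarrow> complex"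
  assumes approx: "\<And>j. j \<in> A \<Longrightarrow> norm (f (x j) * exp (- g (x j)) - 1) \<le> C * norm (x j) ^ 3"
    and x: "\<And>j. j \<in> A \<Longrightarrow> norm (x j) \<le> y" and C: "0 \<le> C" and y: "0 \<le> y"
    and card: "card A \<le> n"
  shows "norm ((\<Prod>j\<in>A. f (x j)) * exp (- (\<Sum>j\<in>A. g (x j))) - 1) \<le> exp (real n * (C * y ^ 3)) - 1"
proof (cases "finite A")
  case True
  have "(\<Prod>j\<in>A. f (x j)) * exp (- (\<Sum>j\<in>A. g (x j))) = (\<Prod>j\<in>A. f (x j) * exp (- g (x j)))"
    using True by (simp add: prod.distrib exp_sum flip: sum_negf)
  also have "norm (\<dots> - 1) \<le> exp (real (card A) * (C * y ^ 3)) - 1"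
  proof (rule norm_prod_minus_1_le_exp)
    fix j assume j: "j \<in> A"
    have "C * norm (x j) ^ 3 \<le> C * y ^ 3" using x[OF j] C by (intro mult_left_mono power_mono) auto
    then show "norm (f (x j) * exp (- g (x j)) - 1) \<le> C * y ^ 3" using approx[OF j] by linarith
  qed (use C y in simp)
  also have "exp (real (card A) * (C * y ^ 3)) \<le> exp (real n * (C * y ^ 3))"
    using C y card by (simp add: mult_right_mono)
  finally show ?thesis by simp
qed (use C y in simp)

section \<open>Asymptotics on the unit circle\<close>


definition dev1 :: "nat \<Rightarrow> nat \<Rightarrow> real" where
  "dev1 l d = (\<Sum>k=1..l. real k - real d)"

definition dev2 :: "nat \<Rightarrow> nat \<Rightarrow> real" where
  "dev2 l d = (\<Sum>k=1..l. (real k - real d)\<^sup>2)"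

text \<open>The arguments \<open>\<i> t (k - d)\<close> are imaginary with real negative squares, so
  the linear part becomes a phase and the quadratic part a real exponent. The constant depends on
  \<open>w\<close> alone; this makes the estimate uniform over the permutations, which enter through
  \<open>d\<close>.\<close>

lemma linear_factor_prod:
  fixes w :: real
  obtains C where "0 \<le> C"
    "\<And>t l d N y. l \<le> N \<Longrightarrow> d \<le> N \<Longrightarrow> \<bar>t\<bar> * real N \<le> y \<Longrightarrow> y \<le> 1 \<Longrightarrow>
      norm ((\<Prod>k=1..l. 1 - of_real w * (exp (\<i> * of_real (t * (real k - real d))) - 1)) -
        exp (of_real (w * (1 + w) / 2 * t\<^sup>2 * dev2 l d) - \<i> * of_real (w * t * dev1 l d)))
      \<le> exp (w * (1 + w) / 2 * t\<^sup>2 * dev2 l d) * (exp (real N * (C * y ^ 3)) - 1)"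
proof -
  define f where "f x = 1 - complex_of_real w * (exp x - 1)" for x
  define g where "g x = - (complex_of_real w * x + of_real w * (1 + of_real w) / 2 * x\<^sup>2)" for x
  obtain C where C: "0 \<le> C" "\<And>x. norm x \<le> 1 \<Longrightarrow> norm (f x * exp (- g x) - 1) \<le> C * norm x ^ 3"
    unfolding f_def g_def minus_minus by (rule linear_factor_approx[of "of_real w"]) blast
  show ?thesis
  proof (rule that[OF C(1)])
    fix t y :: real and l d N assume l: "l \<le> N" "d \<le> N" and y: "\<bar>t\<bar> * real N \<le> y" "y \<le> 1"
    define x where "x k = \<i> * complex_of_real (t * (real k - real d))" for k :: nat
    have x: "norm (x k) \<le> y" if "k \<in> {1..l}" for k
    proof -
      have "\<bar>real k - real d\<bar> \<le> real N" using that l by auto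
      then have "\<bar>t\<bar> * \<bar>real k - real d\<bar> \<le> \<bar>t\<bar> * real N" by (intro mult_left_mono) auto
      moreover have "norm (x k) = \<bar>t\<bar> * \<bar>real k - real d\<bar>"
        unfolding x_def norm_mult norm_of_real abs_mult by simp
      ultimately show ?thesis using y by simp
    qed
    have y0: "0 \<le> y" using y(1) by (rule order.trans[rotated]) simp
    define G where "G = (\<Sum>k=1..l. g (x k))"
    have P: "norm ((\<Prod>k=1..l. f (x k)) * exp (- G) - 1) \<le> exp (real N * (C * y ^ 3)) - 1"
      unfolding G_def
      using x y(2) C y0 l by (intro norm_prod_minus_exp_sum_le) (auto intro: C(2) order.trans)
    have gx: "g (x k) = of_real (w * (1 + w) / 2 * t\<^sup>2 * (real k - real d)\<^sup>2) - \<i> * of_real (w * t * (real k - real d))" for k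
      by (simp add: g_def x_def power_mult_distrib)
    have D: "w * t * dev1 l d = (\<Sum>k=1..l. w * t * (real k - real d))"
      "w * (1 + w) / 2 * t\<^sup>2 * dev2 l d = (\<Sum>k=1..l. w * (1 + w) / 2 * t\<^sup>2 * (real k - real d)\<^sup>2)"
      by (simp_all only: dev1_def dev2_def sum_distrib_left)
    have G: "G = of_real (w * (1 + w) / 2 * t\<^sup>2 * dev2 l d) - \<i> * of_real (w * t * dev1 l d)"
      unfolding G_def gx D of_real_sum sum_distrib_left by (rule sum_subtractf)
    have "norm (exp G) = exp (w * (1 + w) / 2 * t\<^sup>2 * dev2 l d)" by (simp add: G)
    moreover have "(\<Prod>k=1..l. f (x k)) - exp G = exp G * ((\<Prod>k=1..l. f (x k)) * exp (- G) - 1)"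
      by (simp add: exp_minus field_simps)
    ultimately have "norm ((\<Prod>k=1..l. f (x k)) - exp G) = exp (w * (1 + w) / 2 * t\<^sup>2 * dev2 l d) * norm ((\<Prod>k=1..l. f (x k)) * exp (- G) - 1)"
      by (simp only: norm_mult)
    also have "\<dots> \<le> exp (w * (1 + w) / 2 * t\<^sup>2 * dev2 l d) * (exp (real N * (C * y ^ 3)) - 1)"
      using P by (rule mult_left_mono) simp
    finally have "norm ((\<Prod>k=1..l. f (x k)) - exp G) \<le> exp (w * (1 + w) / 2 * t\<^sup>2 * dev2 l d) * (exp (real N * (C * y ^ 3)) - 1)" .
    then show "norm ((\<Prod>k=1..l. 1 - of_real w * (exp (\<i> * of_real (t * (real k - real d))) - 1)) -
        exp (of_real (w * (1 + w) / 2 * t\<^sup>2 * dev2 l d) - \<i> * of_real (w * t * dev1 l d)))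
      \<le> exp (w * (1 + w) / 2 * t\<^sup>2 * dev2 l d) * (exp (real N * (C * y ^ 3)) - 1)"
      unfolding G f_def x_def .
  qed
qed

lemma dev2_bounds:
  assumes "l \<le> N" "d \<le> N"
  shows "0 \<le> dev2 l d" "dev2 l d \<le> real N ^ 3"
proof -
  show "0 \<le> dev2 l d" unfolding dev2_def by (intro sum_nonneg) auto
  have "dev2 l d \<le> (\<Sum>k=1..l. (real N)\<^sup>2)"
    unfolding dev2_def
  proof (rule sum_mono)
    fix k assume "k \<in> {1..l}"
    then have "\<bar>real k - real d\<bar> \<le> \<bar>real N\<bar>" using assms by auto
    then show "(real k - real d)\<^sup>2 \<le> (real N)\<^sup>2" by (simp only: abs_le_square_iff)
  qed
  also have "\<dots> \<le> real N * (real N)\<^sup>2" using assms by (simp add: mult_right_mono)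
  finally show "dev2 l d \<le> real N ^ 3" by (simp add: power2_eq_square power3_eq_cube)
qed

lemma des1_le: "1 \<le> n \<Longrightarrow> des1 n \<pi> \<le> n"
proof -
  assume "1 \<le> n"
  have "card (descents n \<pi>) \<le> card {1..<n}" unfolding descents_def by (intro card_mono) auto
  then show ?thesis using \<open>1 \<le> n\<close> by (simp add: des1_def)
qed

lemma exp_sub_one_tendsto_0:
  fixes f :: "nat \<Rightarrow> real"
  assumes "f \<longlonglongrightarrow> 0"
  shows "(\<lambda>j. exp (f j) - 1) \<longlonglongrightarrow> 0"
  using tendsto_diff[OF tendsto_exp[OF assms] tendsto_const[of 1]] by simp

section \<open>Averages over a sequence of classes\<close>

locale class_sequence =
  fixes n :: "nat \<Rightarrow> nat" and lam :: "nat \<Rightarrow> nat \<Rightarrow> nat"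
  assumes n_pos: "1 \<le> n j" and part: "partition_of (lam j) (n j)"
    and n_lim: "filterlim n at_top sequentially"
begin

abbreviation "cls j \<equiv> conj_class (n j) (lam j)"

definition avg :: "nat \<Rightarrow> ((nat \<Rightarrow> nat) \<Rightarrow> complex) \<Rightarrow> complex" where
  "avg j f = (\<Sum>\<pi>\<in>cls j. f \<pi>) / of_nat (card (cls j))"

lemma card_cls: "card (cls j) > 0"
proof -
  have "card (cls j) \<noteq> 0"
    using card_conj_class[OF n_pos part, of j] by (metis fact_nonzero mult_0_right)
  then show ?thesis by simp
qed

lemma cls_ne: "cls j \<noteq> {}" "finite (cls j)"
  using card_cls[of j] by (auto simp: card_gt_0_iff)

lemma avg_diff: "avg j f - avg j g = avg j (\<lambda>\<pi>. f \<pi> - g \<pi>)"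
  by (simp add: avg_def sum_subtractf diff_divide_distrib)

lemma avg_cmult: "c * avg j f = avg j (\<lambda>\<pi>. c * f \<pi>)"
  by (simp add: avg_def sum_distrib_left)

lemma norm_avg_le:
  assumes "\<And>\<pi>. \<pi> \<in> cls j \<Longrightarrow> norm (f \<pi>) \<le> B"
  shows "norm (avg j f) \<le> B"
proof -
  have "norm (\<Sum>\<pi>\<in>cls j. f \<pi>) \<le> (\<Sum>\<pi>\<in>cls j. B)" using assms by (rule sum_norm_le)
  then have "norm (\<Sum>\<pi>\<in>cls j. f \<pi>) \<le> real (card (cls j)) * B" by simp
  then show ?thesis using card_cls[of j] by (simp add: avg_def norm_divide divide_le_eq mult.commute)
qed

lemma inverse_n_lim: "(\<lambda>j. 1 / real (n j)) \<longlonglongrightarrow> 0"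
  using filterlim_compose[OF lim_1_over_n n_lim] .

lemma lam1_le: "lam j 1 \<le> n j"
  using partition_of_le[OF part, of 1 j] n_pos[of j] by simp

end

text \<open>The scale \<open>s = n^(-3/2)\<close> gives the central limit theorem and \<open>s = n^(-2) / 4\<close> the law of large
  numbers for the number of descents.\<close>

locale scaled_class_sequence = class_sequence +
  fixes \<theta>1 \<theta>2 :: real and s :: "nat \<Rightarrow> real"
  assumes \<theta>2: "\<theta>2 \<noteq> 0" and \<theta>12: "\<theta>1 + \<theta>2 \<noteq> 0"
    and s_pos: "0 < s j" and s_small: "(s j)\<^sup>2 * real (n j) ^ 3 \<le> 1"
begin

text \<open>This is \<open>z / (1 - z)\<close>, finite because \<theta>2 is nonzero; with it
  \<open>w (1 + w) t^2 = \<kappa> s^2\<close>.\<close>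

definition "w = \<theta>1 / \<theta>2"
definition "z = complex_of_real (\<theta>1 / (\<theta>1 + \<theta>2))"
definition "t j = \<theta>2 * s j"
definition "q j = exp (\<i> * complex_of_real (t j))"
definition "\<kappa> = \<theta>1 * (\<theta>1 + \<theta>2)"

lemma w_t: "w * t j = \<theta>1 * s j"
  using \<theta>2 by (simp add: w_def t_def)

lemma w_t_sq: "w * (1 + w) / 2 * (t j)\<^sup>2 * D = \<kappa> / 2 * (s j)\<^sup>2 * D"
proof -
  have "w * (1 + w) * (t j)\<^sup>2 = \<kappa> * (s j)\<^sup>2"
    using \<theta>2 by (simp add: w_def t_def \<kappa>_def power2_eq_square field_simps)
  then show ?thesis by simp
qed

lemma w_eq: "w = \<theta>1 / (\<theta>1 + \<theta>2) / (1 - \<theta>1 / (\<theta>1 + \<theta>2))" "1 - \<theta>1 / (\<theta>1 + \<theta>2) \<noteq> 0"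
proof -
  have *: "1 - \<theta>1 / (\<theta>1 + \<theta>2) = \<theta>2 / (\<theta>1 + \<theta>2)" using \<theta>12 by (simp add: diff_divide_eq_iff)
  show "w = \<theta>1 / (\<theta>1 + \<theta>2) / (1 - \<theta>1 / (\<theta>1 + \<theta>2))" "1 - \<theta>1 / (\<theta>1 + \<theta>2) \<noteq> 0"
    unfolding * using \<theta>2 \<theta>12 by (simp_all add: w_def)
qed

lemma z_ne_1: "z \<noteq> 1"
proof
  assume "z = 1"
  then have "\<theta>1 / (\<theta>1 + \<theta>2) = 1" unfolding z_def of_real_eq_1_iff .
  then show False using w_eq(2) by simp
qed

lemma linear_factor: "(1 - z * c) / (1 - z) = 1 - of_real w * (c - 1)"
proof -
  have "of_real w = z / (1 - z)" unfolding w_eq(1) z_def by simp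
  moreover have "(1 - z * c) / (1 - z) = 1 - z / (1 - z) * (c - 1)"
    using z_ne_1 by (simp add: field_simps)
  ultimately show ?thesis by simp
qed

lemma q_power: "q j ^ k / q j ^ d = exp (\<i> * of_real (t j * (real k - real d)))"
proof -
  have "q j ^ m = exp (\<i> * of_real (t j * real m))" for m
    unfolding q_def exp_of_nat_mult[symmetric] by (simp add: mult_ac)
  then show ?thesis by (simp add: exp_diff[symmetric] algebra_simps)
qed

lemma norm_q: "norm (q j) = 1"
  by (simp add: q_def)

lemma sn_lim: "(\<lambda>j. s j * real (n j)) \<longlonglongrightarrow> 0"
proof -
  have "(\<lambda>j. (s j * real (n j))\<^sup>2) \<longlonglongrightarrow> 0"
  proof (rule Lim_null_comparison[OF _ inverse_n_lim], rule always_eventually, rule allI)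
    fix j
    have "(s j * real (n j))\<^sup>2 * real (n j) \<le> 1"
      using s_small[of j] by (simp add: power2_eq_square power3_eq_cube mult_ac)
    then show "norm ((s j * real (n j))\<^sup>2) \<le> 1 / real (n j)"
      using n_pos[of j] by (simp add: le_divide_eq)
  qed
  from tendsto_real_sqrt[OF this] show ?thesis by (simp add: tendsto_rabs_zero_iff)
qed

text \<open>The largest angle that occurs: every \<open>t (k - d)\<close> with
  \<open>1 \<le> k \<le> n\<close> and \<open>1 \<le> d \<le> n\<close> is at most this in
  modulus.\<close>

definition "y j = \<bar>\<theta>2\<bar> * (s j * real (n j))"

lemma y_lim: "y \<longlonglongrightarrow> 0"
  unfolding y_def using tendsto_mult_right_zero[OF sn_lim, of "\<bar>\<theta>2\<bar>"] by simp

lemma y_pos: "0 < y j"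
  using \<theta>2 s_pos[of j] n_pos[of j] by (simp add: y_def)

lemma t_y: "\<bar>t j\<bar> * real (n j) = y j"
  using s_pos[of j] by (simp add: t_def y_def abs_mult)

text \<open>There are at most \<open>n\<close> factors, each with an error of order
  \<open>y^3\<close>, and \<open>n * y^3\<close> is a constant times
  \<open>(s^2 * n^3) * (s * n)\<close>, a bounded quantity times a vanishing one.\<close>

lemma err_lim: "(\<lambda>j. exp (real (n j) * (C * y j ^ 3)) - 1) \<longlonglongrightarrow> 0"
proof (rule exp_sub_one_tendsto_0)
  have "(\<lambda>j. \<bar>C\<bar> * \<bar>\<theta>2\<bar> ^ 3 * (s j * real (n j))) \<longlonglongrightarrow> 0"
    using tendsto_mult_right_zero[OF sn_lim] .
  then show "(\<lambda>j. real (n j) * (C * y j ^ 3)) \<longlonglongrightarrow> 0"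
  proof (rule Lim_null_comparison[rotated], intro always_eventually allI)
    fix j
    have "real (n j) * y j ^ 3 = \<bar>\<theta>2\<bar> ^ 3 * ((s j)\<^sup>2 * real (n j) ^ 3) * (s j * real (n j))"
      unfolding y_def by (simp add: power2_eq_square power3_eq_cube mult_ac)
    also have "\<dots> \<le> \<bar>\<theta>2\<bar> ^ 3 * 1 * (s j * real (n j))"
      using s_small[of j] s_pos[of j] by (intro mult_right_mono mult_left_mono) auto
    finally have "\<bar>C\<bar> * (real (n j) * y j ^ 3) \<le> \<bar>C\<bar> * (\<bar>\<theta>2\<bar> ^ 3 * 1 * (s j * real (n j)))"
      by (intro mult_left_mono) auto
    then show "norm (real (n j) * (C * y j ^ 3)) \<le> \<bar>C\<bar> * \<bar>\<theta>2\<bar> ^ 3 * (s j * real (n j))"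
      using y_pos[of j] by (simp add: abs_mult mult_ac)
  qed
qed

lemma ev_y: "0 < c \<Longrightarrow> \<forall>\<^sub>F j in sequentially. y j < c"
  using y_lim by (rule order_tendstoD(2))

lemma norm_q_minus_1: "norm (q j - 1) \<le> \<bar>t j\<bar>"
proof -
  have "norm (q j - 1) = 2 * \<bar>sin (t j / 2)\<bar>" unfolding q_def by (rule dist_exp_i_1)
  also have "\<dots> \<le> 2 * \<bar>t j / 2\<bar>" using abs_sin_x_le_abs_x[of "t j / 2"] by (intro mult_left_mono) auto
  finally show ?thesis by simp
qed

lemma t_le_y: "\<bar>t j\<bar> \<le> y j"
  using n_pos[of j] mult_left_mono[of 1 "real (n j)" "\<bar>t j\<bar>"] by (simp add: t_y[symmetric])

lemma t_ne: "t j \<noteq> 0"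
  using \<theta>2 s_pos[of j] by (simp add: t_def)

lemma q_ne_1: "y j < 1 \<Longrightarrow> q j \<noteq> 1"
proof
  assume y: "y j < 1" and "q j = 1"
  then obtain k :: int where "Im (\<i> * complex_of_real (t j)) = of_int (2 * k) * pi"
    unfolding q_def exp_eq_1 by blast
  then have t: "t j = of_int (2 * k) * pi" by simp
  then have "k \<noteq> 0" using t_ne[of j] by auto
  then have "1 * pi \<le> \<bar>real_of_int (2 * k)\<bar> * pi" by (intro mult_right_mono) auto
  then have "pi \<le> \<bar>t j\<bar>" using t by (simp add: abs_mult)
  then show False using t_le_y[of j] y pi_gt3 by simp
qed

lemma ev_q:
  "\<forall>\<^sub>F j in sequentially. q j \<noteq> 1 \<and> real (n j) * norm (q j - 1) \<le> 1/2 \<and> (\<forall>k\<in>{1..n j}. q j ^ k \<noteq> 1)"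
proof -
  have "\<forall>\<^sub>F j in sequentially. y j < 1/2" by (rule ev_y) simp
  then show ?thesis
  proof eventually_elim
    case (elim j)
    then have q1: "q j \<noteq> 1" using q_ne_1[of j] by simp
    have "real (n j) * norm (q j - 1) \<le> real (n j) * \<bar>t j\<bar>"
      using norm_q_minus_1 by (intro mult_left_mono) auto
    then have "real (n j) * norm (q j - 1) \<le> 1/2" using elim t_y[of j] by (simp add: mult.commute)
    then show ?case using power_ne_1[OF q1 eq_refl[OF norm_q]] q1 by blast
  qed
qed

text \<open>The accumulated error is governed by
  \<open>n * err = 3 (n \<eta>) + 4 (n \<eta>)^2\<close>, and \<open>n * \<eta>\<close> is at most a
  constant times \<open>y\<close>.\<close>

lemma long_cycles_lim: "(\<lambda>j. long_cycles (n j) (lam j) z (q j)) \<longlonglongrightarrow> 1"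
proof (rule LIM_zero_cancel)
  define Z where "Z = 2 * ((1 + norm z) / norm (1 - z))\<^sup>2"
  have Z0: "0 \<le> Z" by (simp add: Z_def)
  define \<eta> where "\<eta> j = Z * norm (q j - 1)" for j
  have n\<eta>: "real (n j) * \<eta> j \<le> Z * y j" for j
  proof -
    have "real (n j) * \<eta> j \<le> real (n j) * (Z * \<bar>t j\<bar>)"
      unfolding \<eta>_def using Z0 norm_q_minus_1 by (intro mult_left_mono) auto
    then show ?thesis by (simp add: t_y[symmetric] mult_ac)
  qed
  have \<eta>0: "0 \<le> \<eta> j" for j using Z0 by (simp add: \<eta>_def)
  have \<eta>_le: "\<eta> j \<le> real (n j) * \<eta> j" for j
    using n_pos[of j] mult_right_mono[of 1 "real (n j)" "\<eta> j"] \<eta>0[of j] by simp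
  have lim: "(\<lambda>j. Z * y j) \<longlonglongrightarrow> 0" using tendsto_mult_right_zero[OF y_lim] .
  have "(\<lambda>j. 3 * (Z * y j) + 4 * (Z * y j)\<^sup>2) \<longlonglongrightarrow> 3 * 0 + 4 * 0\<^sup>2"
    by (intro tendsto_intros lim)
  then have bnd: "(\<lambda>j. exp (3 * (Z * y j) + 4 * (Z * y j)\<^sup>2) - 1) \<longlonglongrightarrow> 0"
    by (intro exp_sub_one_tendsto_0) simp
  have ev: "\<forall>\<^sub>F j in sequentially. Z * y j < 1/3" using lim by (rule order_tendstoD(2)) simp
  show "(\<lambda>j. long_cycles (n j) (lam j) z (q j) - 1) \<longlonglongrightarrow> 0"
  proof (rule Lim_null_comparison[OF _ bnd])
    show "\<forall>\<^sub>F j in sequentially. norm (long_cycles (n j) (lam j) z (q j) - 1) \<le> exp (3 * (Z * y j) + 4 * (Z * y j)\<^sup>2) - 1"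
      using ev ev_q
    proof eventually_elim
      case (elim j)
      let ?e = "3 * \<eta> j + 4 * ((\<eta> j)\<^sup>2 * real (n j))"
      have n\<eta>2: "real (n j) * \<eta> j \<le> 1/3" using n\<eta>[of j] elim by simp
      have "(\<eta> j)\<^sup>2 * real (n j) = \<eta> j * (real (n j) * \<eta> j)" by (simp add: power2_eq_square)
      also have "\<dots> \<le> 1/3 * (1/3)" using n\<eta>2 \<eta>_le[of j] \<eta>0[of j] by (intro mult_mono) auto
      finally have "norm (long_cycles (n j) (lam j) z (q j) - 1) \<le> (1 + ?e) ^ n j - 1"
        using norm_long_cycles_le[of "q j" "n j" "lam j" z] elim norm_q part z_ne_1 n\<eta>2 \<eta>_le[of j]
        by (simp add: \<eta>_def Z_def)
      also have "(1 + ?e) ^ n j \<le> exp ?e ^ n j"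
        using \<eta>0[of j] by (intro power_mono) auto
      also have "exp ?e ^ n j = exp (3 * (real (n j) * \<eta> j) + 4 * (real (n j) * \<eta> j)\<^sup>2)"
        unfolding exp_of_nat_mult[symmetric] by (simp add: power2_eq_square algebra_simps)
      also have "\<dots> \<le> exp (3 * (Z * y j) + 4 * (Z * y j)\<^sup>2)"
        using n\<eta>[of j] \<eta>0[of j] by (simp add: add_mono power_mono)
      finally show ?case by simp
    qed
  qed
qed

text \<open>One summand after its factors are replaced by exponentials: the phase is affine in
  \<open>maj\<close> and in \<open>d\<close>, the modulus depends on \<open>d\<close> only.\<close>

definition "gauss_term j \<pi> = exp (of_real (\<kappa> / 2 * (s j)\<^sup>2 * dev2 (n j) (des1 (n j) \<pi>)) +
    \<i> * of_real (s j * (\<theta>2 * real (maj (n j) \<pi>) - \<theta>1 * dev1 (n j) (des1 (n j) \<pi>))))"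

lemma term_factor: "q j ^ maj (n j) \<pi> * exp (of_real (w * (1 + w) / 2 * (t j)\<^sup>2 * dev2 (n j) d) - \<i> * of_real (w * t j * dev1 (n j) d))
   = exp (of_real (\<kappa> / 2 * (s j)\<^sup>2 * dev2 (n j) d) + \<i> * of_real (s j * (\<theta>2 * real (maj (n j) \<pi>) - \<theta>1 * dev1 (n j) d)))"
proof -
  have "q j ^ maj (n j) \<pi> = exp (\<i> * of_real (s j * \<theta>2 * real (maj (n j) \<pi>)))"
    unfolding q_def exp_of_nat_mult[symmetric] by (simp add: t_def mult_ac)
  then show ?thesis unfolding w_t_sq w_t by (simp add: exp_add[symmetric] algebra_simps)
qed

lemma s_sq_dev2_le: "l \<le> n j \<Longrightarrow> d \<le> n j \<Longrightarrow> \<kappa> / 2 * (s j)\<^sup>2 * dev2 l d \<le> \<bar>\<kappa>\<bar>"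
proof -
  assume l: "l \<le> n j" "d \<le> n j"
  have "(s j)\<^sup>2 * dev2 l d \<le> (s j)\<^sup>2 * real (n j) ^ 3" using dev2_bounds(2)[OF l] by (intro mult_left_mono) auto
  also have "\<dots> \<le> 1" by (rule s_small)
  finally have 1: "(s j)\<^sup>2 * dev2 l d \<le> 1" .
  have 0: "0 \<le> (s j)\<^sup>2 * dev2 l d" using dev2_bounds(1)[OF l] by simp
  have "\<kappa> / 2 * ((s j)\<^sup>2 * dev2 l d) \<le> \<bar>\<kappa>\<bar> * 1" using 0 1 by (intro mult_mono) auto
  then show ?thesis by (simp add: mult_ac)
qed

text \<open>Powers of \<open>q\<close> have modulus 1 and the real exponents are at most
  \<open>\<bar>\<kappa>\<bar>\<close>, so the error of the product passes to the average
  uniformly.\<close>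

lemma avg_gauss_term_diff_lim:
  "(\<lambda>j. avg j (\<lambda>\<pi>. q j ^ maj (n j) \<pi> * (\<Prod>k=1..n j. (1 - z * q j ^ k / q j ^ des1 (n j) \<pi>) / (1 - z))) - avg j (gauss_term j)) \<longlonglongrightarrow> 0"
proof -
  obtain C where C: "0 \<le> C" and bound: "\<And>t l d N y. l \<le> N \<Longrightarrow> d \<le> N \<Longrightarrow> \<bar>t\<bar> * real N \<le> y \<Longrightarrow> y \<le> 1 \<Longrightarrow>
      norm ((\<Prod>k=1..l. 1 - of_real w * (exp (\<i> * of_real (t * (real k - real d))) - 1)) -
        exp (of_real (w * (1 + w) / 2 * t\<^sup>2 * dev2 l d) - \<i> * of_real (w * t * dev1 l d)))
      \<le> exp (w * (1 + w) / 2 * t\<^sup>2 * dev2 l d) * (exp (real N * (C * y ^ 3)) - 1)"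
    by (rule linear_factor_prod[of w]) blast
  have lim: "(\<lambda>j. exp \<bar>\<kappa>\<bar> * (exp (real (n j) * (C * y j ^ 3)) - 1)) \<longlonglongrightarrow> 0"
    using tendsto_mult_right_zero[OF err_lim] .
  have "\<forall>\<^sub>F j in sequentially. y j < 1" by (rule ev_y) simp
  then have "\<forall>\<^sub>F j in sequentially. norm (avg j (\<lambda>\<pi>. q j ^ maj (n j) \<pi> * (\<Prod>k=1..n j. (1 - z * q j ^ k / q j ^ des1 (n j) \<pi>) / (1 - z))) - avg j (gauss_term j))
     \<le> exp \<bar>\<kappa>\<bar> * (exp (real (n j) * (C * y j ^ 3)) - 1)"
  proof eventually_elim
    case (elim j)
    show ?case unfolding avg_diff
    proof (rule norm_avg_le)
      fix \<pi>
      define d where "d = des1 (n j) \<pi>"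
      have d: "d \<le> n j" unfolding d_def by (rule des1_le[OF n_pos])
      have P: "(\<Prod>k=1..n j. (1 - z * q j ^ k / q j ^ d) / (1 - z)) = (\<Prod>k=1..n j. 1 - of_real w * (exp (\<i> * of_real (t j * (real k - real d))) - 1))"
        unfolding times_divide_eq_right[symmetric] linear_factor q_power ..
      let ?P = "\<Prod>k=1..n j. 1 - of_real w * (exp (\<i> * of_real (t j * (real k - real d))) - 1)"
      let ?X = "exp (of_real (w * (1 + w) / 2 * (t j)\<^sup>2 * dev2 (n j) d) - \<i> * of_real (w * t j * dev1 (n j) d))"
      have "norm (q j ^ maj (n j) \<pi> * (\<Prod>k=1..n j. (1 - z * q j ^ k / q j ^ d) / (1 - z)) - gauss_term j \<pi>)
          = norm (q j ^ maj (n j) \<pi> * (?P - ?X))"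
        unfolding P gauss_term_def d_def[symmetric] term_factor[symmetric] by (simp add: right_diff_distrib)
      also have "\<dots> = norm (?P - ?X)" by (simp add: norm_mult norm_power norm_q)
      also have "\<dots> \<le> exp (w * (1 + w) / 2 * (t j)\<^sup>2 * dev2 (n j) d) * (exp (real (n j) * (C * y j ^ 3)) - 1)"
        using d elim t_y by (intro bound) auto
      also have "\<dots> \<le> exp \<bar>\<kappa>\<bar> * (exp (real (n j) * (C * y j ^ 3)) - 1)"
        unfolding w_t_sq using s_sq_dev2_le[of "n j" j d] d C y_pos[of j] by (intro mult_right_mono) auto
      finally show "norm (q j ^ maj (n j) \<pi> * (\<Prod>k=1..n j. (1 - z * q j ^ k / q j ^ des1 (n j) \<pi>) / (1 - z)) - gauss_term j \<pi>)
        \<le> exp \<bar>\<kappa>\<bar> * (exp (real (n j) * (C * y j ^ 3)) - 1)" by (simp add: d_def)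
    qed
  qed
  then show ?thesis using lim by (rule Lim_null_comparison)
qed

text \<open>Comes from \<open>(1 - q^k) / (k (1 - q)) = h k / h 1\<close> with
  \<open>h k = (exp (\<i> t k) - 1) / (\<i> t k)\<close>: the expansion at \<open>k\<close> minus
  the expansion at 1, summed over the \<open>k\<close> that survive cancellation.\<close>

definition "quot_exponent j = of_real (- (t j)\<^sup>2 / 24 * (\<Sum>k=lam j 1 + 1..n j. (real k)\<^sup>2 - 1)) +
    \<i> * of_real (t j / 2 * (\<Sum>k=lam j 1 + 1..n j. real k - 1))"

text \<open>The shift is by 1 because the factor of the fixed points belongs to an identity
  permutation, for which \<open>d = 1\<close>.\<close>

definition "short_exponent j = of_real (\<kappa> / 2 * (s j)\<^sup>2 * dev2 (lam j 1) 1) - \<i> * of_real (\<theta>1 * s j * dev1 (lam j 1) 1)"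

lemma norm_exp_quot_exponent: "norm (exp (quot_exponent j)) \<le> 1"
proof -
  have "0 \<le> (\<Sum>k=lam j 1 + 1..n j. (real k)\<^sup>2 - 1)" by (intro sum_nonneg) (auto simp: one_le_power)
  then show ?thesis by (simp add: quot_exponent_def)
qed

lemma norm_exp_short_exponent: "norm (exp (short_exponent j)) \<le> exp \<bar>\<kappa>\<bar>"
  using s_sq_dev2_le[OF lam1_le n_pos, of j] by (simp add: short_exponent_def)

definition "short_cycles j = (\<Prod>k=1..lam j 1. (1 - z * q j ^ k / q j) / (1 - z))"

lemma short_cycles_lim: "(\<lambda>j. short_cycles j - exp (short_exponent j)) \<longlonglongrightarrow> 0"
proof -
  obtain C where C: "0 \<le> C" and bound: "\<And>t l d N y. l \<le> N \<Longrightarrow> d \<le> N \<Longrightarrow> \<bar>t\<bar> * real N \<le> y \<Longrightarrow> y \<le> 1 \<Longrightarrow>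
      norm ((\<Prod>k=1..l. 1 - of_real w * (exp (\<i> * of_real (t * (real k - real d))) - 1)) -
        exp (of_real (w * (1 + w) / 2 * t\<^sup>2 * dev2 l d) - \<i> * of_real (w * t * dev1 l d)))
      \<le> exp (w * (1 + w) / 2 * t\<^sup>2 * dev2 l d) * (exp (real N * (C * y ^ 3)) - 1)"
    by (rule linear_factor_prod[of w]) blast
  have lim: "(\<lambda>j. exp \<bar>\<kappa>\<bar> * (exp (real (n j) * (C * y j ^ 3)) - 1)) \<longlonglongrightarrow> 0"
    using tendsto_mult_right_zero[OF err_lim] .
  have "\<forall>\<^sub>F j in sequentially. y j < 1" by (rule ev_y) simp
  then have "\<forall>\<^sub>F j in sequentially. norm (short_cycles j - exp (short_exponent j)) \<le> exp \<bar>\<kappa>\<bar> * (exp (real (n j) * (C * y j ^ 3)) - 1)"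
  proof eventually_elim
    case (elim j)
    have P: "short_cycles j = (\<Prod>k=1..lam j 1. 1 - of_real w * (exp (\<i> * of_real (t j * (real k - real 1))) - 1))"
      unfolding short_cycles_def times_divide_eq_right[symmetric] linear_factor q_power[of j _ 1, symmetric] by simp
    have "norm (short_cycles j - exp (short_exponent j)) \<le> exp (w * (1 + w) / 2 * (t j)\<^sup>2 * dev2 (lam j 1) 1) * (exp (real (n j) * (C * y j ^ 3)) - 1)"
      using bound[OF lam1_le n_pos eq_refl[OF t_y] less_imp_le[OF elim]] unfolding P short_exponent_def w_t_sq w_t .
    also have "\<dots> \<le> exp \<bar>\<kappa>\<bar> * (exp (real (n j) * (C * y j ^ 3)) - 1)"
      unfolding w_t_sq using s_sq_dev2_le[OF lam1_le n_pos, of j] C y_pos[of j] by (intro mult_right_mono) auto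
    finally show ?case .
  qed
  then show ?thesis using lim by (rule Lim_null_comparison)
qed

definition "x j k = \<i> * complex_of_real (t j * real k)"

text \<open>The index map \<open>m\<close> lets one limit serve both the numerators, with
  \<open>m k = k\<close>, and the denominators, with \<open>m k = 1\<close>.\<close>

definition "quot_prod j m = (\<Prod>k=lam j 1 + 1..n j. (exp (x j (m k)) - 1) / x j (m k)) *
   exp (- (\<Sum>k=lam j 1 + 1..n j. x j (m k) / 2 + (x j (m k))\<^sup>2 / 24))"

lemma quot_prod_lim:
  assumes m: "\<And>j k. k \<in> {lam j 1 + 1..n j} \<Longrightarrow> m k \<in> {1..n j}"
  shows "(\<lambda>j. quot_prod j m) \<longlonglongrightarrow> 1"
proof (rule LIM_zero_cancel)
  obtain C where C: "0 \<le> C" "\<And>x::complex. norm x \<le> 1 \<Longrightarrow> x \<noteq> 0 \<Longrightarrow>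
      norm ((exp x - 1) / x * exp (- (x / 2 + x\<^sup>2 / 24)) - 1) \<le> C * norm x ^ 3"
    using exp_quotient_approx by blast
  have "\<forall>\<^sub>F j in sequentially. y j < 1" by (rule ev_y) simp
  then have "\<forall>\<^sub>F j in sequentially. norm (quot_prod j m - 1) \<le> exp (real (n j) * (C * y j ^ 3)) - 1"
  proof eventually_elim
    case (elim j)
    have x: "norm (x j (m k)) \<le> y j" "x j (m k) \<noteq> 0" if "k \<in> {lam j 1 + 1..n j}" for k
    proof -
      have "m k \<in> {1..n j}" using m that .
      then have "\<bar>t j\<bar> * real (m k) \<le> \<bar>t j\<bar> * real (n j)" "m k \<noteq> 0" by (auto intro!: mult_left_mono)
      then show "norm (x j (m k)) \<le> y j" "x j (m k) \<noteq> 0"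
        using t_y[of j] t_ne[of j] by (auto simp: x_def norm_mult abs_mult)
    qed
    show ?case
      unfolding quot_prod_def
    proof (rule norm_prod_minus_exp_sum_le[where f = "\<lambda>x. (exp x - 1) / x" and g = "\<lambda>x. x / 2 + x\<^sup>2 / 24"])
      fix k assume k: "k \<in> {lam j 1 + 1..n j}"
      show "norm ((exp (x j (m k)) - 1) / x j (m k) * exp (- (x j (m k) / 2 + (x j (m k))\<^sup>2 / 24)) - 1) \<le> C * norm (x j (m k)) ^ 3"
        using x[OF k] elim by (intro C(2)) auto
      show "norm (x j (m k)) \<le> y j" using x[OF k] by simp
    qed (use C y_pos[of j] in auto)
  qed
  then show "(\<lambda>j. quot_prod j m - 1) \<longlonglongrightarrow> 0" using err_lim by (rule Lim_null_comparison)
qed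

lemma quot_exponent_eq: "quot_exponent j = (\<Sum>k=lam j 1 + 1..n j. x j k / 2 + (x j k)\<^sup>2 / 24) - (\<Sum>k=lam j 1 + 1..n j. x j 1 / 2 + (x j 1)\<^sup>2 / 24)"
proof -
  have *: "(x j k / 2 + (x j k)\<^sup>2 / 24) - (x j 1 / 2 + (x j 1)\<^sup>2 / 24) =
    of_real (- (t j)\<^sup>2 / 24 * ((real k)\<^sup>2 - 1)) + \<i> * of_real (t j / 2 * (real k - 1))" for k
    by (simp add: x_def power_mult_distrib field_simps)
  show ?thesis
    unfolding sum_subtractf[symmetric] * quot_exponent_def sum_distrib_left of_real_sum by (rule sum.distrib[symmetric])
qed

lemma avg_eq:
  assumes q: "q j \<noteq> 1" "\<forall>k\<in>{1..n j}. q j ^ k \<noteq> 1"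
  shows "avg j (\<lambda>\<pi>. q j ^ maj (n j) \<pi> * (\<Prod>k=1..n j. (1 - z * q j ^ k / q j ^ des1 (n j) \<pi>) / (1 - z)))
    = exp (quot_exponent j) * (quot_prod j (\<lambda>k. k) / quot_prod j (\<lambda>_. 1) * long_cycles (n j) (lam j) z (q j) * short_cycles j)"
proof -
  define l where "l = lam j 1"
  define a where "a k = (1 - q j ^ k) / (of_nat k * (1 - q j))" for k
  define b where "b k = of_nat k * (1 - q j) / (1 - q j ^ k)" for k
  define h where "h k = (exp (x j k) - 1) / x j k" for k
  have l: "l \<le> n j" unfolding l_def by (rule lam1_le)
  have exp_x: "exp (x j k) = q j ^ k" for k
    unfolding q_def exp_of_nat_mult[symmetric] x_def by (simp add: mult_ac)
  have x0: "x j k \<noteq> 0" if "k \<noteq> 0" for k using that t_ne[of j] by (simp add: x_def)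
  \<comment> \<open>The factor \<open>k\<close> in the denominator of \<open>a k\<close> comes from
    \<open>x j k = k * x j 1\<close>.\<close>
  have a_h: "a k = h k / h 1" if "k \<in> {l + 1..n j}" for k
  proof -
    have hk: "h k = (q j ^ k - 1) / (of_nat k * x j 1)" unfolding h_def exp_x by (simp add: x_def)
    have h1: "h 1 = (q j - 1) / x j 1" unfolding h_def exp_x by simp
    have "h k / h 1 = (q j ^ k - 1) / (of_nat k * (q j - 1))"
      unfolding hk h1 using x0[of 1] that q(1) by simp
    also have "\<dots> = a k" unfolding a_def by (metis minus_diff_eq mult_minus_right minus_divide_divide)
    finally show ?thesis ..
  qed
  have "(\<Prod>k=1..n j. a k) * (\<Prod>k=1..l. b k) = (\<Prod>k=l + 1..n j. a k) * (\<Prod>k=1..l. a k * b k)"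
  proof -
    have "{1..n j} = {1..l} \<union> {l + 1..n j}" using l by auto
    then have "(\<Prod>k=1..n j. a k) = (\<Prod>k=1..l. a k) * (\<Prod>k=l + 1..n j. a k)"
      by (simp only:) (rule prod.union_disjoint; auto)
    then show ?thesis by (simp add: prod.distrib)
  qed
  also have "(\<Prod>k=1..l. a k * b k) = 1"
    using q l by (intro prod.neutral) (auto simp: a_def b_def)
  also have "(\<Prod>k=l + 1..n j. a k) = (\<Prod>k=l + 1..n j. h k) / (\<Prod>k=l + 1..n j. h 1)"
    unfolding prod_dividef[symmetric] using a_h by (intro prod.cong refl)
  also have "\<dots> = exp (quot_exponent j) * (quot_prod j (\<lambda>k. k) / quot_prod j (\<lambda>_. 1))"
    unfolding quot_exponent_eq exp_diff quot_prod_def exp_minus l_def h_def by (simp add: field_simps)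
  finally have ab: "(\<Prod>k=1..n j. a k) * (\<Prod>k=1..l. b k) = exp (quot_exponent j) * (quot_prod j (\<lambda>k. k) / quot_prod j (\<lambda>_. 1))" by simp
  have "q j \<noteq> 0" by (simp add: q_def)
  from average_des_maj[OF n_pos part this q(2) z_ne_1]
  have "avg j (\<lambda>\<pi>. q j ^ maj (n j) \<pi> * (\<Prod>k=1..n j. (1 - z * q j ^ k / q j ^ des1 (n j) \<pi>) / (1 - z)))
     = (\<Prod>k=1..n j. a k) * short_cycles j * (\<Prod>k=1..l. b k) * long_cycles (n j) (lam j) z (q j)"
    unfolding avg_def a_def b_def l_def short_cycles_def .
  also have "\<dots> = ((\<Prod>k=1..n j. a k) * (\<Prod>k=1..l. b k)) * (long_cycles (n j) (lam j) z (q j) * short_cycles j)"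
    by (simp only: mult_ac)
  finally show ?thesis unfolding ab by (simp only: mult.assoc)
qed

text \<open>The phases may grow with \<open>j\<close>, so neither side need converge and only the
  difference is controlled. Writing the factors as \<open>D + 1\<close> and
  \<open>E + exp (short_exponent j)\<close> leaves terms that contain \<open>D\<close> or
  \<open>E\<close>, both tending to 0, times bounded exponentials.\<close>

theorem avg_gauss_term_lim: "(\<lambda>j. avg j (gauss_term j) - exp (quot_exponent j + short_exponent j)) \<longlonglongrightarrow> 0"
proof -
  define D where "D j = quot_prod j (\<lambda>k. k) / quot_prod j (\<lambda>_. 1) * long_cycles (n j) (lam j) z (q j) - 1" for j
  define E where "E j = short_cycles j - exp (short_exponent j)" for j
  have "D \<longlonglongrightarrow> 1 / 1 * 1 - 1"
    unfolding D_def[abs_def] by (intro tendsto_intros quot_prod_lim long_cycles_lim) auto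
  then have D: "D \<longlonglongrightarrow> 0" by simp
  have E: "E \<longlonglongrightarrow> 0" unfolding E_def by (rule short_cycles_lim)
  have DR: "(\<lambda>j. D j * exp (short_exponent j)) \<longlonglongrightarrow> 0"
  proof (rule Lim_null_comparison)
    show "\<forall>\<^sub>F j in sequentially. norm (D j * exp (short_exponent j)) \<le> norm (D j) * exp \<bar>\<kappa>\<bar>"
      using norm_exp_short_exponent by (intro always_eventually allI) (simp add: norm_mult mult_left_mono)
    show "(\<lambda>j. norm (D j) * exp \<bar>\<kappa>\<bar>) \<longlonglongrightarrow> 0"
      using tendsto_mult_left_zero[OF tendsto_norm_zero[OF D]] .
  qed
  have sum: "(\<lambda>j. D j * E j + D j * exp (short_exponent j) + E j) \<longlonglongrightarrow> 0"
    using tendsto_add[OF tendsto_add[OF tendsto_mult_zero[OF D E] DR] E] by simp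
  have "(\<lambda>j. exp (quot_exponent j) * (D j * E j + D j * exp (short_exponent j) + E j)) \<longlonglongrightarrow> 0"
  proof (rule Lim_null_comparison[OF _ tendsto_norm_zero[OF sum]], intro always_eventually allI)
    fix j
    have "norm (exp (quot_exponent j)) * norm (D j * E j + D j * exp (short_exponent j) + E j) \<le> 1 * norm (D j * E j + D j * exp (short_exponent j) + E j)"
      using norm_exp_quot_exponent by (rule mult_right_mono) simp
    then show "norm (exp (quot_exponent j) * (D j * E j + D j * exp (short_exponent j) + E j)) \<le> norm (D j * E j + D j * exp (short_exponent j) + E j)"
      unfolding norm_mult by simp
  qed
  moreover have "\<forall>\<^sub>F j in sequentially. avg j (\<lambda>\<pi>. q j ^ maj (n j) \<pi> * (\<Prod>k=1..n j. (1 - z * q j ^ k / q j ^ des1 (n j) \<pi>) / (1 - z))) - exp (quot_exponent j + short_exponent j)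
      = exp (quot_exponent j) * (D j * E j + D j * exp (short_exponent j) + E j)"
    using ev_q
  proof eventually_elim
    case (elim j)
    then have q: "q j \<noteq> 1" "\<forall>k\<in>{1..n j}. q j ^ k \<noteq> 1" by blast+
    have "exp (quot_exponent j) * ((D j + 1) * (E j + exp (short_exponent j))) - exp (quot_exponent j + short_exponent j) = exp (quot_exponent j) * (D j * E j + D j * exp (short_exponent j) + E j)"
      by (simp add: exp_add algebra_simps)
    then show ?case unfolding avg_eq[OF q] by (simp add: D_def E_def)
  qed
  ultimately have "(\<lambda>j. avg j (\<lambda>\<pi>. q j ^ maj (n j) \<pi> * (\<Prod>k=1..n j. (1 - z * q j ^ k / q j ^ des1 (n j) \<pi>) / (1 - z))) - exp (quot_exponent j + short_exponent j)) \<longlonglongrightarrow> 0"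
    by (simp only: tendsto_cong)
  from tendsto_diff[OF this avg_gauss_term_diff_lim] show ?thesis by simp
qed

end

section \<open>Law of large numbers and characteristic functions\<close>


lemma sum_nat_real: "(\<Sum>k=1..l. real k) = real l * (real l + 1) / 2"
  by (induction l) (auto simp: field_simps)

lemma sum_sq_real: "(\<Sum>k=1..l. (real k)\<^sup>2) = real l * (real l + 1) * (2 * real l + 1) / 6"
  by (induction l) (auto simp: field_simps power2_eq_square)

lemma dev1_eq: "dev1 l d = real l * (real l + 1) / 2 - real l * real d"
  unfolding dev1_def sum_subtractf sum_nat_real by simp

lemma dev2_eq: "dev2 l d = real l * (real l + 1) * (2 * real l + 1) / 6 - real d * real l * (real l + 1) + real l * (real d)\<^sup>2"
proof -
  have "dev2 l d = (\<Sum>k=1..l. (real k)\<^sup>2 - 2 * real d * real k + (real d)\<^sup>2)"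
    unfolding dev2_def by (intro sum.cong refl) (simp add: power2_eq_square algebra_simps)
  also have "\<dots> = (\<Sum>k=1..l. (real k)\<^sup>2) - 2 * real d * (\<Sum>k=1..l. real k) + real l * (real d)\<^sup>2"
    by (simp add: sum.distrib sum_subtractf sum_distrib_left)
  finally show ?thesis unfolding sum_nat_real sum_sq_real by (simp add: mult_ac)
qed

lemma sum_above:
  fixes f :: "nat \<Rightarrow> real"
  assumes "l \<le> n"
  shows "(\<Sum>k=l + 1..n. f k) = (\<Sum>k=1..n. f k) - (\<Sum>k=1..l. f k)"
proof -
  have "{1..n} = {1..l} \<union> {l + 1..n}" using assms by auto
  then have "(\<Sum>k=1..n. f k) = (\<Sum>k=1..l. f k) + (\<Sum>k=l + 1..n. f k)"
    by (simp only:) (rule sum.union_disjoint; auto)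
  then show ?thesis by simp
qed

text \<open>Lets averaged cosines control averaged squares; the fourth-order remainder is at most
  \<open>y^2 / 24\<close> on this range.\<close>

lemma one_minus_cos_ge:
  fixes y :: real
  assumes "\<bar>y\<bar> \<le> 1"
  shows "y\<^sup>2 \<le> 4 * (1 - cos y)"
proof -
  have "\<bar>Re (iexp y - (\<Sum>k \<le> 3. (\<i> * y)^k / fact k))\<bar> \<le> \<bar>y\<bar>^(Suc 3) / fact (Suc 3)"
    using abs_Re_le_cmod iexp_approx1 by (rule order.trans)
  moreover have "Re (iexp y - (\<Sum>k \<le> 3. (\<i> * y)^k / fact k)) = cos y - 1 + y\<^sup>2 / 2"
    by (simp add: numeral_3_eq_3 power2_eq_square exp_Euler cos_of_real sin_of_real)
  moreover have "\<bar>y\<bar>^(Suc 3) / fact (Suc 3) \<le> y\<^sup>2 / 24"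
  proof -
    have "\<bar>y\<bar> ^ 4 \<le> \<bar>y\<bar> ^ 2" using assms by (intro power_decreasing) auto
    then show ?thesis by (simp add: fact_numeral eval_nat_numeral)
  qed
  ultimately have "cos y - 1 + y\<^sup>2 / 2 \<le> y\<^sup>2 / 24" by linarith
  then have "11 * y\<^sup>2 + (cos y * 24 - 24) \<le> 0" by simp
  moreover have "0 \<le> y\<^sup>2" by simp
  ultimately show ?thesis unfolding right_diff_distrib by linarith
qed

lemma maj_le: "maj n \<pi> \<le> n * n"
proof -
  have "maj n \<pi> \<le> (\<Sum>i\<in>descents n \<pi>. n)"
    unfolding maj_def by (intro sum_mono) (auto simp: descents_def)
  also have "\<dots> = card (descents n \<pi>) * n" by simp
  also have "\<dots> \<le> n * n"
  proof (rule mult_le_mono1)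
    have "card (descents n \<pi>) \<le> card {1..<n}" unfolding descents_def by (intro card_mono) auto
    then show "card (descents n \<pi>) \<le> n" by simp
  qed
  finally show ?thesis .
qed

lemma norm_exp_add_i_diff:
  fixes r u :: real
  shows "norm (exp (of_real r + \<i> * of_real u) - exp (\<i> * of_real u)) = \<bar>exp r - 1\<bar>"
proof -
  have "exp (of_real r + \<i> * of_real u) - exp (\<i> * of_real u) = of_real (exp r - 1) * exp (\<i> * of_real u)"
    by (simp add: exp_add algebra_simps exp_of_real)
  then show ?thesis by (simp only: norm_mult norm_exp_i_times norm_of_real mult_1_right)
qed

lemma abs_exp_minus_1_le:
  fixes r :: real
  assumes "\<bar>r\<bar> \<le> b"
  shows "\<bar>exp r - 1\<bar> \<le> exp b - 1"
proof (cases "0 \<le> r")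
  case False
  have "1 - exp r \<le> - r" using exp_ge_add_one_self[of r] by linarith
  moreover have "1 + b \<le> exp b" by (rule exp_ge_add_one_self)
  moreover have "exp r \<le> 1" using False by simp
  ultimately show ?thesis using False assms by linarith
qed (use assms in auto)

text \<open>The inequality of arithmetic and geometric means, used in place of Cauchy-Schwarz to
  pass from mean squares to mean absolute values.\<close>

lemma abs_le_square_divide:
  fixes d e :: real
  assumes "0 < e"
  shows "\<bar>d\<bar> \<le> e / 4 + 1 / e * d\<^sup>2"
proof -
  have "0 \<le> (2 * \<bar>d\<bar> - e)\<^sup>2 / (4 * e)" using assms by simp
  also have "\<dots> = e / 4 + 1 / e * d\<^sup>2 - \<bar>d\<bar>"
    using assms by (simp add: power2_diff power_mult_distrib field_simps) (simp add: power2_eq_square)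
  finally show ?thesis by simp
qed

lemma abs_exp_diff_le:
  fixes a b M :: real
  assumes "a \<le> M" "b \<le> M"
  shows "\<bar>exp a - exp b\<bar> \<le> exp M * \<bar>a - b\<bar>"
proof -
  have "norm (exp a - exp b) \<le> exp M * norm (a - b)"
  proof (rule field_differentiable_bound[where S = "{..M}" and f' = exp])
    show "(exp has_field_derivative exp z) (at z within {..M})" for z :: real
      by (rule has_field_derivative_at_within) (rule DERIV_exp)
  qed (use assms in auto)
  then show ?thesis by simp
qed

section \<open>Real averages and concentration\<close>

context class_sequence
begin

definition ravg :: "nat \<Rightarrow> ((nat \<Rightarrow> nat) \<Rightarrow> real) \<Rightarrow> real" where
  "ravg j f = (\<Sum>\<pi>\<in>cls j. f \<pi>) / real (card (cls j))"

lemma ravg_mono: "(\<And>\<pi>. \<pi> \<in> cls j \<Longrightarrow> f \<pi> \<le> g \<pi>) \<Longrightarrow> ravg j f \<le> ravg j g"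
  unfolding ravg_def by (intro divide_right_mono sum_mono) auto

lemma ravg_const: "ravg j (\<lambda>_. c) = c"
  using card_cls[of j] by (simp add: ravg_def)

lemma ravg_nonneg: "(\<And>\<pi>. 0 \<le> f \<pi>) \<Longrightarrow> 0 \<le> ravg j f"
  unfolding ravg_def by (intro divide_nonneg_nonneg sum_nonneg) auto

lemma ravg_add: "ravg j (\<lambda>\<pi>. f \<pi> + g \<pi>) = ravg j f + ravg j g"
  by (simp add: ravg_def sum.distrib add_divide_distrib)

lemma ravg_cmult: "ravg j (\<lambda>\<pi>. c * f \<pi>) = c * ravg j f"
  by (simp add: ravg_def sum_distrib_left)

lemma Re_avg: "Re (avg j f) = ravg j (\<lambda>\<pi>. Re (f \<pi>))"
proof -
  have "avg j f = (\<Sum>\<pi>\<in>cls j. f \<pi>) / of_real (real (card (cls j)))" by (simp add: avg_def)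
  then show ?thesis by (simp only: Re_divide_of_real Re_sum ravg_def)
qed

lemma norm_avg_le_ravg: "norm (avg j f) \<le> ravg j (\<lambda>\<pi>. norm (f \<pi>))"
  unfolding avg_def ravg_def norm_divide norm_of_nat by (intro divide_right_mono norm_sum) auto

end

context scaled_class_sequence
begin

text \<open>The random phase of a summand. Below, \<open>ctr\<close> and \<open>re_part\<close> are
  the phase and the real exponent on the deterministic side.\<close>

definition "cent j \<pi> = s j * (\<theta>2 * real (maj (n j) \<pi>) - \<theta>1 * dev1 (n j) (des1 (n j) \<pi>))"

definition "ctr j = t j / 2 * (\<Sum>k=lam j 1 + 1..n j. real k - 1) - \<theta>1 * s j * dev1 (lam j 1) 1"

definition "re_part j = - (t j)\<^sup>2 / 24 * (\<Sum>k=lam j 1 + 1..n j. (real k)\<^sup>2 - 1) + \<kappa> / 2 * (s j)\<^sup>2 * dev2 (lam j 1) 1"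

lemma exponent_eq: "quot_exponent j + short_exponent j = of_real (re_part j) + \<i> * of_real (ctr j)"
  by (simp add: quot_exponent_def short_exponent_def re_part_def ctr_def algebra_simps)

lemma gauss_term_cent: "gauss_term j \<pi> = exp (of_real (\<kappa> / 2 * (s j)\<^sup>2 * dev2 (n j) (des1 (n j) \<pi>)) + \<i> * of_real (cent j \<pi>))"
  by (simp add: gauss_term_def cent_def)

context
  assumes s_tiny: "(\<lambda>j. (s j)\<^sup>2 * real (n j) ^ 3) \<longlonglongrightarrow> 0"
begin

text \<open>When \<open>s^2 * n^3\<close> vanishes, all real exponents vanish uniformly. The average
  of the unit numbers \<open>exp (\<i> cent)\<close> then approaches a single unit number, which
  forces the phases to concentrate there.\<close>

lemma avg_cos_lim: "(\<lambda>j. ravg j (\<lambda>\<pi>. cos (cent j \<pi> - ctr j))) \<longlonglongrightarrow> 1"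
proof -
  define \<rho> where "\<rho> j = (\<theta>2\<^sup>2 + \<bar>\<kappa>\<bar>) * ((s j)\<^sup>2 * real (n j) ^ 3)" for j
  have "\<rho> \<longlonglongrightarrow> 0" unfolding \<rho>_def using tendsto_mult_right_zero[OF s_tiny] .
  then have \<rho>: "(\<lambda>j. exp (\<rho> j) - 1) \<longlonglongrightarrow> 0" by (rule exp_sub_one_tendsto_0)
  have dev: "\<bar>\<kappa> / 2 * (s j)\<^sup>2 * dev2 l d\<bar> \<le> \<bar>\<kappa>\<bar> * ((s j)\<^sup>2 * real (n j) ^ 3)" if "l \<le> n j" "d \<le> n j" for j l d
  proof -
    have "\<bar>\<kappa> / 2 * (s j)\<^sup>2 * dev2 l d\<bar> = \<bar>\<kappa>\<bar> / 2 * ((s j)\<^sup>2 * dev2 l d)"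
      using dev2_bounds(1)[OF that] by (simp add: abs_mult)
    also have "\<dots> \<le> \<bar>\<kappa>\<bar> * ((s j)\<^sup>2 * real (n j) ^ 3)"
      using dev2_bounds[OF that] by (intro mult_mono) (auto intro!: mult_left_mono)
    finally show ?thesis .
  qed
  have rp: "\<bar>re_part j\<bar> \<le> \<rho> j" for j
  proof -
    have nn: "0 \<le> (\<Sum>k=lam j 1 + 1..n j. (real k)\<^sup>2 - 1)" by (intro sum_nonneg) (auto simp: one_le_power)
    have "(\<Sum>k=lam j 1 + 1..n j. (real k)\<^sup>2 - 1) \<le> (\<Sum>k=lam j 1 + 1..n j. (real (n j))\<^sup>2)"
    proof (rule sum_mono)
      fix k assume "k \<in> {lam j 1 + 1..n j}"
      then have "(real k)\<^sup>2 \<le> (real (n j))\<^sup>2" by (intro power_mono) auto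
      then show "(real k)\<^sup>2 - 1 \<le> (real (n j))\<^sup>2" by linarith
    qed
    also have "\<dots> \<le> real (n j) * (real (n j))\<^sup>2" by (simp add: mult_right_mono)
    finally have "(\<Sum>k=lam j 1 + 1..n j. (real k)\<^sup>2 - 1) \<le> real (n j) ^ 3" by (simp add: power2_eq_square power3_eq_cube)
    then have "(t j)\<^sup>2 / 24 * (\<Sum>k=lam j 1 + 1..n j. (real k)\<^sup>2 - 1) \<le> (t j)\<^sup>2 * real (n j) ^ 3"
      using nn by (intro mult_mono) auto
    then have "\<bar>- (t j)\<^sup>2 / 24 * (\<Sum>k=lam j 1 + 1..n j. (real k)\<^sup>2 - 1)\<bar> \<le> \<theta>2\<^sup>2 * ((s j)\<^sup>2 * real (n j) ^ 3)"
      using nn by (simp add: abs_mult t_def power_mult_distrib mult_ac)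
    then show ?thesis
      using dev[OF lam1_le n_pos, of j] unfolding re_part_def \<rho>_def distrib_right by linarith
  qed
  have "(\<lambda>j. avg j (\<lambda>\<pi>. exp (\<i> * of_real (cent j \<pi>))) - avg j (gauss_term j)) \<longlonglongrightarrow> 0"
  proof (rule Lim_null_comparison[OF _ \<rho>], intro always_eventually allI)
    fix j
    show "norm (avg j (\<lambda>\<pi>. exp (\<i> * of_real (cent j \<pi>))) - avg j (gauss_term j)) \<le> exp (\<rho> j) - 1"
      unfolding avg_diff
    proof (rule norm_avg_le)
      fix \<pi>
      let ?r = "\<kappa> / 2 * (s j)\<^sup>2 * dev2 (n j) (des1 (n j) \<pi>)"
      have "\<bar>?r\<bar> \<le> \<bar>\<kappa>\<bar> * ((s j)\<^sup>2 * real (n j) ^ 3)" by (rule dev[OF order.refl des1_le[OF n_pos]])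
      also have "\<dots> \<le> \<rho> j" by (simp add: \<rho>_def distrib_right)
      finally have "\<bar>exp ?r - 1\<bar> \<le> exp (\<rho> j) - 1" by (rule abs_exp_minus_1_le)
      then show "norm (exp (\<i> * of_real (cent j \<pi>)) - gauss_term j \<pi>) \<le> exp (\<rho> j) - 1"
        unfolding gauss_term_cent norm_minus_commute[of "exp (\<i> * _)"] norm_exp_add_i_diff .
    qed
  qed
  moreover have "(\<lambda>j. exp (quot_exponent j + short_exponent j) - exp (\<i> * of_real (ctr j))) \<longlonglongrightarrow> 0"
  proof (rule Lim_null_comparison[OF _ \<rho>], intro always_eventually allI)
    fix j
    show "norm (exp (quot_exponent j + short_exponent j) - exp (\<i> * of_real (ctr j))) \<le> exp (\<rho> j) - 1"
      unfolding exponent_eq norm_exp_add_i_diff by (rule abs_exp_minus_1_le[OF rp])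
  qed
  ultimately have "(\<lambda>j. (avg j (\<lambda>\<pi>. exp (\<i> * of_real (cent j \<pi>))) - avg j (gauss_term j)) + (avg j (gauss_term j) - exp (quot_exponent j + short_exponent j))
      + (exp (quot_exponent j + short_exponent j) - exp (\<i> * of_real (ctr j)))) \<longlonglongrightarrow> 0 + 0 + 0"
    by (intro tendsto_add avg_gauss_term_lim)
  then have L: "(\<lambda>j. avg j (\<lambda>\<pi>. exp (\<i> * of_real (cent j \<pi>))) - exp (\<i> * of_real (ctr j))) \<longlonglongrightarrow> 0" by simp
  have "(\<lambda>j. avg j (\<lambda>\<pi>. exp (\<i> * of_real (cent j \<pi> - ctr j))) - 1) \<longlonglongrightarrow> 0"
  proof (rule Lim_null_comparison[OF _ tendsto_norm_zero[OF L]], intro always_eventually allI)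
    fix j
    have e: "exp (\<i> * of_real (cent j \<pi> - ctr j)) = exp (\<i> * of_real (- ctr j)) * exp (\<i> * of_real (cent j \<pi>))" for \<pi>
      by (simp add: exp_add[symmetric] algebra_simps)
    have "exp (\<i> * of_real (- ctr j)) * exp (\<i> * of_real (ctr j)) = 1" by (simp add: exp_add[symmetric])
    then have "avg j (\<lambda>\<pi>. exp (\<i> * of_real (cent j \<pi> - ctr j))) - 1
      = exp (\<i> * of_real (- ctr j)) * (avg j (\<lambda>\<pi>. exp (\<i> * of_real (cent j \<pi>))) - exp (\<i> * of_real (ctr j)))"
      unfolding e avg_cmult[symmetric] by (simp add: algebra_simps)
    then show "norm (avg j (\<lambda>\<pi>. exp (\<i> * of_real (cent j \<pi> - ctr j))) - 1)
      \<le> norm (avg j (\<lambda>\<pi>. exp (\<i> * of_real (cent j \<pi>))) - exp (\<i> * of_real (ctr j)))"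
      by (simp only: norm_mult norm_exp_i_times mult_1)
  qed
  then have "(\<lambda>j. avg j (\<lambda>\<pi>. exp (\<i> * of_real (cent j \<pi> - ctr j)))) \<longlonglongrightarrow> 1" by (simp add: LIM_zero_iff)
  from tendsto_Re[OF this] show ?thesis
    by (simp only: Re_avg Re_exp one_complex.sel) (simp add: Re_exp)
qed

lemma avg_sq_lim:
  assumes "\<And>j \<pi>. \<bar>cent j \<pi> - ctr j\<bar> \<le> 1"
  shows "(\<lambda>j. ravg j (\<lambda>\<pi>. (cent j \<pi> - ctr j)\<^sup>2)) \<longlonglongrightarrow> 0"
proof -
  have lim: "(\<lambda>j. 4 * (1 - ravg j (\<lambda>\<pi>. cos (cent j \<pi> - ctr j)))) \<longlonglongrightarrow> 4 * (1 - 1)"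
    by (intro tendsto_intros avg_cos_lim)
  show ?thesis
  proof (rule Lim_null_comparison)
    show "(\<lambda>j. 4 * (1 - ravg j (\<lambda>\<pi>. cos (cent j \<pi> - ctr j)))) \<longlonglongrightarrow> 0" using lim by simp
    show "\<forall>\<^sub>F j in sequentially. norm (ravg j (\<lambda>\<pi>. (cent j \<pi> - ctr j)\<^sup>2)) \<le> 4 * (1 - ravg j (\<lambda>\<pi>. cos (cent j \<pi> - ctr j)))"
    proof (intro always_eventually allI)
      fix j
      have "ravg j (\<lambda>\<pi>. (cent j \<pi> - ctr j)\<^sup>2) \<le> ravg j (\<lambda>\<pi>. 4 + (-4) * cos (cent j \<pi> - ctr j))"
        using one_minus_cos_ge[OF assms] by (intro ravg_mono) (simp add: algebra_simps)
      also have "\<dots> = 4 * (1 - ravg j (\<lambda>\<pi>. cos (cent j \<pi> - ctr j)))"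
        unfolding ravg_add ravg_cmult ravg_const by simp
      finally show "norm (ravg j (\<lambda>\<pi>. (cent j \<pi> - ctr j)\<^sup>2)) \<le> 4 * (1 - ravg j (\<lambda>\<pi>. cos (cent j \<pi> - ctr j)))"
        using ravg_nonneg[of "\<lambda>\<pi>. (cent j \<pi> - ctr j)\<^sup>2" j] by simp
    qed
  qed
qed

end

end

section \<open>The law of large numbers for descents\<close>

context class_sequence
begin

text \<open>The value of \<open>d / n\<close> at which the difference of the two phase deviations
  formed in the next proof is zero.\<close>

definition "des_mean j = (real (n j) + 1) / (2 * real (n j)) - real (lam j 1) * (real (lam j 1) - 1) / (2 * (real (n j))\<^sup>2)"

text \<open>The frequencies \<open>(1, 0)\<close> are not admissible, so \<open>d\<close> is
  isolated by subtraction: \<open>(0, 1)\<close> concentrates \<open>maj\<close>,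
  \<open>(1, 1)\<close> concentrates \<open>maj\<close> together with \<open>d\<close>.\<close>

lemma des_variance_lim: "(\<lambda>j. ravg j (\<lambda>\<pi>. (real (des1 (n j) \<pi>) / real (n j) - des_mean j)\<^sup>2)) \<longlonglongrightarrow> 0"
proof -
  \<comment> \<open>The factor 1/4 keeps both phase deviations within 1, where squares are bounded
    by cosines: the pieces add up to at most 7/8.\<close>
  define s where "s j = 1 / (4 * (real (n j))\<^sup>2)" for j
  have n0: "0 < real (n j)" for j using n_pos[of j] by simp
  have s_cube: "(s j)\<^sup>2 * real (n j) ^ 3 = 1 / 16 * (1 / real (n j))" for j
    using n0[of j] by (simp add: s_def power2_eq_square power3_eq_cube field_simps)
  have s_small: "(s j)\<^sup>2 * real (n j) ^ 3 \<le> 1" for j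
    unfolding s_cube using n_pos[of j] by (simp add: divide_le_eq)
  have s_pos: "0 < s j" for j using n0[of j] by (simp add: s_def)
  have s_tiny: "(\<lambda>j. (s j)\<^sup>2 * real (n j) ^ 3) \<longlonglongrightarrow> 0"
    unfolding s_cube using tendsto_mult_right_zero[OF inverse_n_lim] .
  interpret A: scaled_class_sequence n lam 0 1 s
    by unfold_locales (auto simp: s_pos s_small)
  interpret B: scaled_class_sequence n lam 1 1 s
    by unfold_locales (auto simp: s_pos s_small)
  have bounds: "\<bar>s j * dev1 (n j) (des1 (n j) \<pi>)\<bar> \<le> 1/4" "\<bar>s j * real (maj (n j) \<pi>)\<bar> \<le> 1/4"
    "\<bar>s j / 2 * (\<Sum>k=lam j 1 + 1..n j. real k - 1)\<bar> \<le> 1/8" "\<bar>s j * dev1 (lam j 1) 1\<bar> \<le> 1/4" for j \<pi>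
  proof -
    have sn: "s j * (real (n j) * real (n j)) = 1/4" using n0[of j] by (simp add: s_def power2_eq_square)
    have scale: "\<bar>s j * u\<bar> \<le> 1/4" if "\<bar>u\<bar> \<le> real (n j) * real (n j)" for u
      using mult_left_mono[OF that, of "s j"] s_pos[of j] sn by (simp add: abs_mult)
    have dev: "\<bar>dev1 l d\<bar> \<le> real (n j) * real (n j)" if "l \<le> n j" "d \<le> n j" for l d
    proof -
      have "\<bar>dev1 l d\<bar> \<le> (\<Sum>k=1..l. \<bar>real k - real d\<bar>)" unfolding dev1_def by (rule sum_abs)
      also have "\<dots> \<le> (\<Sum>k=1..l. real (n j))" using that by (intro sum_mono) auto
      also have "\<dots> \<le> real (n j) * real (n j)" using that by (simp add: mult_right_mono)
      finally show ?thesis .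
    qed
    show "\<bar>s j * dev1 (n j) (des1 (n j) \<pi>)\<bar> \<le> 1/4" "\<bar>s j * dev1 (lam j 1) 1\<bar> \<le> 1/4"
      using scale[OF dev[OF order.refl des1_le[OF n_pos]]] scale[OF dev[OF lam1_le n_pos]] .
    have "real (maj (n j) \<pi>) \<le> real (n j * n j)" using maj_le by (simp only: of_nat_le_iff)
    then show "\<bar>s j * real (maj (n j) \<pi>)\<bar> \<le> 1/4" by (intro scale) simp
    have "\<bar>\<Sum>k=lam j 1 + 1..n j. real k - 1\<bar> \<le> (\<Sum>k=lam j 1 + 1..n j. \<bar>real k - 1\<bar>)" by (rule sum_abs)
    also have "\<dots> \<le> (\<Sum>k=lam j 1 + 1..n j. real (n j))" by (intro sum_mono) auto
    also have "\<dots> \<le> real (n j) * real (n j)" by (simp add: mult_right_mono)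
    finally show "\<bar>s j / 2 * (\<Sum>k=lam j 1 + 1..n j. real k - 1)\<bar> \<le> 1/8"
      using scale[of "\<Sum>k=lam j 1 + 1..n j. real k - 1"] by (simp add: abs_mult)
  qed
  have A: "A.cent j \<pi> - A.ctr j = s j * real (maj (n j) \<pi>) - s j / 2 * (\<Sum>k=lam j 1 + 1..n j. real k - 1)" for j \<pi>
    by (simp add: A.cent_def A.ctr_def A.t_def)
  have B: "B.cent j \<pi> - B.ctr j = A.cent j \<pi> - A.ctr j - s j * dev1 (n j) (des1 (n j) \<pi>) + s j * dev1 (lam j 1) 1" for j \<pi>
    by (simp add: A.cent_def A.ctr_def A.t_def B.cent_def B.ctr_def B.t_def algebra_simps)
  have A1: "\<bar>A.cent j \<pi> - A.ctr j\<bar> \<le> 1" "\<bar>B.cent j \<pi> - B.ctr j\<bar> \<le> 1" for j \<pi>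
    using bounds(1)[of j \<pi>] bounds(2)[of j \<pi>] bounds(3)[of j] bounds(4)[of j] unfolding B A by linarith+
  have lim: "(\<lambda>j. 32 * ravg j (\<lambda>\<pi>. (A.cent j \<pi> - A.ctr j)\<^sup>2) + 32 * ravg j (\<lambda>\<pi>. (B.cent j \<pi> - B.ctr j)\<^sup>2)) \<longlonglongrightarrow> 32 * 0 + 32 * 0"
    by (intro tendsto_intros A.avg_sq_lim B.avg_sq_lim s_tiny A1)
  show ?thesis
  proof (rule Lim_null_comparison[rotated])
    show "(\<lambda>j. 32 * ravg j (\<lambda>\<pi>. (A.cent j \<pi> - A.ctr j)\<^sup>2) + 32 * ravg j (\<lambda>\<pi>. (B.cent j \<pi> - B.ctr j)\<^sup>2)) \<longlonglongrightarrow> 0"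
      using lim by simp
    show "\<forall>\<^sub>F j in sequentially. norm (ravg j (\<lambda>\<pi>. (real (des1 (n j) \<pi>) / real (n j) - des_mean j)\<^sup>2))
      \<le> 32 * ravg j (\<lambda>\<pi>. (A.cent j \<pi> - A.ctr j)\<^sup>2) + 32 * ravg j (\<lambda>\<pi>. (B.cent j \<pi> - B.ctr j)\<^sup>2)"
    proof (intro always_eventually allI)
      fix j
      have "ravg j (\<lambda>\<pi>. (real (des1 (n j) \<pi>) / real (n j) - des_mean j)\<^sup>2)
        \<le> ravg j (\<lambda>\<pi>. 32 * (A.cent j \<pi> - A.ctr j)\<^sup>2 + 32 * (B.cent j \<pi> - B.ctr j)\<^sup>2)"
      proof (rule ravg_mono)
        fix \<pi>
        let ?a = "A.cent j \<pi> - A.ctr j" and ?b = "B.cent j \<pi> - B.ctr j"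
        have "real (des1 (n j) \<pi>) / real (n j) - des_mean j = 4 * (s j * dev1 (lam j 1) 1 - s j * dev1 (n j) (des1 (n j) \<pi>))"
          using n0[of j] by (simp add: s_def dev1_eq des_mean_def power2_eq_square field_simps)
        also have "\<dots> = 4 * (?b - ?a)" unfolding B by simp
        finally have "(real (des1 (n j) \<pi>) / real (n j) - des_mean j)\<^sup>2 = 16 * (?b - ?a)\<^sup>2"
          by (simp only: power_mult_distrib) simp
        also have "\<dots> \<le> 16 * (2 * ?a\<^sup>2 + 2 * ?b\<^sup>2)"
          using zero_le_power2[of "?a + ?b"] by (simp add: power2_eq_square algebra_simps)
        finally show "(real (des1 (n j) \<pi>) / real (n j) - des_mean j)\<^sup>2 \<le> 32 * ?a\<^sup>2 + 32 * ?b\<^sup>2" by simp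
      qed
      then show "norm (ravg j (\<lambda>\<pi>. (real (des1 (n j) \<pi>) / real (n j) - des_mean j)\<^sup>2))
        \<le> 32 * ravg j (\<lambda>\<pi>. (A.cent j \<pi> - A.ctr j)\<^sup>2) + 32 * ravg j (\<lambda>\<pi>. (B.cent j \<pi> - B.ctr j)\<^sup>2)"
        using ravg_nonneg[of "\<lambda>\<pi>. (real (des1 (n j) \<pi>) / real (n j) - des_mean j)\<^sup>2" j]
        unfolding ravg_add ravg_cmult by simp
    qed
  qed
qed

lemma des_deviation_lim: "(\<lambda>j. ravg j (\<lambda>\<pi>. \<bar>real (des1 (n j) \<pi>) / real (n j) - des_mean j\<bar>)) \<longlonglongrightarrow> 0"
proof -
  let ?D = "\<lambda>j \<pi>. real (des1 (n j) \<pi>) / real (n j) - des_mean j"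
  have "\<forall>\<^sub>F j in sequentially. norm (ravg j (\<lambda>\<pi>. \<bar>?D j \<pi>\<bar>)) < e" if e: "0 < e" for e
  proof -
    have "\<forall>\<^sub>F j in sequentially. ravg j (\<lambda>\<pi>. (?D j \<pi>)\<^sup>2) < e\<^sup>2 / 4"
      using des_variance_lim by (rule order_tendstoD(2)) (use e in simp)
    then show ?thesis
    proof eventually_elim
      case (elim j)
      have "ravg j (\<lambda>\<pi>. \<bar>?D j \<pi>\<bar>) \<le> ravg j (\<lambda>\<pi>. e / 4 + 1 / e * (?D j \<pi>)\<^sup>2)"
      proof (rule ravg_mono)
        fix \<pi>
        show "\<bar>?D j \<pi>\<bar> \<le> e / 4 + 1 / e * (?D j \<pi>)\<^sup>2" by (rule abs_le_square_divide[OF e])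
      qed
      also have "\<dots> = e / 4 + 1 / e * ravg j (\<lambda>\<pi>. (?D j \<pi>)\<^sup>2)" unfolding ravg_add ravg_cmult ravg_const ..
      also have "\<dots> \<le> e / 4 + 1 / e * (e\<^sup>2 / 4)" using elim e by (intro add_left_mono mult_left_mono) auto
      also have "\<dots> < e" using e by (simp add: power2_eq_square)
      finally show ?case using ravg_nonneg[of "\<lambda>\<pi>. \<bar>?D j \<pi>\<bar>" j] by simp
    qed
  qed
  then show ?thesis by (auto simp: tendsto_iff dist_norm)
qed

end

section \<open>Limits of the characteristic functions\<close>

locale density_sequence = class_sequence +
  fixes \<alpha> :: real
  assumes density_lim: "(\<lambda>j. real (lam j 1) / real (n j)) \<longlonglongrightarrow> \<alpha>"
begin

definition "dens j = real (lam j 1) / real (n j)"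

definition "proj \<theta>1 \<theta>2 j \<pi> =
  \<theta>1 * ((real (des1 (n j) \<pi>) - (1 - (dens j)\<^sup>2) / 2 * real (n j)) / sqrt (real (n j))) +
  \<theta>2 * ((real (maj (n j) \<pi>) - (1 - (dens j)\<^sup>2) / 4 * (real (n j))\<^sup>2) / (real (n j) * sqrt (real (n j))))"

text \<open>The quadratic form of the covariance matrix; the off-diagonal entry counts twice, whence
  \<open>\<theta>1 * \<theta>2 / 12\<close>.\<close>

definition "quad_form \<theta>1 \<theta>2 = \<theta>1\<^sup>2 / 12 * (1 - 4 * \<alpha>^3 + 3 * \<alpha>^4) + \<theta>1 * \<theta>2 / 12 * (1 - 4 * \<alpha>^3 + 3 * \<alpha>^4) + \<theta>2\<^sup>2 / 36 * (1 - \<alpha>^3)"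

text \<open>The real factor is Lipschitz in \<open>d / n\<close>, so the vanishing mean deviation of
  \<open>d / n\<close> permits replacing it by a number \<open>K j\<close>, which then leaves the
  average and is divided out.\<close>

theorem char_proj_lim:
  assumes \<theta>: "\<theta>2 \<noteq> 0" "\<theta>1 + \<theta>2 \<noteq> 0"
  shows "(\<lambda>j. avg j (\<lambda>\<pi>. exp (\<i> * of_real (proj \<theta>1 \<theta>2 j \<pi>)))) \<longlonglongrightarrow> of_real (exp (- quad_form \<theta>1 \<theta>2 / 2))"
proof -
  define N where "N j = real (n j)" for j
  define e where "e j = 1 / N j" for j
  define s where "s j = 1 / (N j * sqrt (N j))" for j
  have N1: "1 \<le> N j" for j using n_pos[of j] by (simp add: N_def)
  then have N0: "0 < N j" for j using order_less_le_trans[OF zero_less_one] by blast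
  have e_lim: "e \<longlonglongrightarrow> 0" using inverse_n_lim by (simp add: e_def[abs_def] N_def[abs_def])
  have a_lim: "dens \<longlonglongrightarrow> \<alpha>" using density_lim by (simp add: dens_def[abs_def])
  have l_eq: "real (lam j 1) = dens j * N j" for j using N0[of j] by (simp add: dens_def N_def)
  have s_sq: "(s j)\<^sup>2 = 1 / N j ^ 3" for j
    using N0[of j] by (simp add: s_def power_divide power_mult_distrib power2_eq_square power3_eq_cube)
  have s_N: "s j * N j * N j = sqrt (N j)" for j
    using N0[of j] real_sqrt_mult_self[of "N j"] by (simp add: s_def field_simps)
  interpret S: scaled_class_sequence n lam \<theta>1 \<theta>2 s
    by unfold_locales (use \<theta> N0 s_sq in \<open>auto simp: s_def N_def\<close>)
  define m where "m = (1 - \<alpha>\<^sup>2) / 2"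
  have des_mean: "des_mean j = (1 + e j) / 2 - dens j * (dens j - e j) / 2" for j
    unfolding des_mean_def l_eq N_def[symmetric] e_def using N0[of j] by (simp add: field_simps power2_eq_square)
  have m_lim: "des_mean \<longlonglongrightarrow> m"
  proof -
    have "des_mean \<longlonglongrightarrow> (1 + 0) / 2 - \<alpha> * (\<alpha> - 0) / 2"
      unfolding des_mean[abs_def] by (intro tendsto_intros e_lim a_lim) auto
    then show ?thesis by (simp add: m_def power2_eq_square diff_divide_distrib)
  qed
  \<comment> \<open>The normalised second moment \<open>s^2 * dev2\<close> with \<open>d / n\<close>
    replaced by \<open>des_mean\<close>.\<close>
  define v where "v j = (1 + e j) * (2 + e j) / 6 - des_mean j * (1 + e j) + (des_mean j)\<^sup>2" for j
  have v_lim: "v \<longlonglongrightarrow> 1/3 - m + m\<^sup>2"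
  proof -
    have "v \<longlonglongrightarrow> (1 + 0) * (2 + 0) / 6 - m * (1 + 0) + m\<^sup>2"
      unfolding v_def[abs_def] by (intro tendsto_intros e_lim m_lim) auto
    then show ?thesis by simp
  qed
  define K where "K j = exp (S.\<kappa> / 2 * v j)" for j
  define \<delta> where "\<delta> j \<pi> = real (des1 (n j) \<pi>) / N j" for j \<pi>
  have dev2: "(s j)\<^sup>2 * dev2 (n j) (des1 (n j) \<pi>) = (1 + e j) * (2 + e j) / 6 - \<delta> j \<pi> * (1 + e j) + (\<delta> j \<pi>)\<^sup>2" for j \<pi>
    unfolding dev2_eq N_def[symmetric] s_sq \<delta>_def e_def using N0[of j] by (simp add: field_simps power2_eq_square power3_eq_cube)
  have e01: "0 \<le> e j" "e j \<le> 1" for j using N1[of j] N0[of j] by (simp_all add: e_def divide_le_eq)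
  have a01: "0 \<le> dens j" "dens j \<le> 1" for j using lam1_le[of j] n_pos[of j] by (simp_all add: dens_def divide_le_eq)
  have \<delta>01: "0 \<le> \<delta> j \<pi>" "\<delta> j \<pi> \<le> 1" for j \<pi>
    using des1_le[OF n_pos, of j \<pi>] N0[of j] by (simp_all add: \<delta>_def N_def divide_le_eq)
  have m_bd: "\<bar>des_mean j\<bar> \<le> 2" for j
  proof -
    have "\<bar>dens j * (dens j - e j)\<bar> \<le> 1 * 1"
      unfolding abs_mult using a01[of j] e01[of j] by (intro mult_mono) auto
    moreover define p where "p = dens j * (dens j - e j)"
    ultimately show ?thesis unfolding des_mean p_def[symmetric] add_divide_distrib
      using e01[of j] by linarith
  qed
  have v_bd: "\<bar>v j\<bar> \<le> 9" for j
  proof -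
    have "\<bar>(1 + e j) * (2 + e j)\<bar> \<le> 2 * 3" "\<bar>des_mean j * (1 + e j)\<bar> \<le> 2 * 2" "\<bar>(des_mean j)\<^sup>2\<bar> \<le> 2 * 2"
      unfolding abs_mult power2_eq_square using e01[of j] m_bd[of j] by (intro mult_mono; simp)+
    then show ?thesis unfolding v_def by linarith
  qed
  have lip: "norm (S.gauss_term j \<pi> - exp (of_real (S.\<kappa> / 2 * v j) + \<i> * of_real (S.cent j \<pi>)))
      \<le> exp (5 * \<bar>S.\<kappa>\<bar>) * (3 * \<bar>S.\<kappa>\<bar>) * \<bar>\<delta> j \<pi> - des_mean j\<bar>" for j \<pi>
  proof -
    let ?r = "S.\<kappa> / 2 * (s j)\<^sup>2 * dev2 (n j) (des1 (n j) \<pi>)"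
    have "S.gauss_term j \<pi> - exp (of_real (S.\<kappa> / 2 * v j) + \<i> * of_real (S.cent j \<pi>)) = of_real (exp ?r - exp (S.\<kappa> / 2 * v j)) * exp (\<i> * of_real (S.cent j \<pi>))"
      unfolding S.gauss_term_cent exp_add by (simp add: exp_of_real[symmetric] algebra_simps)
    then have "norm (S.gauss_term j \<pi> - exp (of_real (S.\<kappa> / 2 * v j) + \<i> * of_real (S.cent j \<pi>))) = \<bar>exp ?r - exp (S.\<kappa> / 2 * v j)\<bar>"
      by (simp only: norm_mult norm_exp_i_times norm_of_real mult_1_right)
    also have "\<dots> \<le> exp (5 * \<bar>S.\<kappa>\<bar>) * \<bar>?r - S.\<kappa> / 2 * v j\<bar>"
    proof (rule abs_exp_diff_le)
      show "?r \<le> 5 * \<bar>S.\<kappa>\<bar>" using S.s_sq_dev2_le[OF order.refl des1_le[OF n_pos], of j \<pi>] by linarith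
      have "\<bar>S.\<kappa> / 2 * v j\<bar> \<le> \<bar>S.\<kappa>\<bar> / 2 * 9" unfolding abs_mult using v_bd[of j] by (intro mult_mono) auto
      then show "S.\<kappa> / 2 * v j \<le> 5 * \<bar>S.\<kappa>\<bar>" by linarith
    qed
    \<comment> \<open>Both sides are the same quadratic, at \<open>\<delta>\<close> and at its mean,
      so the deviation splits off as a factor.\<close>
    also have "?r - S.\<kappa> / 2 * v j = S.\<kappa> / 2 * ((\<delta> j \<pi> + des_mean j - (1 + e j)) * (\<delta> j \<pi> - des_mean j))"
    proof -
      have "?r = S.\<kappa> / 2 * ((s j)\<^sup>2 * dev2 (n j) (des1 (n j) \<pi>))" by simp
      then show ?thesis unfolding dev2 v_def by (simp add: power2_eq_square algebra_simps)
    qed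
    also have "\<bar>\<dots>\<bar> = \<bar>S.\<kappa>\<bar> / 2 * \<bar>\<delta> j \<pi> + des_mean j - (1 + e j)\<bar> * \<bar>\<delta> j \<pi> - des_mean j\<bar>"
      by (simp add: abs_mult)
    also have "\<dots> \<le> \<bar>S.\<kappa>\<bar> / 2 * 6 * \<bar>\<delta> j \<pi> - des_mean j\<bar>"
    proof (intro mult_right_mono mult_left_mono)
      show "\<bar>\<delta> j \<pi> + des_mean j - (1 + e j)\<bar> \<le> 6" using \<delta>01[of j \<pi>] m_bd[of j] e01[of j] by linarith
    qed auto
    finally show ?thesis by (simp add: mult_ac)
  qed
  have KA: "(\<lambda>j. avg j (S.gauss_term j) - of_real (K j) * avg j (\<lambda>\<pi>. exp (\<i> * of_real (S.cent j \<pi>)))) \<longlonglongrightarrow> 0"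
  proof (rule Lim_null_comparison[rotated])
    show "(\<lambda>j. exp (5 * \<bar>S.\<kappa>\<bar>) * (3 * \<bar>S.\<kappa>\<bar>) * ravg j (\<lambda>\<pi>. \<bar>\<delta> j \<pi> - des_mean j\<bar>)) \<longlonglongrightarrow> 0"
      using tendsto_mult_right_zero[OF des_deviation_lim] unfolding \<delta>_def N_def .
    show "\<forall>\<^sub>F j in sequentially. norm (avg j (S.gauss_term j) - of_real (K j) * avg j (\<lambda>\<pi>. exp (\<i> * of_real (S.cent j \<pi>))))
       \<le> exp (5 * \<bar>S.\<kappa>\<bar>) * (3 * \<bar>S.\<kappa>\<bar>) * ravg j (\<lambda>\<pi>. \<bar>\<delta> j \<pi> - des_mean j\<bar>)"
    proof (intro always_eventually allI)
      fix j
      have eq: "avg j (S.gauss_term j) - of_real (K j) * avg j (\<lambda>\<pi>. exp (\<i> * of_real (S.cent j \<pi>)))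
        = avg j (\<lambda>\<pi>. S.gauss_term j \<pi> - exp (of_real (S.\<kappa> / 2 * v j) + \<i> * of_real (S.cent j \<pi>)))"
        unfolding avg_cmult avg_diff K_def exp_add exp_of_real ..
      have "norm (avg j (\<lambda>\<pi>. S.gauss_term j \<pi> - exp (of_real (S.\<kappa> / 2 * v j) + \<i> * of_real (S.cent j \<pi>))))
        \<le> ravg j (\<lambda>\<pi>. exp (5 * \<bar>S.\<kappa>\<bar>) * (3 * \<bar>S.\<kappa>\<bar>) * \<bar>\<delta> j \<pi> - des_mean j\<bar>)"
        by (rule order.trans[OF norm_avg_le_ravg ravg_mono[OF lip]])
      then show "norm (avg j (S.gauss_term j) - of_real (K j) * avg j (\<lambda>\<pi>. exp (\<i> * of_real (S.cent j \<pi>))))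
       \<le> exp (5 * \<bar>S.\<kappa>\<bar>) * (3 * \<bar>S.\<kappa>\<bar>) * ravg j (\<lambda>\<pi>. \<bar>\<delta> j \<pi> - des_mean j\<bar>)"
        unfolding eq by (simp only: ravg_cmult)
    qed
  qed
  define \<psi> where "\<psi> j = \<theta>1 * s j * (N j * (N j + 1) / 2) - \<theta>1 * (1 - (dens j)\<^sup>2) / 2 * (s j * N j * N j) - \<theta>2 * (1 - (dens j)\<^sup>2) / 4 * (s j * N j * N j)" for j
  have proj: "proj \<theta>1 \<theta>2 j \<pi> = S.cent j \<pi> + \<psi> j" for j \<pi>
  proof -
    have r: "1 / sqrt (N j) = s j * N j" using N0[of j] by (simp add: s_def)
    have "proj \<theta>1 \<theta>2 j \<pi> = \<theta>1 * ((real (des1 (n j) \<pi>) - (1 - (dens j)\<^sup>2) / 2 * N j) * (1 / sqrt (N j))) +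
        \<theta>2 * ((real (maj (n j) \<pi>) - (1 - (dens j)\<^sup>2) / 4 * (N j)\<^sup>2) * s j)"
      unfolding proj_def N_def[symmetric] s_def by simp
    then show ?thesis
      unfolding r S.cent_def \<psi>_def dev1_eq N_def[symmetric] by (simp add: power2_eq_square algebra_simps)
  qed
  \<comment> \<open>In this sum the terms of order \<open>sqrt n\<close> cancel: the centring by the
    squared density of fixed points is the one that fits \<open>ctr\<close>. What remains has order
    \<open>n^(-1/2)\<close>.\<close>
  define \<gamma> where "\<gamma> j = S.ctr j + \<psi> j" for j
  have \<gamma>: "\<gamma> j = (s j * N j) * (\<theta>1 * (1 + dens j) / 2 - \<theta>2 * (1 - dens j) / 4)" for j
  proof -
    have sum: "(\<Sum>k=lam j 1 + 1..n j. real k - 1) = (N j * (N j + 1) / 2 - N j) - (dens j * N j * (dens j * N j + 1) / 2 - dens j * N j)"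
      unfolding sum_above[OF lam1_le] sum_subtractf sum_nat_real by (simp add: l_eq[unfolded One_nat_def] N_def)
    show ?thesis
      unfolding \<gamma>_def S.ctr_def \<psi>_def S.t_def dev1_eq sum l_eq by (simp add: field_simps power2_eq_square)
  qed
  have sN_lim: "(\<lambda>j. s j * N j) \<longlonglongrightarrow> 0" using S.sn_lim unfolding N_def .
  have \<gamma>_lim: "\<gamma> \<longlonglongrightarrow> 0"
  proof -
    have "\<gamma> \<longlonglongrightarrow> 0 * (\<theta>1 * (1 + \<alpha>) / 2 - \<theta>2 * (1 - \<alpha>) / 4)"
      unfolding \<gamma>[abs_def] by (intro tendsto_intros sN_lim a_lim) auto
    then show ?thesis by simp
  qed
  \<comment> \<open>Both cubes come from sums of squares divided by \<open>n^3\<close>: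
    \<open>\<alpha>^3 / 3\<close> up to the number of fixed points, in the short factor, and
    \<open>(1 - \<alpha>^3) / 3\<close> beyond it, in the quotients.\<close>
  define R where "R = - \<theta>2\<^sup>2 * (1 - \<alpha>^3) / 72 + S.\<kappa> * \<alpha>^3 / 6"
  have re_part: "S.re_part j = - \<theta>2\<^sup>2 / 24 * ((1 + e j) * (2 + e j) / 6 - (e j)\<^sup>2 - dens j * (dens j + e j) * (2 * dens j + e j) / 6 + dens j * (e j)\<^sup>2)
     + S.\<kappa> / 2 * (dens j * (dens j + e j) * (2 * dens j + e j) / 6 - dens j * (dens j + e j) * e j + dens j * (e j)\<^sup>2)" for j
  proof -
    have 1: "(\<Sum>k=lam j 1 + 1..n j. (real k)\<^sup>2 - 1) = (N j * (N j + 1) * (2 * N j + 1) / 6 - N j) - (dens j * N j * (dens j * N j + 1) * (2 * (dens j * N j) + 1) / 6 - dens j * N j)"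
      unfolding sum_above[OF lam1_le] sum_subtractf sum_sq_real by (simp add: l_eq[unfolded One_nat_def] N_def)
    have 2: "(N j * (N j + 1) * (2 * N j + 1) / 6 - N j - (dens j * N j * (dens j * N j + 1) * (2 * (dens j * N j) + 1) / 6 - dens j * N j)) / N j ^ 3
       = (1 + e j) * (2 + e j) / 6 - (e j)\<^sup>2 - dens j * (dens j + e j) * (2 * dens j + e j) / 6 + dens j * (e j)\<^sup>2"
      unfolding e_def using N0[of j] by (simp add: field_simps power2_eq_square power3_eq_cube)
    have 3: "dev2 (lam j 1) 1 / N j ^ 3 = dens j * (dens j + e j) * (2 * dens j + e j) / 6 - dens j * (dens j + e j) * e j + dens j * (e j)\<^sup>2"
      unfolding e_def dev2_eq l_eq using N0[of j] by (simp add: field_simps power2_eq_square power3_eq_cube)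
    show ?thesis unfolding 2[symmetric] 3[symmetric] S.re_part_def 1 S.t_def power_mult_distrib s_sq by simp
  qed
  have R_lim: "S.re_part \<longlonglongrightarrow> R"
  proof -
    have "S.re_part \<longlonglongrightarrow> - \<theta>2\<^sup>2 / 24 * ((1 + 0) * (2 + 0) / 6 - 0\<^sup>2 - \<alpha> * (\<alpha> + 0) * (2 * \<alpha> + 0) / 6 + \<alpha> * 0\<^sup>2)
       + S.\<kappa> / 2 * (\<alpha> * (\<alpha> + 0) * (2 * \<alpha> + 0) / 6 - \<alpha> * (\<alpha> + 0) * 0 + \<alpha> * 0\<^sup>2)"
      unfolding re_part[abs_def] by (intro tendsto_intros e_lim a_lim) auto
    then show ?thesis by (simp add: R_def power3_eq_cube field_simps)
  qed
  let ?\<phi> = "\<lambda>j. avg j (\<lambda>\<pi>. exp (\<i> * of_real (proj \<theta>1 \<theta>2 j \<pi>)))"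
  have \<phi>: "?\<phi> j = exp (\<i> * of_real (\<psi> j)) * avg j (\<lambda>\<pi>. exp (\<i> * of_real (S.cent j \<pi>)))" for j
    unfolding avg_cmult proj by (simp add: exp_add[symmetric] algebra_simps)
  have diff: "(\<lambda>j. of_real (K j) * avg j (\<lambda>\<pi>. exp (\<i> * of_real (S.cent j \<pi>))) - exp (S.quot_exponent j + S.short_exponent j)) \<longlonglongrightarrow> 0"
    using tendsto_diff[OF S.avg_gauss_term_lim KA] by simp
  have "(\<lambda>j. of_real (K j) * ?\<phi> j - exp (of_real (S.re_part j) + \<i> * of_real (\<gamma> j))) \<longlonglongrightarrow> 0"
  proof (rule Lim_null_comparison[OF _ tendsto_norm_zero[OF diff]], intro always_eventually allI)
    fix j
    have "of_real (K j) * ?\<phi> j - exp (of_real (S.re_part j) + \<i> * of_real (\<gamma> j))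
       = exp (\<i> * of_real (\<psi> j)) * (of_real (K j) * avg j (\<lambda>\<pi>. exp (\<i> * of_real (S.cent j \<pi>))) - exp (S.quot_exponent j + S.short_exponent j))"
      unfolding \<phi> S.exponent_eq \<gamma>_def by (simp add: right_diff_distrib exp_add distrib_left)
    then show "norm (of_real (K j) * ?\<phi> j - exp (of_real (S.re_part j) + \<i> * of_real (\<gamma> j)))
      \<le> norm (of_real (K j) * avg j (\<lambda>\<pi>. exp (\<i> * of_real (S.cent j \<pi>))) - exp (S.quot_exponent j + S.short_exponent j))"
      by (simp only: norm_mult norm_exp_i_times mult_1)
  qed
  moreover have "(\<lambda>j. exp (of_real (S.re_part j) + \<i> * of_real (\<gamma> j))) \<longlonglongrightarrow> exp (of_real R + \<i> * of_real 0)"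
    by (intro tendsto_intros R_lim \<gamma>_lim)
  ultimately have "(\<lambda>j. of_real (K j) * ?\<phi> j) \<longlonglongrightarrow> exp (of_real R + \<i> * of_real 0)"
    using tendsto_add by fastforce
  then have K\<phi>: "(\<lambda>j. of_real (K j) * ?\<phi> j) \<longlonglongrightarrow> of_real (exp R)" by (simp add: exp_of_real)
  have "(\<lambda>j. complex_of_real (K j)) \<longlonglongrightarrow> of_real (exp (S.\<kappa> / 2 * (1/3 - m + m\<^sup>2)))"
    unfolding K_def by (intro tendsto_intros v_lim)
  then have "(\<lambda>j. of_real (K j) * ?\<phi> j / of_real (K j)) \<longlonglongrightarrow> of_real (exp R) / of_real (exp (S.\<kappa> / 2 * (1/3 - m + m\<^sup>2)))"
    by (intro tendsto_divide K\<phi>) auto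
  moreover have "of_real (K j) * ?\<phi> j / of_real (K j) = ?\<phi> j" for j by (simp add: K_def)
  moreover have "complex_of_real (exp R) / of_real (exp (S.\<kappa> / 2 * (1/3 - m + m\<^sup>2))) = of_real (exp (- quad_form \<theta>1 \<theta>2 / 2))"
  proof -
    \<comment> \<open>Since \<open>1/3 - m + m^2 = 1/12 + \<alpha>^4 / 4\<close>, the terms with
      \<open>\<kappa>\<close> combine to
      \<open>- \<kappa> / 24 * (1 - 4 \<alpha>^3 + 3 \<alpha>^4)\<close>.\<close>
    have "R - S.\<kappa> / 2 * (1/3 - m + m\<^sup>2) = - quad_form \<theta>1 \<theta>2 / 2"
      unfolding R_def m_def S.\<kappa>_def quad_form_def by (simp add: field_simps power2_eq_square power3_eq_cube power4_eq_xxxx)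
    then show ?thesis by (simp add: exp_diff[symmetric] flip: of_real_divide)
  qed
  ultimately show ?thesis by simp
qed

end

section \<open>Convergence in distribution in the plane\<close>


abbreviation "std_normal \<equiv> std_normal_distribution"

lemma prob_space_std_normal: "prob_space std_normal"
  using prob_space_normal_density by auto

section \<open>Interchange of integrals for bounded integrands\<close>

lemma integral_swap_bounded:
  fixes f :: "'a \<Rightarrow> 'b \<Rightarrow> 'c::{banach, second_countable_topology}"
  assumes "prob_space M1" "sigma_finite_measure M2"
    and f: "case_prod f \<in> borel_measurable (M1 \<Otimes>\<^sub>M M2)"
    and A: "A \<in> sets M2" "emeasure M2 A < \<infinity>"
    and bound: "\<And>x y. norm (f x y) \<le> B" and null: "\<And>x y. y \<notin> A \<Longrightarrow> f x y = 0"
  shows "(\<integral>x. (\<integral>y. f x y \<partial>M2) \<partial>M1) = (\<integral>y. (\<integral>x. f x y \<partial>M1) \<partial>M2)"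
proof -
  interpret M1: prob_space M1 by fact
  interpret M2: sigma_finite_measure M2 by fact
  interpret P: pair_sigma_finite M1 M2 ..
  have "integrable (M1 \<Otimes>\<^sub>M M2) (case_prod f)"
  proof (rule integrableI_bounded_set[where A = "space M1 \<times> A" and B = B])
    show "emeasure (M1 \<Otimes>\<^sub>M M2) (space M1 \<times> A) < \<infinity>"
      using A by (simp add: M2.emeasure_pair_measure_Times M1.emeasure_space_1)
    show "AE x in M1 \<Otimes>\<^sub>M M2. x \<notin> space M1 \<times> A \<longrightarrow> case_prod f x = 0"
      by (rule AE_I2) (use null in \<open>force simp: space_pair_measure\<close>)
  qed (use f A bound in auto)
  from P.Fubini_integral[OF this] show ?thesis ..
qed

lemma integral_swap_prob:
  fixes f :: "'a \<Rightarrow> 'b \<Rightarrow> 'c::{banach, second_countable_topology}"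
  assumes "prob_space M1" "prob_space M2" "case_prod f \<in> borel_measurable (M1 \<Otimes>\<^sub>M M2)"
    and "\<And>x y. norm (f x y) \<le> B"
  shows "(\<integral>x. (\<integral>y. f x y \<partial>M2) \<partial>M1) = (\<integral>y. (\<integral>x. f x y \<partial>M1) \<partial>M2)"
proof -
  interpret M2: prob_space M2 by fact
  \<comment> \<open>Cutting off outside \<open>space M2\<close> provides the support condition
    without changing either iterated integral.\<close>
  define g where "g x y = (if y \<in> space M2 then f x y else 0)" for x y
  have "(\<integral>x. (\<integral>y. g x y \<partial>M2) \<partial>M1) = (\<integral>y. (\<integral>x. g x y \<partial>M1) \<partial>M2)"
  proof (rule integral_swap_bounded[where A = "space M2" and B = "\<bar>B\<bar>"])
    have "case_prod g \<in> borel_measurable (M1 \<Otimes>\<^sub>M M2) \<longleftrightarrow> case_prod f \<in> borel_measurable (M1 \<Otimes>\<^sub>M M2)"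
      by (rule measurable_cong) (auto simp: g_def space_pair_measure)
    then show "case_prod g \<in> borel_measurable (M1 \<Otimes>\<^sub>M M2)" using assms(3) by simp
    show "norm (g x y) \<le> \<bar>B\<bar>" for x y using assms(4)[of x y] by (auto simp: g_def)
  qed (use assms in \<open>auto simp: g_def M2.emeasure_space_1 intro: M2.sigma_finite_measure_axioms\<close>)
  moreover have "(\<integral>y. g x y \<partial>M2) = (\<integral>y. f x y \<partial>M2)" for x
    by (rule Bochner_Integration.integral_cong) (auto simp: g_def)
  moreover have "(\<integral>y. (\<integral>x. g x y \<partial>M1) \<partial>M2) = (\<integral>y. (\<integral>x. f x y \<partial>M1) \<partial>M2)"
    by (rule Bochner_Integration.integral_cong) (auto simp: g_def)
  ultimately show ?thesis by simp
qed

lemma std_normal_char: "(\<integral>s. exp (\<i> * of_real (u * s)) \<partial>std_normal) = complex_of_real (exp (- u\<^sup>2 / 2))"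
  using fun_cong[OF char_std_normal_distribution, of u] by (simp add: char_def)

section \<open>Gaussian smoothing of measures in the plane\<close>

definition char2 :: "(real^2) measure \<Rightarrow> real \<Rightarrow> real \<Rightarrow> complex" where
  "char2 M a b = (\<integral>x. exp (\<i> * of_real (a * x $ 1 + b * x $ 2)) \<partial>M)"

text \<open>Up to the factor \<open>c^2 / (2 * pi)\<close>, the density at \<open>(y1, y2)\<close>
  of \<open>M\<close> convolved with independent centred normal noise of variance
  \<open>1 / c^2\<close> in each coordinate.\<close>

definition gauss_smooth :: "real \<Rightarrow> (real^2) measure \<Rightarrow> real \<Rightarrow> real \<Rightarrow> real" where
  "gauss_smooth c M y1 y2 = (\<integral>x. exp (- (c * (y1 - x $ 1))\<^sup>2 / 2) * exp (- (c * (y2 - x $ 2))\<^sup>2 / 2) \<partial>M)"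

lemma borel_vec2 [measurable]: "(\<lambda>x::real^2. x $ i) \<in> borel_measurable borel"
  by (intro borel_measurable_continuous_onI continuous_intros)

context
  fixes M :: "(real^2) measure"
  assumes M: "prob_space M" "sets M = sets borel"
begin

lemma measurable_M [measurable]: "(\<lambda>x. x $ i) \<in> borel_measurable M"
  using borel_vec2 measurable_cong_sets[OF M(2) refl] by blast

lemma measurable_char2 [measurable]:
  "(\<lambda>r. char2 M a (k * r)) \<in> borel_measurable borel"
  "(\<lambda>(s, r). char2 M (k * s) (k * r)) \<in> borel_measurable (borel \<Otimes>\<^sub>M borel)"
proof -
  interpret M: prob_space M by (rule M)
  show "(\<lambda>r. char2 M a (k * r)) \<in> borel_measurable borel" unfolding char2_def by measurable
  show "(\<lambda>(s, r). char2 M (k * s) (k * r)) \<in> borel_measurable (borel \<Otimes>\<^sub>M borel)"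
    unfolding char2_def by measurable
qed

lemma norm_char2_le: "norm (char2 M a b) \<le> 1"
proof -
  interpret M: prob_space M by (rule M)
  have "norm (char2 M a b) \<le> (\<integral>x. norm (exp (\<i> * of_real (a * x $ 1 + b * x $ 2))) \<partial>M)"
    unfolding char2_def by (rule integral_norm_bound)
  also have "\<dots> = (\<integral>x. 1 \<partial>M)" by (simp only: norm_exp_i_times)
  finally show ?thesis by (simp add: M.prob_space)
qed

text \<open>A Gaussian is the characteristic function of a Gaussian: each exponential is rewritten
  as a mean of \<open>exp (\<i> u s)\<close> over a standard normal \<open>s\<close>, and
  interchanging integrals leaves the characteristic function of \<open>M\<close>.\<close>

lemma gauss_smooth_char2:
  "complex_of_real (gauss_smooth c M y1 y2)
    = (\<integral>s. (\<integral>r. exp (\<i> * of_real (c * (s * y1 + r * y2))) * char2 M (- c * s) (- c * r) \<partial>std_normal) \<partial>std_normal)"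
proof -
  interpret M: prob_space M by (rule M)
  interpret G: prob_space std_normal by (rule prob_space_std_normal)
  define F where "F x s r = exp (\<i> * complex_of_real (c * (y1 - x $ 1) * s)) * exp (\<i> * complex_of_real (c * (y2 - x $ 2) * r))" for x :: "real^2" and s r
  have normF: "norm (F x s r) \<le> 1" for x s r unfolding F_def norm_mult norm_exp_i_times by simp
  have F_int: "(\<integral>x. F x s r \<partial>M) = exp (\<i> * of_real (c * (s * y1 + r * y2))) * char2 M (- c * s) (- c * r)" for s r
  proof -
    have "F x s r = exp (\<i> * of_real (c * (s * y1 + r * y2))) * exp (\<i> * of_real (- c * s * x $ 1 + - c * r * x $ 2))" for x
      unfolding F_def by (simp add: exp_add[symmetric] algebra_simps)
    then show ?thesis unfolding char2_def by (simp only: integral_mult_right_zero)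
  qed
  have "complex_of_real (gauss_smooth c M y1 y2)
      = (\<integral>x. complex_of_real (exp (- (c * (y1 - x $ 1))\<^sup>2 / 2)) * of_real (exp (- (c * (y2 - x $ 2))\<^sup>2 / 2)) \<partial>M)"
    unfolding gauss_smooth_def by (simp flip: integral_complex_of_real)
  also have "\<dots> = (\<integral>x. (\<integral>s. exp (\<i> * complex_of_real (c * (y1 - x $ 1) * s)) * of_real (exp (- (c * (y2 - x $ 2))\<^sup>2 / 2)) \<partial>std_normal) \<partial>M)"
    by (simp only: std_normal_char[symmetric] integral_mult_left_zero)
  also have "\<dots> = (\<integral>s. (\<integral>x. exp (\<i> * complex_of_real (c * (y1 - x $ 1) * s)) * of_real (exp (- (c * (y2 - x $ 2))\<^sup>2 / 2)) \<partial>M) \<partial>std_normal)"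
  proof (rule integral_swap_prob[where B = 1, OF M(1) prob_space_std_normal])
    show "norm (exp (\<i> * complex_of_real (c * (y1 - x $ 1) * s)) * of_real (exp (- (c * (y2 - x $ 2))\<^sup>2 / 2))) \<le> 1" for x :: "real^2" and s
      unfolding norm_mult norm_exp_i_times norm_of_real by simp
  qed measurable
  also have "\<dots> = (\<integral>s. (\<integral>r. (\<integral>x. F x s r \<partial>M) \<partial>std_normal) \<partial>std_normal)"
  proof (rule Bochner_Integration.integral_cong[OF refl])
    fix s
    have "(\<integral>x. exp (\<i> * complex_of_real (c * (y1 - x $ 1) * s)) * of_real (exp (- (c * (y2 - x $ 2))\<^sup>2 / 2)) \<partial>M)
      = (\<integral>x. (\<integral>r. F x s r \<partial>std_normal) \<partial>M)"
      unfolding F_def by (simp only: std_normal_char[symmetric] integral_mult_right_zero)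
    also have "\<dots> = (\<integral>r. (\<integral>x. F x s r \<partial>M) \<partial>std_normal)"
    proof (rule integral_swap_prob[OF M(1) prob_space_std_normal _ normF])
      show "(\<lambda>(x, r). F x s r) \<in> borel_measurable (M \<Otimes>\<^sub>M std_normal)" unfolding F_def by measurable
    qed
    finally show "(\<integral>x. exp (\<i> * complex_of_real (c * (y1 - x $ 1) * s)) * of_real (exp (- (c * (y2 - x $ 2))\<^sup>2 / 2)) \<partial>M)
      = (\<integral>r. (\<integral>x. F x s r \<partial>M) \<partial>std_normal)" .
  qed
  also have "\<dots> = (\<integral>s. (\<integral>r. exp (\<i> * of_real (c * (s * y1 + r * y2))) * char2 M (- c * s) (- c * r) \<partial>std_normal) \<partial>std_normal)"
    by (simp only: F_int)
  finally show ?thesis .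
qed

end

lemma gauss_smooth_lim:
  assumes M: "\<And>j. prob_space (M j)" "\<And>j. sets (M j) = sets borel" and N: "prob_space N" "sets N = sets borel"
    and conv: "\<And>a b. b \<noteq> 0 \<Longrightarrow> a + b \<noteq> 0 \<Longrightarrow> (\<lambda>j. char2 (M j) a b) \<longlonglongrightarrow> char2 N a b"
    and c: "c \<noteq> 0"
  shows "(\<lambda>j. gauss_smooth c (M j) y1 y2) \<longlonglongrightarrow> gauss_smooth c N y1 y2"
proof -
  interpret G: prob_space std_normal by (rule prob_space_std_normal)
  define f where "f L s r = exp (\<i> * of_real (c * (s * y1 + r * y2))) * char2 L (- c * s) (- c * r)" for L s r
  have f_meas: "f L s \<in> borel_measurable std_normal" "(\<lambda>s. \<integral>r. f L s r \<partial>std_normal) \<in> borel_measurable std_normal"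
    if "prob_space L" "sets L = sets borel" for L s
  proof -
    note [measurable] = measurable_char2[OF that]
    show "f L s \<in> borel_measurable std_normal" unfolding f_def by measurable
    have "(\<lambda>(s, r). f L s r) \<in> borel_measurable (std_normal \<Otimes>\<^sub>M std_normal)"
      unfolding f_def by measurable
    then show "(\<lambda>s. \<integral>r. f L s r \<partial>std_normal) \<in> borel_measurable std_normal" by measurable
  qed
  have f_norm: "norm (f L s r) \<le> 1" if "prob_space L" "sets L = sets borel" for L s r
    unfolding f_def norm_mult norm_exp_i_times using norm_char2_le[OF that] by simp
  have inner: "(\<lambda>j. \<integral>r. f (M j) s r \<partial>std_normal) \<longlonglongrightarrow> (\<integral>r. f N s r \<partial>std_normal)" for s
  proof (rule integral_dominated_convergence[where w = "\<lambda>_. 1"])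
    \<comment> \<open>For fixed \<open>s\<close>, the excluded frequencies correspond to these two
      values of \<open>r\<close>.\<close>
    have "AE r in lborel. r \<noteq> 0 \<and> r \<noteq> - s"
      by (intro AE_conjI AE_lborel_singleton)
    then have "AE r in std_normal. r \<noteq> 0 \<and> r \<noteq> - s"
      by (subst AE_density) auto
    then show "AE r in std_normal. (\<lambda>j. f (M j) s r) \<longlonglongrightarrow> f N s r"
    proof (rule AE_mp, intro AE_I2 impI)
      fix r assume "r \<noteq> 0 \<and> r \<noteq> - s"
      then have "- c * r \<noteq> 0" "- c * (s + r) \<noteq> 0"
        using c by (auto simp: add_eq_0_iff)
      then have "- c * r \<noteq> 0" "- c * s + - c * r \<noteq> 0" by (simp_all only: distrib_left not_False_eq_True)
      then show "(\<lambda>j. f (M j) s r) \<longlonglongrightarrow> f N s r"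
        unfolding f_def by (intro tendsto_intros conv)
    qed
  qed (use f_meas M N f_norm in auto)
  have "(\<lambda>j. \<integral>s. (\<integral>r. f (M j) s r \<partial>std_normal) \<partial>std_normal) \<longlonglongrightarrow> (\<integral>s. (\<integral>r. f N s r \<partial>std_normal) \<partial>std_normal)"
  proof (rule integral_dominated_convergence[where w = "\<lambda>_. 1"])
    show "AE s in std_normal. norm (\<integral>r. f (M j) s r \<partial>std_normal) \<le> 1" for j
    proof (rule AE_I2)
      fix s
      have "norm (\<integral>r. f (M j) s r \<partial>std_normal) \<le> (\<integral>r. norm (f (M j) s r) \<partial>std_normal)" by (rule integral_norm_bound)
      also have "\<dots> \<le> (\<integral>r. 1 \<partial>std_normal)"
      proof (rule integral_mono)
        show "integrable std_normal (\<lambda>r. norm (f (M j) s r))"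
          using f_meas(1)[OF M(1,2)] f_norm[OF M(1,2)] by (intro integrable_norm G.integrable_const_bound[where B = 1]) auto
      qed (use f_norm[OF M(1,2)] in auto)
      finally show "norm (\<integral>r. f (M j) s r \<partial>std_normal) \<le> 1" using G.prob_space by simp
    qed
  qed (use f_meas M N inner in auto)
  then have "(\<lambda>j. complex_of_real (gauss_smooth c (M j) y1 y2)) \<longlonglongrightarrow> of_real (gauss_smooth c N y1 y2)"
    unfolding gauss_smooth_char2[OF M] gauss_smooth_char2[OF N] f_def .
  then show ?thesis by (simp only: tendsto_of_real_iff)
qed


definition vec2 :: "real \<Rightarrow> real \<Rightarrow> real^2" where
  "vec2 a b = (\<chi> i. if i = 1 then a else b)"

lemma vec2_nth [simp]: "vec2 a b $ 1 = a" "vec2 a b $ 2 = b"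
  by (simp_all add: vec2_def)

lemma norm_vec2_le: "norm (vec2 a b) \<le> \<bar>a\<bar> + \<bar>b\<bar>"
  using norm_le_l1_cart[of "vec2 a b"] by (simp add: UNIV_2)

lemma measurable_vec2 [measurable]:
  assumes [measurable]: "f \<in> borel_measurable M" "g \<in> borel_measurable M"
  shows "(\<lambda>x. vec2 (f x) (g x)) \<in> borel_measurable M"
proof -
  have "continuous_on UNIV (\<lambda>p. vec2 (fst p) (snd p))"
    unfolding vec2_def
  proof (rule continuous_on_vec_lambda)
    show "continuous_on UNIV (\<lambda>p::real \<times> real. if i = 1 then fst p else snd p)" for i :: 2
      by (cases "i = 1") (auto intro!: continuous_intros)
  qed
  then have "(\<lambda>p. vec2 (fst p) (snd p)) \<in> borel_measurable (borel :: (real \<times> real) measure)"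
    by (rule borel_measurable_continuous_onI)
  then have [measurable]: "(\<lambda>p. vec2 (fst p) (snd p)) \<in> borel_measurable (borel \<Otimes>\<^sub>M borel)"
    by (simp add: borel_prod)
  have "(\<lambda>x. (\<lambda>p. vec2 (fst p) (snd p)) (f x, g x)) \<in> borel_measurable M" by measurable
  then show ?thesis by simp
qed

lemma gauss_smooth_bounds:
  assumes "prob_space M" "sets M = sets borel"
  shows "0 \<le> gauss_smooth c M y1 y2" "gauss_smooth c M y1 y2 \<le> 1"
proof -
  interpret M: prob_space M by fact
  note [measurable] = measurable_M[OF assms]
  show "0 \<le> gauss_smooth c M y1 y2" unfolding gauss_smooth_def by (intro integral_nonneg_AE) auto
  have bd: "exp (- (c * (y1 - x $ 1))\<^sup>2 / 2) * exp (- (c * (y2 - x $ 2))\<^sup>2 / 2) \<le> 1" for x :: "real^2"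
    unfolding exp_add[symmetric] by (simp add: add_nonneg_nonneg)
  have "gauss_smooth c M y1 y2 \<le> (\<integral>x. 1 \<partial>M)"
    unfolding gauss_smooth_def
  proof (rule integral_mono)
    show "integrable M (\<lambda>x. exp (- (c * (y1 - x $ 1))\<^sup>2 / 2) * exp (- (c * (y2 - x $ 2))\<^sup>2 / 2))"
      by (rule M.integrable_const_bound[where B = 1]) (use bd in auto)
  qed (use bd in auto)
  then show "gauss_smooth c M y1 y2 \<le> 1" by (simp add: M.prob_space)
qed

lemma measurable_gauss_smooth:
  assumes "prob_space M" "sets M = sets borel"
  shows "(\<lambda>(y1, y2). gauss_smooth c M y1 y2) \<in> borel_measurable (borel \<Otimes>\<^sub>M borel)"
proof -
  interpret M: prob_space M by fact
  note [measurable] = measurable_M[OF assms]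
  show ?thesis unfolding gauss_smooth_def by measurable
qed

text \<open>The density of the centred normal law with standard deviation
  \<open>1 / c\<close>.\<close>

definition kern :: "real \<Rightarrow> real \<Rightarrow> real" where
  "kern c u = c * std_normal_density (c * u)"

lemma kern_eq: "kern c u = c / sqrt (2 * pi) * exp (- (c * u)\<^sup>2 / 2)"
  by (simp add: kern_def std_normal_density_def)

lemma kern_bounds:
  assumes "0 < c"
  shows "0 \<le> kern c u" "kern c u \<le> c"
proof -
  have "1 \<le> sqrt (2 * pi)" using pi_gt3 by simp
  then have "1 / sqrt (2 * pi) * exp (- (c * u)\<^sup>2 / 2) \<le> 1 * 1" by (intro mult_mono) auto
  then show "kern c u \<le> c" "0 \<le> kern c u"
    using mult_left_mono[of "1 / sqrt (2 * pi) * exp (- (c * u)\<^sup>2 / 2)" 1 c] assms by (simp_all add: kern_eq)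
qed

lemma measurable_kern [measurable]: "kern c \<in> borel_measurable borel"
  unfolding kern_def by measurable

lemma integral_std_normal_kern:
  fixes f :: "real \<Rightarrow> real"
  assumes c: "0 < c" and [measurable]: "f \<in> borel_measurable borel"
  shows "(\<integral>r. f (x + r / c) \<partial>std_normal) = (\<integral>y. f y * kern c (y - x) \<partial>lborel)"
proof -
  have "(\<integral>r. f (x + r / c) \<partial>std_normal) = (\<integral>r. std_normal_density r * f (x + r / c) \<partial>lborel)"
    by (subst integral_density) (auto simp: normal_density_nonneg)
  also have "\<dots> = \<bar>1 / c\<bar> *\<^sub>R (\<integral>r. f (x + 1 / c * r) * kern c (x + 1 / c * r - x) \<partial>lborel)"
    using c by (simp add: kern_def mult_ac flip: integral_mult_right_zero)
  also have "\<dots> = (\<integral>y. f y * kern c (y - x) \<partial>lborel)"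
    by (rule lborel_integral_real_affine[symmetric]) (use c in simp)
  finally show ?thesis .
qed

definition smooth :: "real \<Rightarrow> (real^2 \<Rightarrow> real) \<Rightarrow> real^2 \<Rightarrow> real" where
  "smooth c g x = (\<integral>s. (\<integral>r. g (vec2 (x $ 1 + s / c) (x $ 2 + r / c)) \<partial>std_normal) \<partial>std_normal)"

context
  fixes g :: "real^2 \<Rightarrow> real" and B L c :: real
  assumes g: "continuous_on UNIV g" and B: "\<And>x. \<bar>g x\<bar> \<le> B" and supp: "\<forall>x. L < norm x \<longrightarrow> g x = 0"
    and c: "0 < c"
begin

lemma g_measurable [measurable]: "g \<in> borel_measurable borel"
  using g by (rule borel_measurable_continuous_onI)

lemma g_outside: "y1 \<notin> {-L..L} \<Longrightarrow> g (vec2 y1 y2) = 0" "y2 \<notin> {-L..L} \<Longrightarrow> g (vec2 y1 y2) = 0"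
  using component_le_norm_cart[of "vec2 y1 y2" 1] component_le_norm_cart[of "vec2 y1 y2" 2]
  by (auto intro!: supp[rule_format])

lemma B0: "0 \<le> B"
  using B[of 0] by linarith

lemma integral_box_le:
  fixes f :: "real \<Rightarrow> real"
  assumes "\<And>y. \<bar>f y\<bar> \<le> K" "\<And>y. y \<notin> {-L..L} \<Longrightarrow> f y = 0" "f \<in> borel_measurable borel"
  shows "\<bar>\<integral>y. f y \<partial>lborel\<bar> \<le> K * \<bar>2 * L\<bar>"
proof -
  have K: "0 \<le> K" using assms(1)[of 0] by linarith
  have fin: "emeasure lborel {-L..L} < \<infinity>" by (simp add: emeasure_lborel_Icc_eq)
  have "norm (\<integral>y. f y \<partial>lborel) \<le> (\<integral>y. K * indicator {-L..L} y \<partial>lborel)"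
  proof (rule Bochner_Integration.integral_norm_bound_integral)
    show "integrable lborel f"
      using assms fin by (intro integrableI_bounded_set[where A = "{-L..L}" and B = K]) auto
    show "integrable lborel (\<lambda>y. K * indicator {-L..L} y)" using fin by simp
    show "norm (f y) \<le> K * indicator {-L..L} y" for y
      using assms(1)[of y] assms(2)[of y] K by (auto simp: indicator_def)
  qed
  also have "\<dots> = K * measure lborel {-L..L}" by simp
  also have "\<dots> \<le> K * \<bar>2 * L\<bar>" using K by (intro mult_left_mono) (auto simp: measure_def emeasure_lborel_Icc_eq)
  finally show ?thesis by simp
qed

text \<open>Writing the noise as a kernel against Lebesgue measure and moving the integral over
  \<open>M\<close> inside twice confines the dependence on the measure to
  \<open>gauss_smooth\<close>. The support of \<open>g\<close> provides the box of finite measure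
  for these interchanges.\<close>

lemma integral_smooth:
  assumes M: "prob_space M" "sets M = sets borel"
  shows "(\<integral>x. smooth c g x \<partial>M) = (\<integral>y1. (\<integral>y2. g (vec2 y1 y2) * (c\<^sup>2 / (2 * pi)) * gauss_smooth c M y1 y2 \<partial>lborel) \<partial>lborel)"
proof -
  interpret M: prob_space M by fact
  note [measurable] = measurable_M[OF M]
  have fin: "emeasure lborel {-L..L} < \<infinity>" by (simp add: emeasure_lborel_Icc_eq)
  define F where "F x y1 y2 = g (vec2 y1 y2) * kern c (y2 - x $ 2) * kern c (y1 - x $ 1)" for x :: "real^2" and y1 y2
  have F_bd: "\<bar>F x y1 y2\<bar> \<le> B * c * c" for x y1 y2
  proof -
    have "\<bar>kern c u\<bar> \<le> c" for u using kern_bounds[OF c, of u] by simp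
    then show ?thesis unfolding F_def abs_mult using B B0 c by (intro mult_mono) auto
  qed
  have F_out: "y1 \<notin> {-L..L} \<or> y2 \<notin> {-L..L} \<Longrightarrow> F x y1 y2 = 0" for x y1 y2
    using g_outside unfolding F_def by auto
  have "smooth c g x = (\<integral>y1. (\<integral>y2. F x y1 y2 \<partial>lborel) \<partial>lborel)" for x
  proof -
    have "smooth c g x = (\<integral>s. (\<integral>y2. g (vec2 (x $ 1 + s / c) y2) * kern c (y2 - x $ 2) \<partial>lborel) \<partial>std_normal)"
      unfolding smooth_def by (intro Bochner_Integration.integral_cong refl integral_std_normal_kern[OF c]) measurable
    also have "\<dots> = (\<integral>y1. (\<integral>y2. g (vec2 y1 y2) * kern c (y2 - x $ 2) \<partial>lborel) * kern c (y1 - x $ 1) \<partial>lborel)"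
      by (rule integral_std_normal_kern[OF c]) measurable
    finally show ?thesis by (simp only: F_def integral_mult_left_zero)
  qed
  then have "(\<integral>x. smooth c g x \<partial>M) = (\<integral>x. (\<integral>y1. (\<integral>y2. F x y1 y2 \<partial>lborel) \<partial>lborel) \<partial>M)" by simp
  also have "\<dots> = (\<integral>y1. (\<integral>x. (\<integral>y2. F x y1 y2 \<partial>lborel) \<partial>M) \<partial>lborel)"
  proof (rule integral_swap_bounded[where A = "{-L..L}" and B = "B * c * c * \<bar>2 * L\<bar>"])
    show "norm (\<integral>y2. F x y1 y2 \<partial>lborel) \<le> B * c * c * \<bar>2 * L\<bar>" for x y1
      unfolding real_norm_def by (rule integral_box_le) (use F_bd F_out in \<open>auto simp: F_def\<close>)
    show "(\<integral>y2. F x y1 y2 \<partial>lborel) = 0" if "y1 \<notin> {-L..L}" for x y1 using F_out that by simp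
    show "(\<lambda>(x, y1). \<integral>y2. F x y1 y2 \<partial>lborel) \<in> borel_measurable (M \<Otimes>\<^sub>M lborel)"
      unfolding F_def by measurable
  qed (use M fin in \<open>auto intro: lborel.sigma_finite_measure_axioms\<close>)
  also have "\<dots> = (\<integral>y1. (\<integral>y2. (\<integral>x. F x y1 y2 \<partial>M) \<partial>lborel) \<partial>lborel)"
  proof (rule Bochner_Integration.integral_cong[OF refl])
    fix y1
    show "(\<integral>x. (\<integral>y2. F x y1 y2 \<partial>lborel) \<partial>M) = (\<integral>y2. (\<integral>x. F x y1 y2 \<partial>M) \<partial>lborel)"
    proof (rule integral_swap_bounded[where A = "{-L..L}" and B = "B * c * c"])
      show "(\<lambda>(x, y2). F x y1 y2) \<in> borel_measurable (M \<Otimes>\<^sub>M lborel)" unfolding F_def by measurable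
    qed (use M fin F_bd F_out in \<open>auto intro: lborel.sigma_finite_measure_axioms\<close>)
  qed
  also have "\<dots> = (\<integral>y1. (\<integral>y2. g (vec2 y1 y2) * (c\<^sup>2 / (2 * pi)) * gauss_smooth c M y1 y2 \<partial>lborel) \<partial>lborel)"
  proof (intro Bochner_Integration.integral_cong refl)
    fix y1 y2
    have "F x y1 y2 = g (vec2 y1 y2) * (c\<^sup>2 / (2 * pi)) * (exp (- (c * (y1 - x $ 1))\<^sup>2 / 2) * exp (- (c * (y2 - x $ 2))\<^sup>2 / 2))" for x
    proof -
      have "sqrt (2 * pi) * sqrt (2 * pi) = 2 * pi" by simp
      then have "c / sqrt (2 * pi) * (c / sqrt (2 * pi)) = c\<^sup>2 / (2 * pi)"
        by (simp only: times_divide_times_eq power2_eq_square)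
      then have "c\<^sup>2 / (2 * pi) = c / sqrt (2 * pi) * (c / sqrt (2 * pi))" ..
      then show ?thesis unfolding F_def kern_eq by (simp only: mult_ac)
    qed
    then show "(\<integral>x. F x y1 y2 \<partial>M) = g (vec2 y1 y2) * (c\<^sup>2 / (2 * pi)) * gauss_smooth c M y1 y2"
      unfolding gauss_smooth_def by (simp only: integral_mult_right_zero)
  qed
  finally show ?thesis .
qed

lemma integral_smooth_lim:
  assumes M: "\<And>j. prob_space (M j)" "\<And>j. sets (M j) = sets borel" and N: "prob_space N" "sets N = sets borel"
    and conv: "\<And>a b. b \<noteq> 0 \<Longrightarrow> a + b \<noteq> 0 \<Longrightarrow> (\<lambda>j. char2 (M j) a b) \<longlonglongrightarrow> char2 N a b"
  shows "(\<lambda>j. \<integral>x. smooth c g x \<partial>M j) \<longlonglongrightarrow> (\<integral>x. smooth c g x \<partial>N)"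
proof -
  define K where "K = B * (c\<^sup>2 / (2 * pi)) * 1"
  define f where "f Q y1 y2 = g (vec2 y1 y2) * (c\<^sup>2 / (2 * pi)) * gauss_smooth c Q y1 y2" for Q y1 y2
  have fin: "emeasure lborel {-L..L} < \<infinity>" by (simp add: emeasure_lborel_Icc_eq)
  have f_meas: "(\<lambda>(y1, y2). f Q y1 y2) \<in> borel_measurable (borel \<Otimes>\<^sub>M borel)"
    if "prob_space Q" "sets Q = sets borel" for Q
  proof -
    note [measurable] = measurable_gauss_smooth[OF that, of c, unfolded split_beta']
    show ?thesis unfolding f_def split_beta' by measurable
  qed
  have f_meas1: "f Q y1 \<in> borel_measurable borel" "(\<lambda>y1. \<integral>y2. f Q y1 y2 \<partial>lborel) \<in> borel_measurable borel"
    if "prob_space Q" "sets Q = sets borel" for Q y1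
  proof -
    note [measurable] = f_meas[OF that]
    show "f Q y1 \<in> borel_measurable borel" by measurable
    have "(\<lambda>(y1, y2). f Q y1 y2) \<in> borel_measurable (borel \<Otimes>\<^sub>M lborel)" by measurable
    then show "(\<lambda>y1. \<integral>y2. f Q y1 y2 \<partial>lborel) \<in> borel_measurable borel"
      by (rule lborel.borel_measurable_lebesgue_integral)
  qed
  have f_bd: "\<bar>f Q y1 y2\<bar> \<le> K" if "prob_space Q" "sets Q = sets borel" for Q y1 y2
    unfolding f_def K_def abs_mult using B B0 gauss_smooth_bounds[OF that] by (intro mult_mono) auto
  have f_out: "f Q y1 y2 = 0" if "y1 \<notin> {-L..L} \<or> y2 \<notin> {-L..L}" for Q y1 y2
    using g_outside that unfolding f_def by auto
  have K0: "0 \<le> K" using B0 by (simp add: K_def)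
  have inner: "(\<lambda>j. \<integral>y2. f (M j) y1 y2 \<partial>lborel) \<longlonglongrightarrow> (\<integral>y2. f N y1 y2 \<partial>lborel)" for y1
  proof (rule integral_dominated_convergence[where w = "\<lambda>y. K * indicator {-L..L} y"])
    show "AE y2 in lborel. norm (f (M j) y1 y2) \<le> K * indicator {-L..L} y2" for j
      using f_bd[OF M(1,2), of j y1] f_out K0 by (intro AE_I2) (auto simp: indicator_def)
    show "AE y2 in lborel. (\<lambda>j. f (M j) y1 y2) \<longlonglongrightarrow> f N y1 y2"
      unfolding f_def using c by (intro AE_I2 tendsto_intros gauss_smooth_lim M N conv) auto
  qed (use f_meas1 M N fin in auto)
  have "(\<lambda>j. \<integral>y1. (\<integral>y2. f (M j) y1 y2 \<partial>lborel) \<partial>lborel) \<longlonglongrightarrow> (\<integral>y1. (\<integral>y2. f N y1 y2 \<partial>lborel) \<partial>lborel)"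
  proof (rule integral_dominated_convergence[where w = "\<lambda>y. K * \<bar>2 * L\<bar> * indicator {-L..L} y"])
    show "AE y1 in lborel. norm (\<integral>y2. f (M j) y1 y2 \<partial>lborel) \<le> K * \<bar>2 * L\<bar> * indicator {-L..L} y1" for j
    proof (rule AE_I2)
      fix y1
      show "norm (\<integral>y2. f (M j) y1 y2 \<partial>lborel) \<le> K * \<bar>2 * L\<bar> * indicator {-L..L} y1"
      proof (cases "y1 \<in> {-L..L}")
        case True
        have "\<bar>\<integral>y2. f (M j) y1 y2 \<partial>lborel\<bar> \<le> K * \<bar>2 * L\<bar>"
          by (rule integral_box_le) (use f_bd[OF M(1,2)] f_out f_meas1[OF M(1,2)] in auto)
        then show ?thesis using True by simp
      qed (simp add: f_out)
    qed
  qed (use f_meas1 M N fin inner in auto)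
  then show ?thesis unfolding integral_smooth[OF M] integral_smooth[OF N] f_def .
qed

text \<open>The noise moves a point by at most \<open>(\<bar>s\<bar> + \<bar>r\<bar>) / c\<close>,
  whose mean tends to 0 as \<open>c\<close> grows. The slack \<epsilon> in the hypothesis admits
  continuous functions that are not Lipschitz.\<close>

lemma smooth_close:
  assumes lip: "\<And>x y. \<bar>g x - g y\<bar> \<le> \<epsilon> + \<Lambda> * norm (x - y)" and \<Lambda>: "0 \<le> \<Lambda>"
    and M: "prob_space M" "sets M = sets borel"
  shows "\<bar>(\<integral>x. smooth c g x \<partial>M) - (\<integral>x. g x \<partial>M)\<bar> \<le> \<epsilon> + 2 * \<Lambda> * (\<integral>s. \<bar>s\<bar> \<partial>std_normal) / c"
proof -
  interpret M: prob_space M by fact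
  interpret G: prob_space std_normal by (rule prob_space_std_normal)
  note [measurable] = measurable_M[OF M]
  define m where "m = (\<integral>s. \<bar>s\<bar> \<partial>std_normal)"
  have abs_int: "integrable std_normal (\<lambda>s::real. \<bar>s\<bar>)"
    using integrable_std_normal_distribution_moment[of 1] by (intro integrable_abs) simp
  have int_g: "integrable std_normal (\<lambda>r. g (vec2 a (b + r / c)))" for a b
    by (rule G.integrable_const_bound[where B = B]) (use B in auto)
  define I where "I x s = (\<integral>r. g (vec2 (x $ 1 + s / c) (x $ 2 + r / c)) \<partial>std_normal)" for x :: "real^2" and s
  have I_bd: "\<bar>I x s\<bar> \<le> B" for x s
  proof -
    have "norm (I x s) \<le> (\<integral>r. B \<partial>std_normal)"
      unfolding I_def by (rule Bochner_Integration.integral_norm_bound_integral[OF int_g]) (use B in auto)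
    then show ?thesis using G.prob_space by simp
  qed
  have I_meas: "(\<lambda>s. I x s) \<in> borel_measurable std_normal" for x unfolding I_def by measurable
  have int_I: "integrable std_normal (I x)" for x
    by (rule G.integrable_const_bound[where B = B]) (use I_bd I_meas in auto)
  have I_close: "\<bar>I x s - g x\<bar> \<le> \<epsilon> + \<Lambda> / c * \<bar>s\<bar> + \<Lambda> / c * m" for x s
  proof -
    have "norm (\<integral>r. g (vec2 (x $ 1 + s / c) (x $ 2 + r / c)) - g x \<partial>std_normal) \<le> (\<integral>r. (\<epsilon> + \<Lambda> / c * \<bar>s\<bar>) + \<Lambda> / c * \<bar>r\<bar> \<partial>std_normal)"
    proof (rule Bochner_Integration.integral_norm_bound_integral)
      fix r
      have "vec2 (x $ 1 + s / c) (x $ 2 + r / c) - x = vec2 (s / c) (r / c)"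
        by (simp add: vec_eq_iff forall_2)
      then have "norm (vec2 (x $ 1 + s / c) (x $ 2 + r / c) - x) \<le> \<bar>s\<bar> / c + \<bar>r\<bar> / c"
        using norm_vec2_le[of "s / c" "r / c"] c by (simp add: abs_divide)
      then have "\<Lambda> * norm (vec2 (x $ 1 + s / c) (x $ 2 + r / c) - x) \<le> \<Lambda> * (\<bar>s\<bar> / c + \<bar>r\<bar> / c)"
        using \<Lambda> by (rule mult_left_mono)
      then show "norm (g (vec2 (x $ 1 + s / c) (x $ 2 + r / c)) - g x) \<le> (\<epsilon> + \<Lambda> / c * \<bar>s\<bar>) + \<Lambda> / c * \<bar>r\<bar>"
        using lip[of "vec2 (x $ 1 + s / c) (x $ 2 + r / c)" x] by (simp add: distrib_left)
    qed (use int_g abs_int in auto)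
    also have "\<dots> = \<epsilon> + \<Lambda> / c * \<bar>s\<bar> + \<Lambda> / c * m"
      using abs_int G.prob_space by (simp add: m_def)
    also have "(\<integral>r. g (vec2 (x $ 1 + s / c) (x $ 2 + r / c)) - g x \<partial>std_normal) = I x s - g x"
      unfolding I_def using int_g G.prob_space by simp
    finally show ?thesis by simp
  qed
  have smooth: "smooth c g x = (\<integral>s. I x s \<partial>std_normal)" for x unfolding smooth_def I_def ..
  have close: "\<bar>smooth c g x - g x\<bar> \<le> \<epsilon> + 2 * \<Lambda> * m / c" for x
  proof -
    have "norm (\<integral>s. I x s - g x \<partial>std_normal) \<le> (\<integral>s. (\<epsilon> + \<Lambda> / c * m) + \<Lambda> / c * \<bar>s\<bar> \<partial>std_normal)"
    proof (rule Bochner_Integration.integral_norm_bound_integral)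
      show "norm (I x s - g x) \<le> (\<epsilon> + \<Lambda> / c * m) + \<Lambda> / c * \<bar>s\<bar>" for s using I_close[of x s] by simp
    qed (use int_I abs_int in auto)
    also have "\<dots> = \<epsilon> + 2 * \<Lambda> * m / c" using abs_int G.prob_space by (simp add: m_def)
    also have "(\<integral>s. I x s - g x \<partial>std_normal) = smooth c g x - g x"
      unfolding smooth using int_I G.prob_space by simp
    finally show ?thesis by simp
  qed
  have smooth_bd: "\<bar>smooth c g x\<bar> \<le> B" for x
  proof -
    have "norm (smooth c g x) \<le> (\<integral>s. B \<partial>std_normal)"
      unfolding smooth by (rule Bochner_Integration.integral_norm_bound_integral[OF int_I]) (use I_bd in auto)
    then show ?thesis using G.prob_space by simp
  qed
  have smooth_meas: "smooth c g \<in> borel_measurable M" unfolding smooth_def[abs_def] by measurable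
  have g_meas: "g \<in> borel_measurable M" using g_measurable measurable_cong_sets[OF M(2) refl] by blast
  have int: "integrable M (smooth c g)" "integrable M g"
    by (rule M.integrable_const_bound[where B = B]; use smooth_bd B smooth_meas g_meas in auto)+
  have "norm (\<integral>x. smooth c g x - g x \<partial>M) \<le> (\<integral>x. \<epsilon> + 2 * \<Lambda> * m / c \<partial>M)"
    by (rule Bochner_Integration.integral_norm_bound_integral) (use int close in auto)
  then show ?thesis using int M.prob_space by (simp add: m_def)
qed

end

text \<open>Points closer than \<open>h\<close> are handled by uniform continuity on a ball; for
  points at distance at least \<open>h\<close> the trivial bound \<open>2 * B\<close> is below
  \<open>\<Lambda> * h\<close>.\<close>

lemma compact_support_modulus:
  fixes g :: "real^2 \<Rightarrow> real"
  assumes g: "continuous_on UNIV g" and B: "\<And>x. \<bar>g x\<bar> \<le> B" and supp: "\<forall>x. L < norm x \<longrightarrow> g x = 0" and \<epsilon>: "0 < \<epsilon>"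
  obtains \<Lambda> where "0 \<le> \<Lambda>" "\<And>x y. \<bar>g x - g y\<bar> \<le> \<epsilon> + \<Lambda> * norm (x - y)"
proof -
  have "uniformly_continuous_on (cball 0 (L + 1)) g"
    using g by (intro compact_uniformly_continuous) (auto intro: continuous_on_subset)
  then obtain d where d: "0 < d" "\<And>x y. x \<in> cball 0 (L + 1) \<Longrightarrow> y \<in> cball 0 (L + 1) \<Longrightarrow> dist y x < d \<Longrightarrow> dist (g y) (g x) < \<epsilon>"
    unfolding uniformly_continuous_on_def using \<epsilon> by metis
  \<comment> \<open>The bound 1 matches the enlarged radius \<open>L + 1\<close>: if one of two
    close points lies beyond it, both lie where \<open>g\<close> vanishes.\<close>
  define h where "h = min d 1"
  have h: "0 < h" "h \<le> d" "h \<le> 1" using d(1) by (auto simp: h_def)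
  have B0: "0 \<le> B" using B[of 0] by linarith
  show ?thesis
  proof (rule that[of "2 * B / h"])
    fix x y :: "real^2"
    show "\<bar>g x - g y\<bar> \<le> \<epsilon> + 2 * B / h * norm (x - y)"
    proof (cases "norm (x - y) < h")
      case True
      have tri: "norm x \<le> norm y + norm (x - y)" "norm y \<le> norm x + norm (x - y)"
        using norm_triangle_sub[of x y] norm_triangle_sub[of y x] by (auto simp: norm_minus_commute)
      have "\<bar>g x - g y\<bar> \<le> \<epsilon>"
      proof (cases "norm x \<le> L + 1 \<and> norm y \<le> L + 1")
        case True
        then have "dist (g x) (g y) < \<epsilon>"
          using d(2)[of y x] \<open>norm (x - y) < h\<close> h by (auto simp: dist_norm)
        then show ?thesis by (simp add: dist_real_def)
      next
        case False
        then have "L < norm x" "L < norm y" using tri True h(3) by linarith+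
        then show ?thesis using supp \<epsilon> by simp
      qed
      moreover have "0 \<le> 2 * B / h * norm (x - y)" using B0 h by simp
      ultimately show ?thesis by linarith
    next
      case False
      have "2 * B / h * h \<le> 2 * B / h * norm (x - y)" using False B0 h by (intro mult_left_mono) auto
      then have "2 * B \<le> 2 * B / h * norm (x - y)" using h by simp
      then show ?thesis using B[of x] B[of y] \<epsilon> by linarith
    qed
  qed (use B0 h in simp)
qed

text \<open>The two exceptional lines are a null set, which dominated convergence under the Gaussian
  smoothing does not see.\<close>

theorem conv_in_distr_char2:
  assumes M: "\<And>j. prob_space (M j)" "\<And>j. sets (M j) = sets borel" and N: "prob_space N" "sets N = sets borel"
    and conv: "\<And>a b. b \<noteq> 0 \<Longrightarrow> a + b \<noteq> 0 \<Longrightarrow> (\<lambda>j. char2 (M j) a b) \<longlonglongrightarrow> char2 N a b"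
  shows "conv_in_distr M N"
proof -
  have vague: "(\<lambda>j. \<integral>x. g x \<partial>M j) \<longlonglongrightarrow> (\<integral>x. g x \<partial>N)"
    if g: "continuous_on UNIV g" "\<And>x. \<bar>g x\<bar> \<le> B" "\<forall>x. L < norm x \<longrightarrow> g x = 0" for g :: "real^2 \<Rightarrow> real" and B L
  proof (rule LIMSEQ_I)
    fix r :: real assume r: "0 < r"
    have r8: "0 < r / 8" using r by simp
    obtain \<Lambda> where \<Lambda>: "0 \<le> \<Lambda>" "\<And>x y. \<bar>g x - g y\<bar> \<le> r / 8 + \<Lambda> * norm (x - y)"
      by (rule compact_support_modulus[OF g r8]) (rule that)
    define m where "m = (\<integral>s. \<bar>s\<bar> \<partial>std_normal)"
    have m0: "0 \<le> m" unfolding m_def by (intro integral_nonneg_AE) auto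
    \<comment> \<open>Large enough for \<open>2 * \<Lambda> * m / c \<le> r / 8\<close>; the summand
      1 keeps \<open>c\<close> positive when the product is 0.\<close>
    define c where "c = 16 * \<Lambda> * m / r + 1"
    have c: "0 < c" using \<Lambda> m0 r by (simp add: c_def add_nonneg_pos)
    have "2 * \<Lambda> * m \<le> r / 8 * c" using r by (simp add: c_def field_simps)
    then have cl: "2 * \<Lambda> * m / c \<le> r / 8" using c by (simp add: divide_le_eq)
    have close: "\<bar>(\<integral>x. smooth c g x \<partial>Q) - (\<integral>x. g x \<partial>Q)\<bar> \<le> r / 4" if "prob_space Q" "sets Q = sets borel" for Q
      using smooth_close[OF g c \<Lambda>(2,1) that] cl unfolding m_def[symmetric] by linarith
    have "(\<lambda>j. \<integral>x. smooth c g x \<partial>M j) \<longlonglongrightarrow> (\<integral>x. smooth c g x \<partial>N)"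
      by (rule integral_smooth_lim[OF g c M N conv])
    then obtain j0 where j0: "\<And>j. j \<ge> j0 \<Longrightarrow> norm ((\<integral>x. smooth c g x \<partial>M j) - (\<integral>x. smooth c g x \<partial>N)) < r / 4"
      using r LIMSEQ_D[of _ _ "r / 4"] by (metis zero_less_divide_iff zero_less_numeral)
    have "norm ((\<integral>x. g x \<partial>M j) - (\<integral>x. g x \<partial>N)) < r" if "j \<ge> j0" for j
      using j0[OF that] close[OF M(1,2), of j] close[OF N] r unfolding real_norm_def by linarith
    then show "\<exists>no. \<forall>j\<ge>no. norm ((\<integral>x. g x \<partial>M j) - (\<integral>x. g x \<partial>N)) < r" by blast
  qed
  show ?thesis
    unfolding conv_in_distr_def
  proof (intro allI impI)
    fix f :: "real^2 \<Rightarrow> real" assume f: "continuous_on UNIV f" and bdd: "bounded (range f)"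
    obtain B where B: "\<And>x. \<bar>f x\<bar> \<le> B" using bdd by (auto simp: bounded_iff)
    have B0: "0 \<le> B" using B[of 0] by linarith
    define cut where "cut L x = max 0 (min 1 (L + 1 - norm x))" for L :: real and x :: "real^2"
    have cut: "continuous_on UNIV (cut L)" "0 \<le> cut L x" "cut L x \<le> 1" "L + 1 < norm x \<Longrightarrow> cut L x = 0" for L x
      unfolding cut_def by (auto intro!: continuous_intros)
    have meas: "h \<in> borel_measurable Q" if "continuous_on UNIV h" "sets Q = sets borel" for h :: "real^2 \<Rightarrow> real" and Q
      using borel_measurable_continuous_onI[OF that(1)] measurable_cong_sets[OF that(2) refl] by blast
    \<comment> \<open>Tightness comes from the limit: the mass lost outside a ball is measured by
      \<open>cut\<close>, itself an admissible test function, and \<open>N\<close> has total mass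
      1.\<close>
    have tail: "\<bar>(\<integral>x. f x \<partial>Q) - (\<integral>x. f x * cut L x \<partial>Q)\<bar> \<le> B * (1 - (\<integral>x. cut L x \<partial>Q))"
      if Q: "prob_space Q" "sets Q = sets borel" for Q L
    proof -
      interpret Q: prob_space Q by fact
      have int: "integrable Q f"
        by (rule Q.integrable_const_bound[where B = B]) (use B f Q(2) meas in auto)
      have int_cut: "integrable Q (cut L)"
        by (rule Q.integrable_const_bound[where B = 1]) (use cut Q(2) meas in auto)
      have int_mult: "integrable Q (\<lambda>x. f x * cut L x)"
      proof (rule Q.integrable_const_bound[where B = B])
        show "AE x in Q. norm (f x * cut L x) \<le> B"
        proof (rule AE_I2)
          fix x
          show "norm (f x * cut L x) \<le> B"
            using mult_mono[OF B[of x] cut(3)[of L x]] B0 cut(2)[of L x] by (simp add: abs_mult)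
        qed
        show "(\<lambda>x. f x * cut L x) \<in> borel_measurable Q"
          using f cut(1) Q(2) by (intro meas continuous_on_mult)
      qed
      note int = int int_cut int_mult
      have "norm (\<integral>x. f x - f x * cut L x \<partial>Q) \<le> (\<integral>x. B * (1 - cut L x) \<partial>Q)"
      proof (rule Bochner_Integration.integral_norm_bound_integral)
        fix x
        have "f x - f x * cut L x = f x * (1 - cut L x)" by (simp add: algebra_simps)
        then show "norm (f x - f x * cut L x) \<le> B * (1 - cut L x)"
          using B[of x] cut(3)[of L x] by (simp add: abs_mult mult_right_mono)
      qed (use int in auto)
      then show ?thesis using int Q.prob_space by simp
    qed
    have cut_lim: "(\<lambda>k. \<integral>x. cut (real k) x \<partial>N) \<longlonglongrightarrow> 1"
    proof -
      interpret N: prob_space N by fact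
      have "(\<lambda>k. \<integral>x. cut (real k) x \<partial>N) \<longlonglongrightarrow> (\<integral>x. 1 \<partial>N)"
      proof (rule integral_dominated_convergence[where w = "\<lambda>_. 1"])
        show "AE x in N. (\<lambda>k. cut (real k) x) \<longlonglongrightarrow> 1"
        proof (rule AE_I2)
          fix x :: "real^2"
          obtain k0 :: nat where "norm x \<le> real k0" using real_arch_simple by blast
          then have "cut (real k) x = 1" if "k0 \<le> k" for k using that by (simp add: cut_def)
          then show "(\<lambda>k. cut (real k) x) \<longlonglongrightarrow> 1"
            by (intro tendsto_eventually) (auto simp: eventually_sequentially)
        qed
      qed (use cut N(2) meas in auto)
      then show ?thesis by (simp add: N.prob_space)
    qed
    show "(\<lambda>j. integral\<^sup>L (M j) f) \<longlonglongrightarrow> integral\<^sup>L N f"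
    proof (rule LIMSEQ_I)
      fix r :: real assume r: "0 < r"
      \<comment> \<open>The two tails, of \<open>M j\<close> in the limit and of \<open>N\<close>,
        then take up at most \<open>r / 2\<close>.\<close>
      define \<epsilon> where "\<epsilon> = r / (4 * (B + 1))"
      have \<epsilon>: "0 < \<epsilon>" "B * (2 * \<epsilon>) \<le> r / 2" using r B0 by (auto simp: \<epsilon>_def field_simps)
      obtain k where "norm ((\<integral>x. cut (real k) x \<partial>N) - 1) < \<epsilon>"
        using LIMSEQ_D[OF cut_lim \<epsilon>(1)] by blast
      then have k: "1 - (\<integral>x. cut (real k) x \<partial>N) < \<epsilon>" unfolding real_norm_def by linarith
      have c1: "(\<lambda>j. \<integral>x. cut (real k) x \<partial>M j) \<longlonglongrightarrow> (\<integral>x. cut (real k) x \<partial>N)"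
        by (rule vague[where B = 1 and L = "real k + 1"]) (use cut in auto)
      have c2: "(\<lambda>j. \<integral>x. f x * cut (real k) x \<partial>M j) \<longlonglongrightarrow> (\<integral>x. f x * cut (real k) x \<partial>N)"
      proof (rule vague[where B = B and L = "real k + 1"])
        show "\<bar>f x * cut (real k) x\<bar> \<le> B" for x
          using mult_mono[OF B[of x] cut(3)[of "real k" x]] B0 cut(2)[of "real k" x] by (simp add: abs_mult)
      qed (use cut f in \<open>auto intro!: continuous_intros\<close>)
      have "(\<lambda>j. B * (1 - (\<integral>x. cut (real k) x \<partial>M j)) + B * (1 - (\<integral>x. cut (real k) x \<partial>N)) + \<bar>(\<integral>x. f x * cut (real k) x \<partial>M j) - (\<integral>x. f x * cut (real k) x \<partial>N)\<bar>)
        \<longlonglongrightarrow> B * (1 - (\<integral>x. cut (real k) x \<partial>N)) + B * (1 - (\<integral>x. cut (real k) x \<partial>N)) + \<bar>(\<integral>x. f x * cut (real k) x \<partial>N) - (\<integral>x. f x * cut (real k) x \<partial>N)\<bar>"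
        by (intro tendsto_intros c1 c2)
      moreover have "B * (1 - (\<integral>x. cut (real k) x \<partial>N)) + B * (1 - (\<integral>x. cut (real k) x \<partial>N)) + \<bar>(\<integral>x. f x * cut (real k) x \<partial>N) - (\<integral>x. f x * cut (real k) x \<partial>N)\<bar> < r"
      proof -
        have "B * (1 - (\<integral>x. cut (real k) x \<partial>N)) \<le> B * \<epsilon>" using k B0 by (intro mult_left_mono) auto
        then show ?thesis using \<epsilon>(2) r by simp
      qed
      ultimately have "\<forall>\<^sub>F j in sequentially. B * (1 - (\<integral>x. cut (real k) x \<partial>M j)) + B * (1 - (\<integral>x. cut (real k) x \<partial>N)) + \<bar>(\<integral>x. f x * cut (real k) x \<partial>M j) - (\<integral>x. f x * cut (real k) x \<partial>N)\<bar> < r"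
        by (rule order_tendstoD(2))
      then have "\<forall>\<^sub>F j in sequentially. norm (integral\<^sup>L (M j) f - integral\<^sup>L N f) < r"
      proof eventually_elim
        case (elim j)
        then show ?case using tail[OF M(1,2), of j "real k"] tail[OF N, of "real k"] unfolding real_norm_def by linarith
      qed
      then show "\<exists>no. \<forall>j\<ge>no. norm (integral\<^sup>L (M j) f - integral\<^sup>L N f) < r"
        by (simp add: eventually_sequentially)
    qed
  qed
qed

section \<open>The limiting normal law\<close>


lemma char_normal_density:
  assumes "0 < v"
  shows "char (density lborel (\<lambda>x. ennreal (normal_density 0 (sqrt v) x))) u = of_real (exp (- v * u\<^sup>2 / 2))"
proof -
  interpret G: prob_space std_normal by (rule prob_space_std_normal)
  have "distributed std_normal lborel (\<lambda>x. x) (normal_density 0 1)"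
    by (auto simp: distributed_def distr_id2)
  then have "distributed std_normal lborel (\<lambda>x. 0 + sqrt v * x) (normal_density (0 + sqrt v * 0) (\<bar>sqrt v\<bar> * 1))"
    using assms by (intro G.normal_density_affine) auto
  then have "distr std_normal lborel (\<lambda>x. sqrt v * x) = density lborel (\<lambda>x. ennreal (normal_density 0 (sqrt v) x))"
    using assms by (simp add: distributed_def)
  then have "char (density lborel (\<lambda>x. ennreal (normal_density 0 (sqrt v) x))) u
      = (\<integral>x. exp (\<i> * of_real (u * x)) \<partial>distr std_normal lborel (\<lambda>x. sqrt v * x))"
    by (simp add: char_def)
  also have "\<dots> = (\<integral>s. exp (\<i> * of_real (u * (sqrt v * s))) \<partial>std_normal)"
    by (rule integral_distr) measurable
  also have "\<dots> = (\<integral>s. exp (\<i> * of_real (u * sqrt v * s)) \<partial>std_normal)" by (simp only: mult.assoc)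
  also have "\<dots> = of_real (exp (- (u * sqrt v)\<^sup>2 / 2))" by (rule std_normal_char)
  also have "(u * sqrt v)\<^sup>2 = v * u\<^sup>2" using assms by (simp add: power_mult_distrib)
  finally show ?thesis by simp
qed

text \<open>Uniqueness of characteristic functions; variance 0 is the point mass, whose
  characteristic function is constantly 1.\<close>

lemma is_normal1_char:
  assumes M: "real_distribution M" and v: "0 \<le> v" and char: "\<And>u. char M u = of_real (exp (- v * u\<^sup>2 / 2))"
  shows "is_normal1 0 v M"
proof (cases "v = 0")
  case True
  have "real_distribution (return borel (0::real))"
    by (auto simp: real_distribution_def real_distribution_axioms_def intro: prob_space_return)
  moreover have "char M = char (return borel 0)"
    using char True by (auto simp: char_def integral_return fun_eq_iff)
  ultimately have "M = return borel 0" using M by (intro Levy_uniqueness) auto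
  then show ?thesis using True by (simp add: is_normal1_def)
next
  case False
  then have v: "0 < v" using v by simp
  have "real_distribution (density lborel (\<lambda>x. ennreal (normal_density 0 (sqrt v) x)))"
    using v prob_space_normal_density[of "sqrt v" 0] by (auto simp: real_distribution_def real_distribution_axioms_def)
  moreover have "char M = char (density lborel (\<lambda>x. ennreal (normal_density 0 (sqrt v) x)))"
    using char char_normal_density[OF v] by (simp add: fun_eq_iff)
  ultimately have "M = density lborel (\<lambda>x. ennreal (normal_density 0 (sqrt v) x))"
    using M by (intro Levy_uniqueness) auto
  then show ?thesis using v by (simp add: is_normal1_def)
qed

text \<open>A lower triangular matrix applied to two independent standard normal variables. The
  covariance is then given by its Cholesky factor, and degenerate laws are included.\<close>

definition lower_normal :: "real \<Rightarrow> real \<Rightarrow> real \<Rightarrow> (real^2) measure" where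
  "lower_normal A B D = distr (std_normal \<Otimes>\<^sub>M std_normal) borel (\<lambda>p. vec2 (A * fst p) (B * fst p + D * snd p))"

lemma lower_normal_map: "(\<lambda>p. vec2 (A * fst p) (B * fst p + D * snd p)) \<in> borel_measurable (std_normal \<Otimes>\<^sub>M std_normal)"
  by measurable

lemma prob_space_lower_normal: "prob_space (lower_normal A B D)" "sets (lower_normal A B D) = sets borel"
proof -
  interpret G: prob_space std_normal by (rule prob_space_std_normal)
  interpret P: pair_prob_space std_normal std_normal ..
  show "prob_space (lower_normal A B D)"
    unfolding lower_normal_def by (rule P.prob_space_distr[OF lower_normal_map])
  show "sets (lower_normal A B D) = sets borel" by (simp add: lower_normal_def)
qed

lemma char2_lower_normal:
  "char2 (lower_normal A B D) a b = of_real (exp (- ((a * A + b * B)\<^sup>2 + (b * D)\<^sup>2) / 2))"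
proof -
  interpret G: prob_space std_normal by (rule prob_space_std_normal)
  interpret P: pair_prob_space std_normal std_normal ..
  let ?f = "\<lambda>p. exp (\<i> * complex_of_real (a * (A * fst p) + b * (B * fst p + D * snd p)))"
  have "char2 (lower_normal A B D) a b = (\<integral>p. ?f p \<partial>(std_normal \<Otimes>\<^sub>M std_normal))"
    unfolding char2_def lower_normal_def by (subst integral_distr[OF lower_normal_map]) simp_all
  also have "\<dots> = (\<integral>s. (\<integral>r. ?f (s, r) \<partial>std_normal) \<partial>std_normal)"
  proof (rule P.integral_fst'[symmetric])
    show "integrable (std_normal \<Otimes>\<^sub>M std_normal) ?f"
    proof (rule P.integrable_const_bound[where B = 1])
      show "AE p in std_normal \<Otimes>\<^sub>M std_normal. norm (?f p) \<le> 1"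
        by (simp only: norm_exp_i_times) simp
    qed measurable
  qed
  also have "\<dots> = (\<integral>s. (\<integral>r. exp (\<i> * of_real ((a * A + b * B) * s)) * exp (\<i> * of_real (b * D * r)) \<partial>std_normal) \<partial>std_normal)"
    by (intro Bochner_Integration.integral_cong refl) (simp add: exp_add[symmetric] algebra_simps)
  also have "\<dots> = (\<integral>s. exp (\<i> * of_real ((a * A + b * B) * s)) * of_real (exp (- (b * D)\<^sup>2 / 2)) \<partial>std_normal)"
    by (simp only: integral_mult_right_zero std_normal_char)
  also have "\<dots> = of_real (exp (- (a * A + b * B)\<^sup>2 / 2)) * of_real (exp (- (b * D)\<^sup>2 / 2))"
    by (simp only: integral_mult_left_zero std_normal_char)
  also have "\<dots> = of_real (exp (- ((a * A + b * B)\<^sup>2 + (b * D)\<^sup>2) / 2))"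
    unfolding of_real_mult[symmetric] exp_add[symmetric] by (simp add: add_divide_distrib)
  finally show ?thesis .
qed

lemma inner_vec2: "(t::real^2) \<bullet> x = t $ 1 * x $ 1 + t $ 2 * x $ 2"
  by (simp add: inner_vec_def sum_2)

lemma is_normal_lower_normal:
  assumes S: "S $ 1 $ 1 = A\<^sup>2" "S $ 1 $ 2 = A * B" "S $ 2 $ 1 = A * B" "S $ 2 $ 2 = B\<^sup>2 + D\<^sup>2"
  shows "is_normal 0 S (lower_normal A B D)"
  unfolding is_normal_def
proof (intro conjI allI)
  show "prob_space (lower_normal A B D)" "sets (lower_normal A B D) = sets borel" by (rule prob_space_lower_normal)+
  show "S $ i $ j = S $ j $ i" for i j
    using S exhaust_2[of i] exhaust_2[of j] by auto
next
  fix t :: "real^2"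
  interpret N: prob_space "lower_normal A B D" by (rule prob_space_lower_normal)
  have "continuous_on UNIV (\<lambda>x. t \<bullet> x)" by (intro continuous_intros)
  then have meas: "(\<lambda>x. t \<bullet> x) \<in> borel_measurable (lower_normal A B D)"
    using borel_measurable_continuous_onI measurable_cong_sets[OF prob_space_lower_normal(2) refl] by blast
  have var: "t \<bullet> (S *v t) = (t $ 1 * A + t $ 2 * B)\<^sup>2 + (t $ 2 * D)\<^sup>2"
    using S by (simp add: inner_vec2 matrix_vector_mult_def sum_2 power2_eq_square algebra_simps)
  have "is_normal1 0 ((t $ 1 * A + t $ 2 * B)\<^sup>2 + (t $ 2 * D)\<^sup>2) (distr (lower_normal A B D) borel (\<lambda>x. t \<bullet> x))"
  proof (rule is_normal1_char)
    show "real_distribution (distr (lower_normal A B D) borel (\<lambda>x. t \<bullet> x))"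
      using N.prob_space_distr[OF meas] by (auto simp: real_distribution_def real_distribution_axioms_def)
    fix u
    have "char (distr (lower_normal A B D) borel (\<lambda>x. t \<bullet> x)) u = (\<integral>x. exp (\<i> * of_real (u * (t \<bullet> x))) \<partial>lower_normal A B D)"
      unfolding char_def by (rule integral_distr[OF meas]) measurable
    also have "\<dots> = char2 (lower_normal A B D) (u * t $ 1) (u * t $ 2)"
      unfolding char2_def by (simp add: inner_vec2 algebra_simps)
    also have "\<dots> = of_real (exp (- ((t $ 1 * A + t $ 2 * B)\<^sup>2 + (t $ 2 * D)\<^sup>2) * u\<^sup>2 / 2))"
      unfolding char2_lower_normal by (simp add: power2_eq_square algebra_simps)
    finally show "char (distr (lower_normal A B D) borel (\<lambda>x. t \<bullet> x)) u
      = of_real (exp (- ((t $ 1 * A + t $ 2 * B)\<^sup>2 + (t $ 2 * D)\<^sup>2) * u\<^sup>2 / 2))" .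
  qed simp
  then show "is_normal1 (t \<bullet> 0) (t \<bullet> (S *v t)) (distr (lower_normal A B D) borel ((\<bullet>) t))"
    unfolding var by simp
qed

text \<open>The off-diagonal entry is half the upper left one, so \<open>B = A / 2\<close> solves
  the factorization without a division, even at \<alpha> = 1 where \<open>A = 0\<close>. For
  \<open>D\<close>, 48 times the remaining entry is
  \<open>(1 - \<alpha>^3) / 3 + 3 (\<alpha>^3 - \<alpha>^4)\<close>, which is nonnegative.\<close>

lemma Sigma_mat_factor:
  fixes \<alpha> :: real
  assumes "0 \<le> \<alpha>" "\<alpha> \<le> 1"
  obtains A B D where "A\<^sup>2 = 1/12 * (1 - 4 * \<alpha>^3 + 3 * \<alpha>^4)" "A * B = 1/24 * (1 - 4 * \<alpha>^3 + 3 * \<alpha>^4)"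
    "B\<^sup>2 + D\<^sup>2 = 1/36 * (1 - \<alpha>^3)"
proof -
  define p where "p = 1 - 4 * \<alpha>^3 + 3 * \<alpha>^4"
  \<comment> \<open>Splitting off the double root at 1 makes the sign visible.\<close>
  have "p = (1 - \<alpha>)\<^sup>2 * (1 + 2 * \<alpha> + 3 * \<alpha>\<^sup>2)"
    unfolding p_def by (simp add: power2_eq_square power3_eq_cube power4_eq_xxxx algebra_simps)
  then have p: "0 \<le> p" using assms by simp
  have "\<alpha>^4 \<le> \<alpha>^3" using assms by (intro power_decreasing) auto
  moreover have "\<alpha>^3 \<le> 1" using assms by (simp add: power_le_one)
  ultimately have d: "0 \<le> 1/36 * (1 - \<alpha>^3) - p / 48" unfolding p_def by (simp add: field_simps)
  show ?thesis
  proof (rule that[of "sqrt (p / 12)" "sqrt (p / 12) / 2" "sqrt (1/36 * (1 - \<alpha>^3) - p / 48)"])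
    show "(sqrt (p / 12))\<^sup>2 = 1/12 * (1 - 4 * \<alpha>^3 + 3 * \<alpha>^4)"
      using p by (simp add: p_def[symmetric])
    have "sqrt (p / 12) * sqrt (p / 12) = p / 12" using p by simp
    then show "sqrt (p / 12) * (sqrt (p / 12) / 2) = 1/24 * (1 - 4 * \<alpha>^3 + 3 * \<alpha>^4)"
      unfolding p_def[symmetric] by (simp add: field_simps)
    show "(sqrt (p / 12) / 2)\<^sup>2 + (sqrt (1/36 * (1 - \<alpha>^3) - p / 48))\<^sup>2 = 1/36 * (1 - \<alpha>^3)"
      using p d by (simp add: power_divide real_sqrt_pow2)
  qed
qed

lemma powr_three_halves: "0 < x \<Longrightarrow> x powr (3/2) = x * sqrt x" for x :: real
proof -
  assume "0 < x"
  have "x powr (1 + 1/2) = x powr 1 * x powr (1/2)" by (rule powr_add)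
  then show ?thesis using \<open>0 < x\<close> by (simp add: powr_half_sqrt)
qed

theorem theorem1p2:
  fixes \<alpha> :: real and n :: "nat \<Rightarrow> nat" and lam :: "nat \<Rightarrow> nat \<Rightarrow> nat"
  assumes "0 \<le> \<alpha>" and "\<alpha> \<le> 1"
    and "\<And>j. n j \<ge> 1"
    and "\<And>j. partition_of (lam j) (n j)"
    and "filterlim n at_top sequentially"
    and "(\<lambda>j. fix_density (n j) (lam j)) \<longlonglongrightarrow> \<alpha>"
  shows "\<exists>N. is_normal 0 (Sigma_mat \<alpha>) N \<and> conv_in_distr (\<lambda>j. W_law (n j) (lam j)) N"
proof -
  interpret density_sequence n lam \<alpha>
    using assms by unfold_locales (auto simp: fix_density_def)
  obtain A B D where ABD: "A\<^sup>2 = 1/12 * (1 - 4 * \<alpha>^3 + 3 * \<alpha>^4)" "A * B = 1/24 * (1 - 4 * \<alpha>^3 + 3 * \<alpha>^4)"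
    "B\<^sup>2 + D\<^sup>2 = 1/36 * (1 - \<alpha>^3)"
    using Sigma_mat_factor[OF assms(1,2)] .
  have "is_normal 0 (Sigma_mat \<alpha>) (lower_normal A B D)"
    by (rule is_normal_lower_normal) (simp_all add: Sigma_mat_def ABD)
  moreover have "conv_in_distr (\<lambda>j. W_law (n j) (lam j)) (lower_normal A B D)"
  proof (rule conv_in_distr_char2)
    show "prob_space (W_law (n j) (lam j))" for j
      unfolding W_law_def by (rule measure_pmf.prob_space_distr) simp
    show "sets (W_law (n j) (lam j)) = sets borel" for j by (simp add: W_law_def)
    fix a b :: real assume ab: "b \<noteq> 0" "a + b \<noteq> 0"
    have "char2 (W_law (n j) (lam j)) a b = avg j (\<lambda>\<pi>. exp (\<i> * of_real (proj a b j \<pi>)))" for j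
    proof -
      have n0: "0 < real (n j)" using assms(3)[of j] by simp
      have proj: "a * W_stat (n j) (lam j) \<pi> $ 1 + b * W_stat (n j) (lam j) \<pi> $ 2 = proj a b j \<pi>" for \<pi>
        using n0 by (simp add: W_stat_def proj_def dens_def fix_density_def powr_half_sqrt powr_three_halves)
      have "char2 (W_law (n j) (lam j)) a b
          = (\<integral>\<pi>. exp (\<i> * of_real (a * W_stat (n j) (lam j) \<pi> $ 1 + b * W_stat (n j) (lam j) \<pi> $ 2)) \<partial>measure_pmf (pmf_of_set (cls j)))"
        unfolding char2_def W_law_def by (rule integral_distr) auto
      \<comment> \<open>The class is finite and, by the class size formula, nonempty; so
        \<open>pmf_of_set\<close> is the uniform law and the integral a finite average.\<close>
      also have "\<dots> = avg j (\<lambda>\<pi>. exp (\<i> * of_real (a * W_stat (n j) (lam j) \<pi> $ 1 + b * W_stat (n j) (lam j) \<pi> $ 2)))"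
        using cls_ne[of j] by (subst integral_measure_pmf[of "cls j"])
          (auto simp: avg_def scaleR_conv_of_real sum_divide_distrib)
      also have "\<dots> = avg j (\<lambda>\<pi>. exp (\<i> * of_real (proj a b j \<pi>)))" by (simp only: proj)
      finally show ?thesis .
    qed
    moreover have "char2 (lower_normal A B D) a b = of_real (exp (- quad_form a b / 2))"
    proof -
      have "(a * A + b * B)\<^sup>2 + (b * D)\<^sup>2 = a\<^sup>2 * A\<^sup>2 + 2 * (a * b * (A * B)) + b\<^sup>2 * (B\<^sup>2 + D\<^sup>2)"
        by (simp add: power2_eq_square algebra_simps)
      also have "\<dots> = quad_form a b" unfolding ABD quad_form_def by (simp add: field_simps)
      finally show ?thesis unfolding char2_lower_normal by simp
    qed
    ultimately show "(\<lambda>j. char2 (W_law (n j) (lam j)) a b) \<longlonglongrightarrow> char2 (lower_normal A B D) a b"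
      using char_proj_lim[OF ab] by simp
  qed (rule prob_space_lower_normal)+
  ultimately show ?thesis by blast
qed

end
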